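(* Let $\mathbb{K}$ be a field, let $G$ be a finite simple chordal graph with vertex set $V(G)=\{x_1,\ldots,x_n\}$, and let $S=\mathbb{K}[x_1,\ldots,x_n]$ be the polynomial ring whose variables are the vertices of $G$. Then for every integer $s\geq 1$, $$\operatorname{depth} S/I(G)^{(s)}\geq \alpha_2(G)-s+1,$$ where $I(G)^{(s)}$ is the $s$-th symbolic power of the edge ideal $I(G)$ and $\alpha_2(G)$ is the star packing number of $G$.
   Context: A graph is chordal if it has no induced cycle of length at least four. The edge ideal of $G$ is $I(G)=(x_ix_j \mid x_ix_j\in E(G))\subseteq S$ (it is $0$ if $G$ has no edges). For an ideal $I$ of $S$ and an integer $s\ge 1$, the $s$-th symbolic power is $I^{(s)}=\bigcap_{\mathfrak{p}\in \mathrm{Min}(I)}\mathrm{Ker}(S\to (S/I^s)_{\mathfrak{p}})$, where $\mathrm{Min}(I)$ is the set of minimal primes of $I$. For edge ideals this equals $I(G)^{(s)}=\bigcap_{C\in\mathcal{C}(G)}\mathfrak{p}_C^s$, where $\mathcal{C}(G)$ is the set of minimal vertex covers of $G$ and $\mathfrak{p}_C$ is the prime ideal generated by the variables in $C$. For a vertex $x$, $N_G(x)$ is the set of vertices adjacent to $x$, and $N_G[x]=N_G(x)\cup\{x\}$. The star ${\rm St}(x)$ with center $x$ is the subgraph of $G$ with vertex set $N_G[x]$ and edge set $\{xy \mid y\in N_G(x)\}$. A star packing of $G$ is a family of stars in $G$ whose vertex sets are pairwise disjoint, and the star packing number $\alpha_2(G)$ is the largest cardinality of a star packing of $G$ (equivalently,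 the largest number of vertices of $G$ with pairwise disjoint closed neighborhoods $N_G[x]$). Depth is taken with respect to the graded maximal ideal $(x_1,\ldots,x_n)$. *)

theory Defs
  imports
    "HOL-Algebra.Algebra"
    "HOL-Algebra.Algebraic_Closure_Type"
    "HOL-Library.Poly_Mapping"
    "HOL-Library.Extended_Real"
begin

section \<open>Simple graphs\<close>

text \<open>
  The vertex set is the whole of a type \<open>'v\<close>, assumed finite in the theorem, and the graph is
  its adjacency relation.
\<close>

definition simple_graph :: "('v \<Rightarrow> 'v \<Rightarrow> bool) \<Rightarrow> bool" where
  "simple_graph E \<longleftrightarrow> symp E \<and> irreflp E"

text \<open>The vertices listed in \<open>vs\<close> induce a cycle, traversed in the order of the list.\<close>

definition induced_cycle :: "('v \<Rightarrow> 'v \<Rightarrow> bool) \<Rightarrow> 'v list \<Rightarrow> bool" where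
  "induced_cycle E vs \<longleftrightarrow>
     3 \<le> length vs \<and> distinct vs \<and>
     (\<forall>i < length vs. \<forall>j < length vs.
        E (vs ! i) (vs ! j) \<longleftrightarrow>
          j = Suc i mod length vs \<or> i = Suc j mod length vs)"

definition chordal :: "('v \<Rightarrow> 'v \<Rightarrow> bool) \<Rightarrow> bool" where
  "chordal E \<longleftrightarrow> \<not> (\<exists>vs. 4 \<le> length vs \<and> induced_cycle E vs)"

definition nbhd :: "('v \<Rightarrow> 'v \<Rightarrow> bool) \<Rightarrow> 'v \<Rightarrow> 'v set" where
  "nbhd E x = {y. E x y}"

definition closed_nbhd :: "('v \<Rightarrow> 'v \<Rightarrow> bool) \<Rightarrow> 'v \<Rightarrow> 'v set" where
  "closed_nbhd E x = insert x (nbhd E x)"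

text \<open>A star is a subgraph, given as the pair of its vertex set and its edge set.\<close>

definition star :: "('v \<Rightarrow> 'v \<Rightarrow> bool) \<Rightarrow> 'v \<Rightarrow> 'v set \<times> 'v set set" where
  "star E x = (closed_nbhd E x, {{x, y} | y. y \<in> nbhd E x})"

definition star_packing :: "('v \<Rightarrow> 'v \<Rightarrow> bool) \<Rightarrow> ('v set \<times> 'v set set) set \<Rightarrow> bool" where
  "star_packing E F \<longleftrightarrow>
     F \<subseteq> range (star E) \<and> pairwise (\<lambda>A B. disjnt (fst A) (fst B)) F"

definition star_packing_number :: "('v::finite \<Rightarrow> 'v \<Rightarrow> bool) \<Rightarrow> nat" where
  "star_packing_number E = Max {card F | F. star_packing E F}"


section \<open>Symbolic powers\<close>

definition minimal_primes :: "('a, 'b) ring_scheme \<Rightarrow> 'a set \<Rightarrow> 'a set set" where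
  "minimal_primes R I =
     {P. primeideal P R \<and> I \<subseteq> P \<and>
         (\<forall>Q. primeideal Q R \<and> I \<subseteq> Q \<and> Q \<subseteq> P \<longrightarrow> Q = P)}"

text \<open>
  Equality of the fractions \<open>a/u\<close> and \<open>b/v\<close> in the localization of the commutative ring
  \<open>R\<close> at the multiplicative set \<open>W\<close>.
\<close>

definition frac_rel :: "('a, 'b) ring_scheme \<Rightarrow> 'a set \<Rightarrow> (('a \<times> 'a) \<times> ('a \<times> 'a)) set" where
  "frac_rel R W =
     {((a, u), (b, v)). a \<in> carrier R \<and> b \<in> carrier R \<and> u \<in> W \<and> v \<in> W \<and>
        (\<exists>t \<in> W. t \<otimes>\<^bsub>R\<^esub> (v \<otimes>\<^bsub>R\<^esub> a \<ominus>\<^bsub>R\<^esub> u \<otimes>\<^bsub>R\<^esub> b) = \<zero>\<^bsub>R\<^esub>)}"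

definition to_localization ::
    "('a, 'b) ring_scheme \<Rightarrow> 'a set \<Rightarrow> 'a \<Rightarrow> ('a \<times> 'a) set" where
  "to_localization R W a = frac_rel R W `` {(a, \<one>\<^bsub>R\<^esub>)}"

text \<open>
  The kernel of \<open>R \<rightarrow> (R/J)\<^sub>P\<close>. The module \<open>(R/J)\<^sub>P\<close> is the localization of the ring
  \<open>R/J\<close> at the image of the complement of \<open>P\<close>.
\<close>

definition localization_kernel ::
    "('a, 'b) ring_scheme \<Rightarrow> 'a set \<Rightarrow> 'a set \<Rightarrow> 'a set" where
  "localization_kernel R J P =
     (let W = (\<lambda>u. J +>\<^bsub>R\<^esub> u) ` (carrier R - P) in
      {f \<in> carrier R. to_localization (R Quot J) W (J +>\<^bsub>R\<^esub> f)
                     = to_localization (R Quot J) W \<zero>\<^bsub>R Quot J\<^esub>})"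

definition symbolic_power :: "('a, 'b) ring_scheme \<Rightarrow> 'a set \<Rightarrow> nat \<Rightarrow> 'a set" where
  "symbolic_power R I s =
     carrier R \<inter>
     (\<Inter>P \<in> minimal_primes R I. localization_kernel R (I [^]\<^bsub>ideals_set R\<^esub> s) P)"


section \<open>Depth\<close>

definition nonzerodivisor :: "('a, 'b) ring_scheme \<Rightarrow> 'a \<Rightarrow> bool" where
  "nonzerodivisor R a \<longleftrightarrow>
     (\<forall>x \<in> carrier R. a \<otimes>\<^bsub>R\<^esub> x = \<zero>\<^bsub>R\<^esub> \<longrightarrow> x = \<zero>\<^bsub>R\<^esub>)"

text \<open>
  \<open>fs\<close> is a regular sequence in \<open>m\<close> on the module \<open>M = R/I\<close>, where
  \<open>M/(f\<^sub>1, \<dots>, f\<^sub>i)M\<close> is identified with \<open>R/(I + (f\<^sub>1, \<dots>, f\<^sub>i))\<close>.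
\<close>

definition regular_sequence_quot ::
    "('a, 'b) ring_scheme \<Rightarrow> 'a set \<Rightarrow> 'a set \<Rightarrow> 'a list \<Rightarrow> bool" where
  "regular_sequence_quot R m I fs \<longleftrightarrow>
     set fs \<subseteq> m \<and>
     (\<forall>i < length fs.
        let J = Idl\<^bsub>R\<^esub> (I \<union> set (take i fs))
        in nonzerodivisor (R Quot J) (J +>\<^bsub>R\<^esub> (fs ! i))) \<and>
     Idl\<^bsub>R\<^esub> (I \<union> set fs) \<noteq> carrier R"

text \<open>
  The depth of \<open>R/I\<close> with respect to \<open>m\<close>, for \<open>R/I \<noteq> 0\<close> (for \<open>R/I = 0\<close> the supremum
  is over the empty set and has the value \<open>0\<close>).
\<close>

definition depth_quot :: "('a, 'b) ring_scheme \<Rightarrow> 'a set \<Rightarrow> 'a set \<Rightarrow> enat" where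
  "depth_quot R m I = (SUP fs \<in> {fs. regular_sequence_quot R m I fs}. enat (length fs))"


section \<open>Edge ideals\<close>

text \<open>
  Polynomials are finitely supported maps from exponent vectors to coefficients; their product
  is the convolution product of \<^theory>\<open>HOL-Library.Poly_Mapping\<close>.
\<close>

type_synonym ('v, 'k) mpoly = "('v \<Rightarrow>\<^sub>0 nat) \<Rightarrow>\<^sub>0 'k"

definition polynomial_ring :: "('v, 'k::field) mpoly ring" where
  "polynomial_ring = ring_of_type_algebra"

definition Var :: "'v \<Rightarrow> ('v, 'k::field) mpoly" where
  "Var x = Poly_Mapping.single (Poly_Mapping.single x 1) 1"

definition graded_maximal_ideal :: "('v, 'k::field) mpoly set" where
  "graded_maximal_ideal = Idl\<^bsub>polynomial_ring\<^esub> (range Var)"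

definition edge_ideal :: "('v \<Rightarrow> 'v \<Rightarrow> bool) \<Rightarrow> ('v, 'k::field) mpoly set" where
  "edge_ideal E = Idl\<^bsub>polynomial_ring\<^esub> {Var x * Var y | x y. E x y}"

end

theory Submission
  imports Defs
begin

text \<open>A monomial \<open>x\<^sup>u\<close> lies outside \<open>I(G)\<^sup>(\<^sup>s\<^sup>)\<close> iff some vertex cover has \<open>u\<close>-weight less than \<open>s\<close>.
  Using a perfect elimination order of the chordal graph and the greedy weighted clique cover along it,
  the set of these exponents is partitioned into cones \<open>b + \<nat>\<^sup>F\<close> with
  \<open>card F \<ge> \<alpha>\<^sub>2(G) - s + 1\<close>, ordered so that every initial union of cones is closed under
  divisors. So \<open>S/I(G)\<^sup>(\<^sup>s\<^sup>)\<close> has a filtration whose factors are polynomial rings in at least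
  \<open>\<alpha>\<^sub>2(G) - s + 1\<close> variables. The elementary symmetric polynomials in all variables restrict to
  regular sequences on each of these polynomial rings, and a sequence that is regular on all factors of a filtration
  is regular on the whole module.\<close>

section \<open>Weights of vertex covers and cone decompositions\<close>

text \<open>The bound comes from duality: the least weight of a vertex cover equals the total
  overlap \<open>sum (ov u) UNIV\<close> of the greedy clique cover, so an exponent outside the
  symbolic power has overlap at most \<open>s - 1\<close>. Each unit of overlap spoils at most one
  of the pairwise disjoint closed neighbourhoods, and every other centre contributes a direction in
  which the exponent may grow. A partition into large cones alone bounds only the Stanley depth. To
  reach depth, the cones are indexed by data with a rank that is monotone in the exponent, which
  yields the required ordering. A second obstacle is that a single sequence must be regular on all
  factors at once, over an arbitrary field. Linear forms general enough for all factors may not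
  exist over a finite field. The elementary symmetric polynomials restrict on the variables in
  \<open>F\<close> to those of \<open>F\<close>, and the first \<open>card F\<close> of these are
  regular in every characteristic.\<close>

definition independent_set :: "('v \<Rightarrow> 'v \<Rightarrow> bool) \<Rightarrow> 'v set \<Rightarrow> bool" where
  "independent_set E F \<longleftrightarrow> (\<forall>x\<in>F. \<forall>y\<in>F. \<not> E x y)"

definition vertex_cover :: "('v \<Rightarrow> 'v \<Rightarrow> bool) \<Rightarrow> 'v set \<Rightarrow> bool" where
  "vertex_cover E C \<longleftrightarrow> (\<forall>x y. E x y \<longrightarrow> x \<in> C \<or> y \<in> C)"

lemma vertex_cover_Compl: "vertex_cover E (- F) \<longleftrightarrow> independent_set E F"
  unfolding vertex_cover_def independent_set_def by blast

definition small_cover_wts :: "('v::finite \<Rightarrow> 'v \<Rightarrow> bool) \<Rightarrow> nat \<Rightarrow> ('v \<Rightarrow> nat) set" where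
  "small_cover_wts E s = {u. \<exists>C. vertex_cover E C \<and> sum u C < s}"

definition coord_cone :: "('v \<Rightarrow> nat) \<Rightarrow> 'v set \<Rightarrow> ('v \<Rightarrow> nat) set" where
  "coord_cone b F = {u. b \<le> u \<and> (\<forall>i. i \<notin> F \<longrightarrow> u i = b i)}"

definition down_closed :: "('v \<Rightarrow> nat) set \<Rightarrow> bool" where
  "down_closed L \<longleftrightarrow> (\<forall>u\<in>L. \<forall>v\<le>u. v \<in> L)"

text \<open>Down-closed sets of exponents are those whose avoiding polynomials form an ideal.
  Demanding this before and after each step turns the list of cones into a chain of ideals; a mere
  partition into cones would give no filtration.\<close>

inductive cone_filtered :: "nat \<Rightarrow> ('v \<Rightarrow> nat) set \<Rightarrow> bool" for k where
  empty: "cone_filtered k {}"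
| add: "cone_filtered k L \<Longrightarrow> down_closed L \<Longrightarrow> down_closed (L \<union> coord_cone b F) \<Longrightarrow>
    L \<inter> coord_cone b F = {} \<Longrightarrow> k \<le> card F \<Longrightarrow> cone_filtered k (L \<union> coord_cone b F)"

text \<open>A fibre of largest rank can be added last: an exponent of \<open>L\<close> above one of
  its members has at least the same rank, hence the same label. So what remains after removing this
  fibre is closed under divisors.\<close>

lemma cone_filtered_by_rank:
  fixes \<phi> :: "('v \<Rightarrow> nat) \<Rightarrow> 'b" and \<rho> :: "'b \<Rightarrow> nat"
  assumes "finite (\<phi> ` L)" "down_closed L"
    and "\<And>u v. u \<in> L \<Longrightarrow> v \<in> L \<Longrightarrow> u \<le> v \<Longrightarrow>
      \<rho> (\<phi> u) \<le> \<rho> (\<phi> v) \<and> (\<rho> (\<phi> u) = \<rho> (\<phi> v) \<longrightarrow> \<phi> u = \<phi> v)"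
    and "\<And>u. u \<in> L \<Longrightarrow> \<exists>b F. k \<le> card F \<and> {v\<in>L. \<phi> v = \<phi> u} = coord_cone b F"
  shows "cone_filtered k L"
  using assms
proof (induction "card (\<phi> ` L)" arbitrary: L)
  case 0
  then have "\<phi> ` L = {}" by (metis card_0_eq)
  then have "L = {}" by blast
  then show ?case by (metis cone_filtered.empty)
next
  case (Suc n)
  note mono = Suc.prems(3) and fibre = Suc.prems(4)
  have fin: "finite (\<rho> ` \<phi> ` L)" using Suc.prems(1) by (rule finite_imageI)
  have "\<phi> ` L \<noteq> {}" using Suc.hyps(2) by (metis card.empty nat.distinct(1))
  then have "Max (\<rho> ` \<phi> ` L) \<in> \<rho> ` \<phi> ` L" using fin by (intro Max_in) blast+
  then obtain w where w: "w \<in> L" "\<rho> (\<phi> w) = Max (\<rho> ` \<phi> ` L)" by force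
  have wmax: "\<rho> (\<phi> u) \<le> \<rho> (\<phi> w)" if "u \<in> L" for u
    unfolding w(2) using that by (intro Max_ge fin) blast
  define Top where "Top = {v\<in>L. \<phi> v = \<phi> w}"
  obtain b F where bF: "k \<le> card F" "Top = coord_cone b F"
    using fibre[OF w(1)] unfolding Top_def by blast
  have up: "v \<in> Top" if "u \<in> Top" "v \<in> L" "u \<le> v" for u v
  proof -
    have u: "u \<in> L" "\<phi> u = \<phi> w" using that(1) by (auto simp: Top_def)
    then have "\<phi> u = \<phi> v" using mono[OF u(1) that(2,3)] wmax[OF that(2)] by simp
    then show ?thesis using that(2) u(2) by (simp add: Top_def)
  qed
  define L' where "L' = L - Top"
  have im: "\<phi> ` L' = \<phi> ` L - {\<phi> w}" unfolding L'_def Top_def by auto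
  have down: "down_closed L'"
    unfolding down_closed_def
  proof (intro ballI allI impI)
    fix u v assume uv: "u \<in> L'" "v \<le> u"
    then have "v \<in> L" using Suc.prems(2) unfolding down_closed_def L'_def by blast
    moreover have "v \<notin> Top" using up[of v u] uv unfolding L'_def by blast
    ultimately show "v \<in> L'" unfolding L'_def by blast
  qed
  have "cone_filtered k L'"
  proof (rule Suc.hyps(1))
    show "n = card (\<phi> ` L')"
      unfolding im using Suc.hyps(2) w(1) Suc.prems(1) by (simp add: card_Diff_singleton)
    show "finite (\<phi> ` L')" unfolding im using Suc.prems(1) by (rule finite_Diff)
    show "down_closed L'" by (rule down)
    show "\<exists>b F. k \<le> card F \<and> {v \<in> L'. \<phi> v = \<phi> u} = coord_cone b F" if "u \<in> L'" for u
    proof -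
      have "{v \<in> L'. \<phi> v = \<phi> u} = {v \<in> L. \<phi> v = \<phi> u}"
        using that unfolding L'_def Top_def by auto
      then show ?thesis using fibre[of u] that unfolding L'_def by simp
    qed
    show "\<rho> (\<phi> u) \<le> \<rho> (\<phi> v) \<and> (\<rho> (\<phi> u) = \<rho> (\<phi> v) \<longrightarrow> \<phi> u = \<phi> v)"
      if "u \<in> L'" "v \<in> L'" "u \<le> v" for u v
      using mono[of u v] that unfolding L'_def by blast
  qed
  moreover have "L = L' \<union> coord_cone b F" "L' \<inter> coord_cone b F = {}"
    using bF(2) unfolding L'_def Top_def by auto
  ultimately show ?case
    using cone_filtered.add[of k L' b F] down Suc.prems(2) bF(1) by simp
qed

section \<open>Duality between greedy clique covers and independent sets\<close>

locale perfect_elimination_order =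
  fixes E :: "'v::finite \<Rightarrow> 'v \<Rightarrow> bool" and r :: "'v \<Rightarrow> nat"
  assumes inj_r: "inj r"
    and sym: "E x y \<Longrightarrow> E y x"
    and irrefl: "\<not> E x x"
    and later_clique: "E i j \<Longrightarrow> E i l \<Longrightarrow> r i < r j \<Longrightarrow> r i < r l \<Longrightarrow> j \<noteq> l \<Longrightarrow> E j l"
begin

definition earlier :: "'v \<Rightarrow> 'v set" where
  "earlier i = {j. E j i \<and> r j < r i}"

text \<open>The greedy weighted clique cover along the order: \<open>cl u i\<close> copies of the clique formed by
  \<open>i\<close> and its later neighbours are used, and \<open>ov u i\<close> is the part of \<open>u i\<close> already
  covered by cliques of earlier vertices. By duality with independent sets, the sums of \<open>ov u\<close>
  over initial segments are weighted vertex cover numbers, hence monotone in \<open>u\<close>.\<close>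

function cl :: "('v \<Rightarrow> nat) \<Rightarrow> 'v \<Rightarrow> nat" where
  "cl u i = u i - (\<Sum>j\<in>earlier i. cl u j)"
  by auto
termination
  by (relation "measure (\<lambda>(u, i). r i)") (auto simp: earlier_def)

declare cl.simps[simp del]

definition ov :: "('v \<Rightarrow> nat) \<Rightarrow> 'v \<Rightarrow> nat" where
  "ov u i = min (u i) (sum (cl u) (earlier i))"

lemma cl_plus_ov: "cl u i + ov u i = u i"
  by (simp add: ov_def cl.simps[of u i] min_def)

lemma wt_le: "u i \<le> cl u i + sum (cl u) (earlier i)"
  using cl.simps[of u i] by simp

lemma wt_eq: "cl u i > 0 \<Longrightarrow> u i = cl u i + sum (cl u) (earlier i)"
  using cl.simps[of u i] by simp

lemma earlier_lt: "j \<in> earlier i \<Longrightarrow> r j < r i" by (simp add: earlier_def)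

lemma not_in_earlier: "i \<notin> earlier i" by (simp add: earlier_def)

text \<open>Double counting: the clique started at \<open>j\<close> consists of \<open>j\<close> and
  its later neighbours, and it is counted once for every vertex of \<open>F\<close> that it
  contains.\<close>

lemma sum_clique_swap:
  assumes "F \<subseteq> {v. r v < b}"
  shows "(\<Sum>l\<in>F. cl u l + sum (cl u) (earlier l)) =
    (\<Sum>j | r j < b. card {l\<in>F. l = j \<or> j \<in> earlier l} * cl u j)"
proof -
  have "(\<Sum>l\<in>F. cl u l + sum (cl u) (earlier l)) = (\<Sum>l\<in>F. sum (cl u) (insert l (earlier l)))"
    by (simp add: not_in_earlier)
  also have "\<dots> = (\<Sum>l\<in>F. sum (cl u) {j \<in> {j. r j < b}. l = j \<or> j \<in> earlier l})"
  proof (rule sum.cong[OF refl])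
    fix l assume "l \<in> F"
    then have "insert l (earlier l) = {j \<in> {j. r j < b}. l = j \<or> j \<in> earlier l}"
      using assms earlier_lt[of _ l] less_trans by fastforce
    then show "sum (cl u) (insert l (earlier l)) =
      sum (cl u) {j \<in> {j. r j < b}. l = j \<or> j \<in> earlier l}" by simp
  qed
  also have "\<dots> = (\<Sum>j | r j < b. \<Sum>l | l \<in> F \<and> (l = j \<or> j \<in> earlier l). cl u j)"
    by (rule sum.swap_restrict) auto
  also have "\<dots> = (\<Sum>j | r j < b. card {l\<in>F. l = j \<or> j \<in> earlier l} * cl u j)"
    by simp
  finally show ?thesis .
qed

lemma card_later_le_1:
  assumes "independent_set E F"
  shows "card {l\<in>F. l = j \<or> j \<in> earlier l} \<le> 1"
proof -
  have "l = l'" if "l \<in> F" "l' \<in> F" "l = j \<or> j \<in> earlier l" "l' = j \<or> j \<in> earlier l'" for l l'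
    using that assms later_clique[of j l l'] sym unfolding independent_set_def earlier_def by blast
  then show ?thesis by (auto simp: card_le_Suc0_iff_eq)
qed

text \<open>Weak duality: an independent set meets each clique at most once.\<close>

lemma independent_wt_le:
  assumes "independent_set E F" "F \<subseteq> {v. r v < b}"
  shows "sum u F \<le> (\<Sum>j | r j < b. cl u j)"
proof -
  have "sum u F \<le> (\<Sum>l\<in>F. cl u l + sum (cl u) (earlier l))"
    by (intro sum_mono wt_le)
  also have "\<dots> = (\<Sum>j | r j < b. card {l\<in>F. l = j \<or> j \<in> earlier l} * cl u j)"
    by (rule sum_clique_swap[OF assms(2)])
  also have "\<dots> \<le> (\<Sum>j | r j < b. 1 * cl u j)"
    by (intro sum_mono mult_right_mono card_later_le_1 assms) simp
  finally show ?thesis by simp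
qed

text \<open>Complementary slackness by a second greedy pass, from the last vertex to the first: a
  vertex with positive \<open>cl\<close> is taken unless its clique already contains a chosen
  vertex. That \<open>cl\<close> is positive on \<open>F\<close> and that every used clique is hit
  are the two properties that make weak duality tight.\<close>

lemma greedy_independent:
  "\<exists>F \<subseteq> {v. a \<le> r v \<and> r v < b \<and> cl u v > 0}. independent_set E F \<and>
     (\<forall>j. a \<le> r j \<longrightarrow> r j < b \<longrightarrow> cl u j > 0 \<longrightarrow> (\<exists>l\<in>F. l = j \<or> j \<in> earlier l))"
proof (induction "b - a" arbitrary: a)
  case 0
  then show ?case by (intro exI[of _ "{}"]) (auto simp: independent_set_def)
next
  case (Suc n)
  have n: "n = b - Suc a" using Suc.hyps(2) by simp
  obtain F where F': "F \<subseteq> {v. Suc a \<le> r v \<and> r v < b \<and> cl u v > 0} \<and> independent_set E F \<and>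
     (\<forall>j. Suc a \<le> r j \<longrightarrow> r j < b \<longrightarrow> cl u j > 0 \<longrightarrow> (\<exists>l\<in>F. l = j \<or> j \<in> earlier l))"
    using Suc.hyps(1)[OF n] by (elim exE) (rule that)
  have F: "F \<subseteq> {v. Suc a \<le> r v \<and> r v < b \<and> cl u v > 0}" "independent_set E F"
    using conjunct1[OF F'] conjunct1[OF conjunct2[OF F']] by simp_all
  have F3: "\<exists>l\<in>F. l = j \<or> j \<in> earlier l" if "Suc a \<le> r j" "r j < b" "cl u j > 0" for j
    using conjunct2[OF conjunct2[OF F']] that by simp
  show ?case
  proof (cases "\<exists>w. r w = a \<and> cl u w > 0 \<and> (\<forall>l\<in>F. w \<notin> earlier l)")
    case True
    then obtain w where w: "r w = a" "cl u w > 0" "\<forall>l\<in>F. w \<notin> earlier l" by blast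
    have uniq: "j = w" if "r j = a" for j using that w(1) inj_r by (metis injD)
    have nonadj: "\<not> E w l \<and> \<not> E l w" if "l \<in> F" for l
    proof -
      have "r w < r l" using F(1) that w(1) by auto
      then have "\<not> E w l" using w(3) that by (auto simp: earlier_def)
      then show ?thesis using sym[of l w] by blast
    qed
    then have "independent_set E (insert w F)"
      using F(2) irrefl unfolding independent_set_def by blast
    moreover have "insert w F \<subseteq> {v. a \<le> r v \<and> r v < b \<and> cl u v > 0}"
      using F(1) w Suc.hyps(2) by auto
    moreover have "\<exists>l\<in>insert w F. l = j \<or> j \<in> earlier l"
      if "a \<le> r j" "r j < b" "cl u j > 0" for j
      using that F3[of j] uniq[of j] by (cases "r j = a") auto
    ultimately show ?thesis by (intro exI[of _ "insert w F"] conjI allI impI) simp_all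
  next
    case False
    have "\<exists>l\<in>F. l = j \<or> j \<in> earlier l"
      if "a \<le> r j" "r j < b" "cl u j > 0" for j
    proof (cases "r j = a")
      case True
      then show ?thesis using False that(3) by blast
    next
      case False
      then show ?thesis using that by (intro F3) simp_all
    qed
    moreover have "F \<subseteq> {v. a \<le> r v \<and> r v < b \<and> cl u v > 0}" using F(1) by auto
    ultimately show ?thesis using F(2) by (intro exI[of _ F] conjI allI impI) simp_all
  qed
qed

lemma independent_wt_attained:
  "\<exists>F \<subseteq> {v. r v < b}. independent_set E F \<and> sum u F = (\<Sum>j | r j < b. cl u j)"
proof -
  obtain F where F: "F \<subseteq> {v. r v < b \<and> cl u v > 0}" "independent_set E F"
    "\<And>j. r j < b \<Longrightarrow> cl u j > 0 \<Longrightarrow> \<exists>l\<in>F. l = j \<or> j \<in> earlier l"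
    using greedy_independent[of 0 b u] by auto
  have sub: "F \<subseteq> {v. r v < b}" using F(1) by auto
  have "sum u F = (\<Sum>l\<in>F. cl u l + sum (cl u) (earlier l))"
    using F(1) wt_eq by (intro sum.cong) auto
  also have "\<dots> = (\<Sum>j | r j < b. card {l\<in>F. l = j \<or> j \<in> earlier l} * cl u j)"
    by (rule sum_clique_swap[OF sub])
  also have "\<dots> = (\<Sum>j | r j < b. cl u j)"
  proof (rule sum.cong[OF refl])
    fix j assume j: "j \<in> {j. r j < b}"
    show "card {l\<in>F. l = j \<or> j \<in> earlier l} * cl u j = cl u j"
    proof (cases "cl u j = 0")
      case False
      then have "{l\<in>F. l = j \<or> j \<in> earlier l} \<noteq> {}" using F(3)[of j] j by auto
      then have "card {l\<in>F. l = j \<or> j \<in> earlier l} > 0" by (simp add: card_gt_0_iff)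
      then have "card {l\<in>F. l = j \<or> j \<in> earlier l} = 1"
        using card_later_le_1[OF F(2), of j] by linarith
      then show ?thesis by simp
    qed simp
  qed
  finally show ?thesis using F(2) sub by blast
qed

lemma ov_sum: "(\<Sum>j | r j < b. ov u j) + (\<Sum>j | r j < b. cl u j) = (\<Sum>j | r j < b. u j)"
  by (simp add: sum.distrib[symmetric] cl_plus_ov add.commute[of "ov u _"])

text \<open>The overlaps themselves are not monotone: on a path a, b, c ordered in this way, raising
  the weights 0, 1, 1 to 1, 1, 1 moves the overlap from c to b. Their sums over initial segments are
  weights of complements of optimal independent sets, and an optimal set for \<open>v\<close> is
  tested against \<open>u\<close>.\<close>

lemma ov_sum_mono:
  assumes "u \<le> v"
  shows "(\<Sum>j | r j < b. ov u j) \<le> (\<Sum>j | r j < b. ov v j)"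
proof -
  obtain F where F: "F \<subseteq> {v. r v < b}" "independent_set E F" "sum v F = (\<Sum>j | r j < b. cl v j)"
    using independent_wt_attained by blast
  have split: "sum w {v. r v < b} = sum w F + sum w ({v. r v < b} - F)" for w :: "'v \<Rightarrow> nat"
    using F(1) by (metis add.commute finite sum.subset_diff)
  have "sum u F \<le> (\<Sum>j | r j < b. cl u j)" by (rule independent_wt_le[OF F(2,1)])
  moreover have "sum u ({v. r v < b} - F) \<le> sum v ({v. r v < b} - F)"
    using assms by (intro sum_mono) (simp add: le_fun_def)
  ultimately show ?thesis
    using ov_sum[of u b] ov_sum[of v b] split[of u] split[of v] F(3) by linarith
qed

text \<open>Vertex covers are the complements of independent sets, so the least cover weight is the
  total weight minus the largest independent weight, and that is the total overlap.\<close>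

lemma small_cover_iff: "u \<in> small_cover_wts E s \<longleftrightarrow> sum (ov u) UNIV < s"
proof -
  obtain b where b: "\<And>v. r v < b"
    using finite_nat_set_iff_bounded[of "range r"] by auto
  have eq: "sum (ov u) UNIV + sum (cl u) UNIV = sum u UNIV"
    using ov_sum[of u b] b by simp
  have compl: "sum u C + sum u (- C) = sum u UNIV" for C
    by (metis Compl_eq_Diff_UNIV add.commute finite subset_UNIV sum.subset_diff)
  show ?thesis
  proof
    assume "u \<in> small_cover_wts E s"
    then obtain C where C: "vertex_cover E C" "sum u C < s" by (auto simp: small_cover_wts_def)
    have "independent_set E (- C)" using C(1) vertex_cover_Compl[of E "- C"] by simp
    then have "sum u (- C) \<le> sum (cl u) UNIV"
      using independent_wt_le[of "- C" b u] b by simp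
    then show "sum (ov u) UNIV < s" using C(2) eq compl[of C] by linarith
  next
    assume s: "sum (ov u) UNIV < s"
    obtain F where F: "independent_set E F" "sum u F = sum (cl u) UNIV"
      using independent_wt_attained[of b u] b by auto
    have "sum u (- F) < s" using F(2) s eq compl[of F] by linarith
    then show "u \<in> small_cover_wts E s"
      using F(1) vertex_cover_Compl by (auto simp: small_cover_wts_def)
  qed
qed

text \<open>Induction along the order; if \<open>c i = 0\<close>, the inequality makes the truncated
  subtraction return 0. The slackness conditions thus characterise the greedy cover, which is how
  membership in a fibre is checked.\<close>

lemma cl_unique:
  assumes "\<And>i. v i = t i + c i" "\<And>i. t i \<le> sum c (earlier i)"
    "\<And>i. c i > 0 \<Longrightarrow> sum c (earlier i) = t i"
  shows "cl v = c" "ov v = t"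
proof -
  have "cl v i = c i" for i
  proof (induction "r i" arbitrary: i rule: less_induct)
    case less
    have "sum (cl v) (earlier i) = sum c (earlier i)"
      using less earlier_lt by (intro sum.cong) auto
    then have "cl v i = v i - sum c (earlier i)" by (simp add: cl.simps[of v i])
    also have "\<dots> = c i" using assms(1,2)[of i] assms(3)[of i] by (cases "c i = 0") auto
    finally show ?case .
  qed
  then show "cl v = c" by auto
  then show "ov v = t"
    using assms(1) cl_plus_ov[of v] by (metis add.commute add_left_cancel ext)
qed

lemma ov_le: "ov u i \<le> sum (cl u) (earlier i)" by (simp add: ov_def)

lemma ov_eq: "cl u i > 0 \<Longrightarrow> sum (cl u) (earlier i) = ov u i"
  using wt_eq[of u i] cl_plus_ov[of u i] by linarith

end

text \<open>A three-digit number in base \<open>B\<close>: comparing such numbers is comparing the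
  triples lexicographically, with the leading entry unbounded.\<close>

lemma lex_rank_mono:
  fixes a b c a' b' c' B :: nat
  assumes "b < B" "c < B" "a \<le> a'" "a = a' \<Longrightarrow> b \<le> b'" "a = a' \<Longrightarrow> b = b' \<Longrightarrow> c \<le> c'"
  shows "a * (B * B) + b * B + c \<le> a' * (B * B) + b' * B + c'"
    "a * (B * B) + b * B + c = a' * (B * B) + b' * B + c' \<Longrightarrow> b' < B \<Longrightarrow> c' < B \<Longrightarrow>
      a = a' \<and> b = b' \<and> c = c'"
proof -
  have less: "x * B + y < x' * B" if "x < x'" "y < B" for x x' y :: nat
  proof -
    have "x * B + y < Suc x * B" using that(2) by simp
    also have "\<dots> \<le> x' * B" using that(1) by (intro mult_right_mono) auto
    finally show ?thesis .
  qed
  have split: "x * (B * B) + y * B + z = (x * B + y) * B + z" for x y z :: nat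
    by (simp add: algebra_simps)
  have lt: "a * (B * B) + b * B + c < a' * (B * B) + b' * B + c'" if "a < a' \<or> b < b'"
  proof -
    have "a * B + b < a' * B + b'"
      using that less[of a a' b] assms by (cases "a < a'") auto
    then have "(a * B + b) * B + c < (a' * B + b') * B" using assms(2) by (rule less)
    then show ?thesis unfolding split by simp
  qed
  have "a < a' \<or> b < b' \<or> (a = a' \<and> b = b')"
    using assms(3,4) by linarith
  then show "a * (B * B) + b * B + c \<le> a' * (B * B) + b' * B + c'"
    using lt assms(5) by (metis add_left_mono less_imp_le)
  show "a = a' \<and> b = b' \<and> c = c'"
    if "a * (B * B) + b * B + c = a' * (B * B) + b' * B + c'" "b' < B" "c' < B"
    using \<open>a < a' \<or> b < b' \<or> (a = a' \<and> b = b')\<close> lt that(1) by auto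
qed

lemma finite_bounded_funs: "finite {f :: 'a::finite \<Rightarrow> nat. \<forall>i. f i \<le> s}"
proof -
  have "finite (PiE (UNIV :: 'a set) (\<lambda>_. {..s}))" by (intro finite_PiE) auto
  moreover have "{f :: 'a \<Rightarrow> nat. \<forall>i. f i \<le> s} \<subseteq> PiE UNIV (\<lambda>_. {..s})" by auto
  ultimately show ?thesis by (rule rev_finite_subset)
qed

lemma small_cover_wts_down_closed: "down_closed (small_cover_wts E s)"
  unfolding down_closed_def
proof (intro ballI allI impI)
  fix u v assume "u \<in> small_cover_wts E s" and le: "v \<le> u"
  then obtain C where C: "vertex_cover E C" "sum u C < s" unfolding small_cover_wts_def by blast
  moreover have "sum v C \<le> sum u C" using le by (intro sum_mono) (simp add: le_fun_def)
  ultimately show "v \<in> small_cover_wts E s" unfolding small_cover_wts_def by force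
qed

section \<open>Cones with prescribed overlap, and the count of their directions\<close>

locale peo_with_centres = perfect_elimination_order +
  fixes Z :: "'a set"
  assumes disjoint_centres: "x \<in> Z \<Longrightarrow> y \<in> Z \<Longrightarrow> x \<noteq> y \<Longrightarrow> closed_nbhd E x \<inter> closed_nbhd E y = {}"
begin

text \<open>The exponents with given \<open>ov u = t\<close> are described by the constraints that the sum of \<open>cl u\<close>
  over the earlier neighbours of \<open>i\<close> is at least \<open>t i\<close>, with equality if \<open>cl u i > 0\<close>. The support
  of \<open>cl u\<close> implies such a constraint unless \<open>i\<close> is binding, and only then are the earlier
  neighbours of \<open>i\<close> rigid. At most \<open>t i\<close> of them lie in the support, and fewer if \<open>cl u i = 0\<close>, which
  leaves a unit of \<open>t i\<close> to pay for a centre adjacent to \<open>i\<close>. An idle centre whose neighbours all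
  vanish is a free direction even when \<open>cl u\<close> vanishes there, hence idle centres are excluded from the
  support.\<close>

definition idle :: "('a \<Rightarrow> nat) \<Rightarrow> 'a set" where
  "idle t = {z\<in>Z. \<forall>i\<in>closed_nbhd E z. t i = 0}"

definition spt :: "('a \<Rightarrow> nat) \<Rightarrow> 'a set" where
  "spt u = {i. cl u i > 0} - idle (ov u)"

definition binding :: "('a \<Rightarrow> nat) \<Rightarrow> 'a set \<Rightarrow> 'a set" where
  "binding t \<sigma> = {i. t i > 0 \<and> (i \<in> \<sigma> \<or> card (\<sigma> \<inter> earlier i) < t i)}"

definition rigid :: "('a \<Rightarrow> nat) \<Rightarrow> 'a set \<Rightarrow> 'a set" where
  "rigid t \<sigma> = (\<Union>i\<in>binding t \<sigma>. earlier i)"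

definition free :: "('a \<Rightarrow> nat) \<Rightarrow> 'a set \<Rightarrow> 'a set" where
  "free t \<sigma> = (\<sigma> - rigid t \<sigma>) \<union> {z\<in>idle t. nbhd E z \<inter> \<sigma> = {}}"

definition trunc :: "nat \<Rightarrow> ('a \<Rightarrow> nat) \<Rightarrow> 'a \<Rightarrow> nat" where
  "trunc s u i = (if i \<in> free (ov u) (spt u) then 0 else min (cl u i) s)"

lemma idle_nonadjacent: "x \<in> idle t \<Longrightarrow> y \<in> idle t \<Longrightarrow> \<not> E x y"
  using disjoint_centres[of x y] irrefl[of x] unfolding idle_def closed_nbhd_def nbhd_def by blast

text \<open>Such a \<open>j\<close> is rigid, and it is not an idle centre because its neighbour
  \<open>i\<close> has \<open>t i > 0\<close>.\<close>

lemma earlier_binding_not_free: "i \<in> binding t \<sigma> \<Longrightarrow> j \<in> earlier i \<Longrightarrow> j \<notin> free t \<sigma>"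
  by (auto simp: free_def rigid_def binding_def earlier_def idle_def closed_nbhd_def nbhd_def)

text \<open>With overlap, support and truncated values fixed, \<open>cl\<close> can grow in two
  kinds of directions: at free vertices, and at vertices whose value is already at least
  \<open>s\<close>. Since every \<open>t i\<close> is below \<open>s\<close>, one summand of size
  \<open>s\<close> satisfies any lower bound, so values from \<open>s\<close> upwards are
  interchangeable. The apex \<open>b\<close> uses the least admissible value of \<open>cl\<close>: 1
  at free support vertices, 0 at free idle centres, the truncated value elsewhere.\<close>

lemma fibre_is_cone:
  assumes u: "u \<in> small_cover_wts E s" and "s > 0"
  defines "t \<equiv> ov u" and "\<sigma> \<equiv> spt u"
  defines "b \<equiv> \<lambda>i. t i + (if i \<in> free t \<sigma> then (if i \<in> \<sigma> then 1 else 0) else min (cl u i) s)"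
  shows "{v \<in> small_cover_wts E s. (ov v, spt v, trunc s v) = (t, \<sigma>, trunc s u)} =
    coord_cone b (free t \<sigma> \<union> {i. s \<le> cl u i})"
proof (intro subset_antisym subsetI)
  fix v assume "v \<in> {v \<in> small_cover_wts E s. (ov v, spt v, trunc s v) = (t, \<sigma>, trunc s u)}"
  then have v: "ov v = t" "spt v = \<sigma>" "trunc s v = trunc s u" by auto
  have eq: "v i = cl v i + t i" for i using cl_plus_ov[of v i] v(1) by simp
  have tr: "min (cl v i) s = min (cl u i) s" if "i \<notin> free t \<sigma>" for i
    using fun_cong[OF v(3), of i] that v(1,2) by (simp add: trunc_def t_def \<sigma>_def)
  have pos: "cl v i > 0" if "i \<in> \<sigma>" for i using that v(2) by (auto simp: spt_def)
  show "v \<in> coord_cone b (free t \<sigma> \<union> {i. s \<le> cl u i})"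
    unfolding coord_cone_def
  proof (intro CollectI conjI allI impI le_funI)
    fix i show "b i \<le> v i"
      using eq[of i] tr[of i] pos[of i] by (auto simp: b_def)
  next
    fix i assume "i \<notin> free t \<sigma> \<union> {i. s \<le> cl u i}"
    then show "v i = b i" using eq[of i] tr[of i] by (auto simp: b_def)
  qed
next
  fix v assume v: "v \<in> coord_cone b (free t \<sigma> \<union> {i. s \<le> cl u i})"
  define c d where "c = cl u" and "d = (\<lambda>i. v i - t i)"
  have ge: "b i \<le> v i" for i using v by (simp add: coord_cone_def le_fun_def)
  have vd: "v i = t i + d i" for i using ge[of i] by (auto simp: d_def b_def)
  have same: "d i = c i" if "i \<notin> free t \<sigma>" "c i < s" for i
    using v that unfolding coord_cone_def by (auto simp: d_def b_def c_def)
  have large: "d i \<ge> s" if "i \<notin> free t \<sigma>" "c i \<ge> s" for i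
    using ge[of i] vd[of i] that by (auto simp: b_def c_def)
  have one: "d i > 0" if "i \<in> free t \<sigma>" "i \<in> \<sigma>" for i
    using ge[of i] vd[of i] that by (auto simp: b_def)
  have supp: "d i > 0 \<longleftrightarrow> c i > 0" if "i \<notin> free t \<sigma>" for i
    using same[OF that] large[OF that] \<open>s > 0\<close> by (cases "c i < s") auto
  have \<sigma>: "i \<in> \<sigma> \<longleftrightarrow> c i > 0 \<and> i \<notin> idle t" for i by (auto simp: \<sigma>_def spt_def t_def c_def)
  have d\<sigma>: "i \<in> \<sigma> \<longleftrightarrow> d i > 0 \<and> i \<notin> idle t" for i
  proof (cases "i \<in> free t \<sigma>")
    case True
    then have "i \<in> \<sigma> \<or> i \<in> idle t" by (auto simp: free_def)
    then show ?thesis using one[OF True] \<sigma>[of i] by blast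
  next
    case False
    then show ?thesis using supp \<sigma> by blast
  qed
  have t_less: "t i < s" for i
    using u member_le_sum[of i UNIV t] by (simp add: small_cover_iff t_def)
  have t_le: "t i \<le> sum c (earlier i)" for i using ov_le[of u i] by (simp add: t_def c_def)
  have t_eq: "sum c (earlier i) = t i" if "c i > 0" for i
    using ov_eq[of u i] that by (simp add: t_def c_def)
  have le: "t i \<le> sum d (earlier i)" for i
  proof (cases "i \<in> binding t \<sigma>")
    case True
    then have nf: "j \<notin> free t \<sigma>" if "j \<in> earlier i" for j
      using that by (rule earlier_binding_not_free)
    show ?thesis
    proof (cases "\<exists>j\<in>earlier i. c j \<ge> s")
      case True
      then obtain j where j: "j \<in> earlier i" "c j \<ge> s" by blast
      then have "s \<le> d j" using large nf by blast
      also have "d j \<le> sum d (earlier i)" using j(1) by (intro member_le_sum) auto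
      finally show ?thesis using t_less[of i] by simp
    next
      case False
      then have "sum d (earlier i) = sum c (earlier i)" using nf same by (intro sum.cong) auto
      then show ?thesis using t_le by simp
    qed
  next
    case False
    show ?thesis
    proof (cases "t i = 0")
      case nz: False
      then have "t i \<le> card (\<sigma> \<inter> earlier i)" using False by (auto simp: binding_def)
      also have "\<dots> = (\<Sum>j\<in>\<sigma> \<inter> earlier i. 1)" by simp
      also have "\<dots> \<le> sum d (\<sigma> \<inter> earlier i)"
        using d\<sigma> by (intro sum_mono) (simp add: Suc_leI)
      also have "\<dots> \<le> sum d (earlier i)" by (intro sum_mono2) auto
      finally show ?thesis .
    qed simp
  qed
  have sum_eq: "sum d (earlier i) = t i" if "d i > 0" for i
  proof (cases "t i = 0")
    case True
    \<comment> \<open>If \<open>c i\<close> and \<open>c j\<close> were both positive,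
      \<open>t_eq\<close> would make \<open>t i\<close> positive. So one of the two became positive
      only as a free idle centre without neighbours in the support. The other has positive
      \<open>d\<close> but is outside the support, hence is idle too, against the disjointness of
      closed neighbourhoods.\<close>
    have "d j = 0" if j: "j \<in> earlier i" for j
    proof (rule ccontr)
      assume "d j \<noteq> 0"
      have adj: "E i j" "E j i" using j sym by (auto simp: earlier_def)
      have zero: "x \<in> idle t \<and> nbhd E x \<inter> \<sigma> = {}" if "d x > 0" "c x = 0" for x
        using that supp[of x] \<sigma>[of x] by (auto simp: free_def)
      have "\<not> (c i > 0 \<and> c j > 0)"
      proof
        assume c: "c i > 0 \<and> c j > 0"
        have "c j \<le> sum c (earlier i)" using j by (intro member_le_sum) auto
        then show False using t_eq[of i] c True by simp
      qed
      then have "(i \<in> idle t \<and> nbhd E i \<inter> \<sigma> = {}) \<or> (j \<in> idle t \<and> nbhd E j \<inter> \<sigma> = {})"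
        using zero[of i] zero[of j] \<open>d i > 0\<close> \<open>d j \<noteq> 0\<close> by auto
      then have "i \<in> idle t \<and> j \<in> idle t"
        using adj d\<sigma>[of i] d\<sigma>[of j] \<open>d i > 0\<close> \<open>d j \<noteq> 0\<close> by (auto simp: nbhd_def)
      then show False using idle_nonadjacent adj by blast
    qed
    then show ?thesis using True by simp
  next
    case False
    have "i \<in> \<sigma>" using False that d\<sigma>[of i] by (auto simp: idle_def closed_nbhd_def)
    then have binding: "i \<in> binding t \<sigma>" and "c i > 0" using False \<sigma> by (auto simp: binding_def)
    then have ti: "sum c (earlier i) = t i" by (intro t_eq)
    \<comment> \<open>The sum of the earlier values equals \<open>t i\<close>, which is below
      \<open>s\<close>; so none of them reaches the truncation level.\<close>
    have "d j = c j" if j: "j \<in> earlier i" for j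
    proof (rule same)
      show "j \<notin> free t \<sigma>" using binding j by (rule earlier_binding_not_free)
      have "c j \<le> sum c (earlier i)" using j by (intro member_le_sum) auto
      then show "c j < s" using ti t_less[of i] by simp
    qed
    then show ?thesis using ti by simp
  qed
  have cl: "cl v = d" and ov: "ov v = t"
    using cl_unique[of v t d, OF vd le sum_eq] by auto
  have "v \<in> small_cover_wts E s" using u by (simp add: small_cover_iff ov t_def)
  moreover have sp: "spt v = \<sigma>" using d\<sigma> by (auto simp: spt_def cl ov)
  moreover have "trunc s v = trunc s u"
  proof
    fix i
    show "trunc s v i = trunc s u i"
      using same[of i] large[of i] sp
      by (cases "c i < s") (auto simp: trunc_def cl ov t_def[symmetric] \<sigma>_def[symmetric] c_def[symmetric])
  qed
  ultimately show "v \<in> {v \<in> small_cover_wts E s. (ov v, spt v, trunc s v) = (t, \<sigma>, trunc s u)}"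
    using ov by simp
qed

text \<open>The disjoint closed neighbourhoods of the centres all meet \<open>W\<close>, so the
  centres inject into it. The second part of \<open>W\<close> is paid for by the overlap: a vertex
  \<open>i\<close> with \<open>t i > 0\<close> pays for the support vertices that it makes rigid
  and, if it lies outside the support, for itself.\<close>

lemma card_centres_le: "card Z \<le> card (free (ov u) (spt u)) + sum (ov u) UNIV"
proof -
  define t \<sigma> where "t = ov u" and "\<sigma> = spt u"
  define P where "P = {i. t i > 0}"
  define W where "W = free t \<sigma> \<union> (\<sigma> \<inter> rigid t \<sigma> \<union> (P - \<sigma>))"
  have "\<exists>w. w \<in> closed_nbhd E z \<and> w \<in> W" if z: "z \<in> Z" for z
  proof (cases "z \<in> idle t")
    case True
    then show ?thesis
      by (cases "nbhd E z \<inter> \<sigma> = {}") (auto simp: W_def free_def closed_nbhd_def)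
  next
    case False
    then obtain i where "i \<in> closed_nbhd E z" "i \<in> P"
      using z by (auto simp: idle_def P_def)
    then show ?thesis by (auto simp: W_def free_def)
  qed
  then obtain g where g: "\<And>z. z \<in> Z \<Longrightarrow> g z \<in> closed_nbhd E z \<and> g z \<in> W" by metis
  have "inj_on g Z"
  proof (rule inj_onI, rule ccontr)
    fix x y assume xy: "x \<in> Z" "y \<in> Z" "g x = g y" "x \<noteq> y"
    then have "g x \<in> closed_nbhd E x \<inter> closed_nbhd E y" using g[of x] g[of y] by simp
    then show False using disjoint_centres[of x y] xy by simp
  qed
  then have "card Z \<le> card W" using g by (intro card_inj_on_le[of g]) (simp_all add: image_subset_iff)
  also have "\<dots> \<le> card (free t \<sigma>) + card (\<sigma> \<inter> rigid t \<sigma> \<union> (P - \<sigma>))"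
    unfolding W_def by (rule card_Un_le)
  also have "card (\<sigma> \<inter> rigid t \<sigma> \<union> (P - \<sigma>)) \<le> card (\<sigma> \<inter> rigid t \<sigma>) + card (P - \<sigma>)"
    by (rule card_Un_le)
  also have "card (\<sigma> \<inter> rigid t \<sigma>) \<le> (\<Sum>i\<in>binding t \<sigma>. card (\<sigma> \<inter> earlier i))"
  proof -
    have "\<sigma> \<inter> rigid t \<sigma> = (\<Union>i\<in>binding t \<sigma>. \<sigma> \<inter> earlier i)" by (auto simp: rigid_def)
    then show ?thesis using card_UN_le[of "binding t \<sigma>" "\<lambda>i. \<sigma> \<inter> earlier i"] by simp
  qed
  also have "(\<Sum>i\<in>binding t \<sigma>. card (\<sigma> \<inter> earlier i)) =
      (\<Sum>i\<in>P. if i \<in> binding t \<sigma> then card (\<sigma> \<inter> earlier i) else 0)"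
    by (subst sum.inter_restrict[symmetric]) (auto simp: P_def binding_def intro: sum.cong)
  also have "card (P - \<sigma>) = (\<Sum>i\<in>P. if i \<notin> \<sigma> then 1 else 0)"
    by (subst sum.inter_filter[symmetric]) (auto simp: set_diff_eq)
  also have "(\<Sum>i\<in>P. if i \<in> binding t \<sigma> then card (\<sigma> \<inter> earlier i) else 0) +
      (\<Sum>i\<in>P. if i \<notin> \<sigma> then 1 else 0) =
      (\<Sum>i\<in>P. (if i \<in> binding t \<sigma> then card (\<sigma> \<inter> earlier i) else 0) + (if i \<notin> \<sigma> then 1 else 0))"
    by (rule sum.distrib[symmetric])
  also have "\<dots> \<le> (\<Sum>i\<in>P. t i)"
  proof (rule sum_mono)
    fix i assume "i \<in> P"
    have "card (\<sigma> \<inter> earlier i) \<le> t i" if "i \<in> \<sigma>"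
    proof -
      have "card (\<sigma> \<inter> earlier i) = (\<Sum>j\<in>\<sigma> \<inter> earlier i. 1)" by simp
      also have "\<dots> \<le> sum (cl u) (\<sigma> \<inter> earlier i)"
        by (intro sum_mono) (auto simp: \<sigma>_def spt_def)
      also have "\<dots> \<le> sum (cl u) (earlier i)" by (intro sum_mono2) auto
      also have "\<dots> = t i" using ov_eq[of u i] that by (simp add: \<sigma>_def spt_def t_def)
      finally show ?thesis .
    qed
    \<comment> \<open>Outside the support, a binding \<open>i\<close> satisfies the strict
      inequality in \<open>binding\<close>, and a non-binding one pays only for itself.\<close>
    then show "(if i \<in> binding t \<sigma> then card (\<sigma> \<inter> earlier i) else 0) + (if i \<notin> \<sigma> then 1 else 0) \<le> t i"
      using \<open>i \<in> P\<close> by (auto simp: binding_def P_def)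
  qed
  also have "\<dots> \<le> sum t UNIV" by (intro sum_mono2) auto
  finally show ?thesis by (simp add: t_def \<sigma>_def)
qed

lemma ov_determined:
  assumes "\<And>i. (\<Sum>j | r j < Suc (r i). ov u j) = (\<Sum>j | r j < Suc (r i). ov v j)"
  shows "ov u = ov v"
proof
  fix i show "ov u i = ov v i"
  proof (induction "r i" arbitrary: i rule: less_induct)
    case less
    have "{j. r j < Suc (r i)} = insert i {j. r j < r i}"
      using inj_r by (auto simp: less_Suc_eq dest: injD)
    then have "ov u i + (\<Sum>j | r j < r i. ov u j) = ov v i + (\<Sum>j | r j < r i. ov v j)"
      using assms[of i] by simp
    moreover have "(\<Sum>j | r j < r i. ov u j) = (\<Sum>j | r j < r i. ov v j)"
      using less by (intro sum.cong) auto
    ultimately show ?case by simp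
  qed
qed

text \<open>At equal overlap \<open>cl\<close> is monotone in the exponent, hence so is the support,
  and at equal support also the truncation; this dictates the order of the three entries of the
  rank. Overlap at most \<open>s - 1\<close> turns the count of centres into
  \<open>card Z + 1 - s\<close> directions.\<close>

lemma small_cover_cone_filtered:
  assumes "s > 0"
  shows "cone_filtered (card Z + 1 - s) (small_cover_wts E s)"
proof -
  define L where "L = small_cover_wts E s"
  define B where "B = Suc (card (UNIV :: 'a set) + card (UNIV :: 'a set) * s)"
  define \<phi> where "\<phi> u = (ov u, spt u, trunc s u)" for u
  \<comment> \<open>The leading entry sums all initial-segment sums of the overlap: each of them is
    monotone, so equality of the totals forces equality of each, and these sums determine the
    overlap.\<close>
  define \<rho> :: "('a \<Rightarrow> nat) \<times> 'a set \<times> ('a \<Rightarrow> nat) \<Rightarrow> nat" where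
    "\<rho> = (\<lambda>(t, \<sigma>, k). (\<Sum>i\<in>UNIV. \<Sum>j | r j < Suc (r i). t j) * (B * B) + card \<sigma> * B + sum k UNIV)"
  have trunc_le: "trunc s u i \<le> s" for u i by (simp add: trunc_def)
  have B: "card \<sigma> < B" "sum (trunc s u) UNIV < B" for \<sigma> :: "'a set" and u
  proof -
    have "card \<sigma> \<le> card (UNIV :: 'a set)" by (intro card_mono) auto
    then show "card \<sigma> < B" by (simp add: B_def)
    have "sum (trunc s u) UNIV \<le> card (UNIV :: 'a set) * s"
      using sum_bounded_above[of UNIV "trunc s u" s] trunc_le by simp
    then show "sum (trunc s u) UNIV < B" by (simp add: B_def)
  qed
  have "cone_filtered (card Z + 1 - s) L"
  proof (rule cone_filtered_by_rank[where \<phi> = \<phi> and \<rho> = \<rho>])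
    have "\<phi> ` L \<subseteq> {f. \<forall>i. f i \<le> s} \<times> UNIV \<times> {f. \<forall>i. f i \<le> s}"
    proof -
      have "ov u i \<le> s" if "u \<in> L" for u i
        using that member_le_sum[of i UNIV "ov u"] by (simp add: L_def small_cover_iff)
      then show ?thesis by (auto simp: \<phi>_def trunc_le)
    qed
    then show "finite (\<phi> ` L)"
      by (rule finite_subset) (intro finite_cartesian_product finite_bounded_funs, simp)
    show "down_closed L" unfolding L_def by (rule small_cover_wts_down_closed)
    show "\<rho> (\<phi> u) \<le> \<rho> (\<phi> v) \<and> (\<rho> (\<phi> u) = \<rho> (\<phi> v) \<longrightarrow> \<phi> u = \<phi> v)"
      if "u \<in> L" "v \<in> L" "u \<le> v" for u v
    proof -
      define T where "T u i = (\<Sum>j | r j < Suc (r i). ov u j)" for u i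
      have T_mono: "T u i \<le> T v i" for i unfolding T_def by (rule ov_sum_mono[OF that(3)])
      have T_le: "sum (T u) UNIV \<le> sum (T v) UNIV" by (intro sum_mono T_mono)
      have ov: "ov u = ov v" if "sum (T u) UNIV = sum (T v) UNIV"
      proof (rule ov_determined)
        have "T u i = T v i" for i
          using sum_mono_inv[OF that T_mono, of i] by simp
        then show "(\<Sum>j | r j < Suc (r i). ov u j) = (\<Sum>j | r j < Suc (r i). ov v j)" for i
          by (simp add: T_def)
      qed
      have cl: "cl u i \<le> cl v i" if "ov u = ov v" for i
        using cl_plus_ov[of u i] cl_plus_ov[of v i] that \<open>u \<le> v\<close> by (metis add_le_cancel_right le_fun_def)
      have spt: "spt u \<subseteq> spt v" if "ov u = ov v"
        using cl[OF that] that less_le_trans by (fastforce simp: spt_def)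
      then have spt_eq: "spt u = spt v" if "ov u = ov v" "card (spt u) = card (spt v)"
        using that by (simp add: card_subset_eq)
      have tr: "trunc s u i \<le> trunc s v i" if "ov u = ov v" "spt u = spt v" for i
        using cl[OF that(1), of i] that by (auto simp: trunc_def)
      then have tr_eq: "trunc s u = trunc s v"
        if "ov u = ov v" "spt u = spt v" "sum (trunc s u) UNIV = sum (trunc s v) UNIV"
        using sum_mono_inv[OF that(3)] that(1,2) by auto
      have \<rho>: "\<rho> (\<phi> w) = sum (T w) UNIV * (B * B) + card (spt w) * B + sum (trunc s w) UNIV" for w
        by (simp add: \<rho>_def \<phi>_def T_def)
      have 1: "card (spt u) \<le> card (spt v)" if "sum (T u) UNIV = sum (T v) UNIV"
        using spt[OF ov[OF that]] by (intro card_mono) auto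
      have 2: "sum (trunc s u) UNIV \<le> sum (trunc s v) UNIV"
        if "sum (T u) UNIV = sum (T v) UNIV" "card (spt u) = card (spt v)"
        using tr[OF ov spt_eq] that ov by (intro sum_mono) auto
      show ?thesis
      proof (intro conjI impI)
        show "\<rho> (\<phi> u) \<le> \<rho> (\<phi> v)" unfolding \<rho> by (rule lex_rank_mono(1)[OF B T_le 1 2])
        assume eq: "\<rho> (\<phi> u) = \<rho> (\<phi> v)"
        note lex = lex_rank_mono(2)[OF B T_le 1 2 eq[unfolded \<rho>] B]
        then have "ov u = ov v" using ov by blast
        moreover from this have "spt u = spt v" using lex spt_eq by blast
        ultimately show "\<phi> u = \<phi> v" using lex tr_eq by (simp add: \<phi>_def)
      qed
    qed
    show "\<exists>b F. card Z + 1 - s \<le> card F \<and> {v \<in> L. \<phi> v = \<phi> u} = coord_cone b F" if "u \<in> L" for u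
    proof -
      have "card Z \<le> card (free (ov u) (spt u)) + sum (ov u) UNIV" by (rule card_centres_le)
      moreover have "sum (ov u) UNIV < s" using that by (simp add: L_def small_cover_iff)
      moreover have "card (free (ov u) (spt u)) \<le> card (free (ov u) (spt u) \<union> {i. s \<le> cl u i})"
        by (intro card_mono) auto
      ultimately have "card Z + 1 - s \<le> card (free (ov u) (spt u) \<union> {i. s \<le> cl u i})" by linarith
      then show ?thesis
        using fibre_is_cone[OF that[unfolded L_def] assms] unfolding \<phi>_def L_def by blast
    qed
  qed
  then show ?thesis by (simp add: L_def)
qed

end

section \<open>Perfect elimination orders of chordal graphs\<close>

definition simplicial_in :: "('v \<Rightarrow> 'v \<Rightarrow> bool) \<Rightarrow> 'v set \<Rightarrow> 'v \<Rightarrow> bool" where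
  "simplicial_in E A v \<longleftrightarrow> v \<in> A \<and> (\<forall>x\<in>A. \<forall>y\<in>A. E v x \<longrightarrow> E v y \<longrightarrow> x \<noteq> y \<longrightarrow> E x y)"

lemma simplicial_inD:
  "simplicial_in E A v \<Longrightarrow> x \<in> A \<Longrightarrow> y \<in> A \<Longrightarrow> E v x \<Longrightarrow> E v y \<Longrightarrow> x \<noteq> y \<Longrightarrow> E x y"
  unfolding simplicial_in_def by blast

lemma induced_cycle_from_path:
  assumes graph: "simple_graph E" and ends: "E a (f 0)" "E a (f n)"
    and inner: "\<And>i. 0 < i \<Longrightarrow> i < n \<Longrightarrow> \<not> E a (f i)" and a: "\<And>i. i \<le> n \<Longrightarrow> f i \<noteq> a"
    and inj: "inj_on f {..n}"
    and path: "\<And>i j. i \<le> n \<Longrightarrow> j \<le> n \<Longrightarrow> E (f i) (f j) \<longleftrightarrow> j = Suc i \<or> i = Suc j"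
    and "2 \<le> n"
  shows "induced_cycle E (a # map f [0..<Suc n])"
proof -
  define vs where "vs = a # map f [0..<Suc n]"
  have len: "length vs = Suc (Suc n)" by (simp add: vs_def)
  have vs0: "vs ! 0 = a" by (simp add: vs_def)
  have vsS: "vs ! Suc k = f k" if "k \<le> n" for k
    unfolding vs_def using that by (simp del: upt_Suc)
  have E_sym: "E x y \<longleftrightarrow> E y x" and E_irrefl: "\<not> E x x" for x y
    using graph unfolding simple_graph_def by (auto dest: sympD irreflpD)
  have a_adj: "E a (f k) \<longleftrightarrow> k = 0 \<or> k = n" if "k \<le> n" for k
    using inner[of k] ends that by (cases "k = 0 \<or> k = n") auto
  have m: "Suc k mod Suc (Suc n) = (if k = Suc n then 0 else Suc k)" if "k < Suc (Suc n)" for k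
    using that by auto
  have "distinct vs"
    unfolding vs_def using a inj
    by (auto simp: distinct_map atLeast0LessThan lessThan_Suc_atMost simp del: upt_Suc)
  moreover have "E (vs ! i) (vs ! j) \<longleftrightarrow> j = Suc i mod Suc (Suc n) \<or> i = Suc j mod Suc (Suc n)"
    if ij: "i < Suc (Suc n)" "j < Suc (Suc n)" for i j
  proof (cases i)
    case 0
    show ?thesis
    proof (cases j)
      case 0
      with \<open>i = 0\<close> show ?thesis using E_irrefl vs0 by simp
    next
      case (Suc l)
      then have l: "l \<le> n" using ij by simp
      show ?thesis using \<open>i = 0\<close> Suc a_adj[OF l] l by (simp add: vs0 vsS m)
    qed
  next
    case (Suc k)
    then have k: "k \<le> n" using ij by simp
    show ?thesis
    proof (cases j)
      case 0
      show ?thesis using \<open>i = Suc k\<close> 0 a_adj[OF k] k E_sym[of a "f k"] by (simp add: vs0 vsS m)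
    next
      case (Suc l)
      then have l: "l \<le> n" using ij by simp
      show ?thesis using \<open>i = Suc k\<close> Suc path[OF k l] k l
        by (simp add: vsS m)
    qed
  qed
  ultimately show ?thesis
    unfolding induced_cycle_def vs_def[symmetric] len using assms(8) by simp
qed

text \<open>A shortest path from \<open>s\<close> to \<open>t\<close> through \<open>H\<close> is
  induced. Were \<open>s\<close> and \<open>t\<close> not adjacent, it would have at least two edges
  and, closed up by \<open>a\<close>, which sees only its ends, would be an induced cycle of length
  at least 4.\<close>

lemma chordal_common_nbrs_adjacent:
  assumes graph: "simple_graph E" and "chordal E"
    and "E a s" "E a t" "s \<noteq> t" "\<And>x. x \<in> H \<Longrightarrow> x \<noteq> a \<and> \<not> E a x"
    and conn: "(s, t) \<in> {(x, y). E x y \<and> x \<in> H \<union> {s, t} \<and> y \<in> H \<union> {s, t}}\<^sup>*"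
  shows "E s t"
proof (rule ccontr)
  assume nadj: "\<not> E s t"
  define Q where "Q = {(x, y). E x y \<and> x \<in> H \<union> {s, t} \<and> y \<in> H \<union> {s, t}}"
  define n where "n = (LEAST n. (s, t) \<in> Q ^^ n)"
  have "\<exists>n. (s, t) \<in> Q ^^ n" using conn rtrancl_imp_relpow unfolding Q_def by fast
  then have n: "(s, t) \<in> Q ^^ n" unfolding n_def by (rule LeastI_ex)
  have least: "n \<le> m" if "(s, t) \<in> Q ^^ m" for m unfolding n_def using that by (rule Least_le)
  obtain f where f: "f 0 = s" "f n = t" "\<And>i. i < n \<Longrightarrow> (f i, f (Suc i)) \<in> Q"
    using n unfolding relpow_fun_conv by blast
  have E_sym: "E x y \<longleftrightarrow> E y x" and E_irrefl: "\<not> E x x" for x y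
    using graph unfolding simple_graph_def by (auto dest: sympD irreflpD)
  have sub: "(f i, f j) \<in> Q ^^ (j - i)" if "i \<le> j" "j \<le> n" for i j
    unfolding relpow_fun_conv using f(3) that by (intro exI[of _ "\<lambda>k. f (i + k)"]) auto
  have mem: "f i \<in> H \<union> {s, t}" if "i \<le> n" for i
    using f that by (cases "i = n") (auto simp: Q_def)
  have n2: "2 \<le> n"
  proof (rule ccontr)
    assume "\<not> 2 \<le> n"
    then have "n = 0 \<or> n = 1" by auto
    then show False using n nadj \<open>s \<noteq> t\<close> by (auto simp: Q_def)
  qed
  have ne: "f i \<noteq> f j" if "i < j" "j \<le> n" for i j
  proof
    assume "f i = f j"
    then have "(s, t) \<in> Q ^^ i O Q ^^ (n - j)"
      using sub[of 0 i] sub[of j n] f(1,2) that by auto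
    then have "n \<le> i + (n - j)" by (intro least) (simp add: relpow_add)
    then show False using that by simp
  qed
  have chord: "j = Suc i" if "i < j" "j \<le> n" "E (f i) (f j)" for i j
  proof (rule ccontr)
    assume "j \<noteq> Suc i"
    have "(f i, f j) \<in> Q" using mem[of i] mem[of j] that by (auto simp: Q_def)
    then have "(s, f j) \<in> Q ^^ Suc i" using sub[of 0 i] f(1) that by auto
    then have "(s, t) \<in> Q ^^ Suc i O Q ^^ (n - j)" using sub[of j n] f(2) that by blast
    then have "(s, t) \<in> Q ^^ (Suc i + (n - j))" by (simp only: relpow_add)
    then have "n \<le> Suc i + (n - j)" by (rule least)
    then show False using that \<open>j \<noteq> Suc i\<close> by simp
  qed
  have "induced_cycle E (a # map f [0..<Suc n])"
  proof (rule induced_cycle_from_path[OF graph])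
    show "E a (f 0)" "E a (f n)" using f assms(3,4) by simp_all
    show "\<not> E a (f i)" if "0 < i" "i < n" for i
    proof -
      have "f i \<in> H" using mem[of i] ne[of 0 i] ne[of i n] f(1,2) that by auto
      then show ?thesis using assms(6) by blast
    qed
    show "f i \<noteq> a" if "i \<le> n" for i
      using mem[OF that] assms(3,4,6) E_irrefl by blast
    show "inj_on f {..n}"
      by (rule linorder_inj_onI) (use ne in auto)
    show "E (f i) (f j) \<longleftrightarrow> j = Suc i \<or> i = Suc j" if "i \<le> n" "j \<le> n" for i j
    proof
      assume e: "E (f i) (f j)"
      then have "i \<noteq> j" using E_irrefl by auto
      then show "j = Suc i \<or> i = Suc j"
        using chord[of i j] chord[of j i] that e E_sym by (metis linorder_neqE_nat)
    next
      assume "j = Suc i \<or> i = Suc j"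
      then show "E (f i) (f j)"
        using f(3)[of i] f(3)[of j] that E_sym by (auto simp: Q_def)
    qed
  qed (rule n2)
  moreover have "4 \<le> length (a # map f [0..<Suc n])" using n2 by simp
  ultimately show False using \<open>chordal E\<close> unfolding chordal_def by blast
qed

text \<open>Dirac: a component \<open>H\<close> of the vertices far from \<open>a\<close> attaches to \<open>a\<close> through a clique
  \<open>S\<close>, and a simplicial vertex is found inside \<open>H\<close>.\<close>

lemma simplicial_nonneighbour:
  assumes graph: "simple_graph E" and chordal: "chordal E"
    and "finite A" "a \<in> A" "b \<in> A" "b \<noteq> a" "\<not> E a b"
  shows "\<exists>v. simplicial_in E A v \<and> v \<noteq> a \<and> \<not> E a v"
  using assms(3-)
proof (induction "card A" arbitrary: A a b rule: less_induct)
  case less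
  have E_sym: "E x y \<Longrightarrow> E y x" and E_irrefl: "\<not> E x x" for x y
    using graph unfolding simple_graph_def by (auto dest: sympD irreflpD)
  define B where "B = {x\<in>A. x \<noteq> a \<and> \<not> E a x}"
  define Q where "Q = {(x, y). E x y \<and> x \<in> B \<and> y \<in> B}"
  define H where "H = {y. (b, y) \<in> Q\<^sup>*}"
  define S where "S = {y\<in>A. E a y \<and> (\<exists>x\<in>H. E x y)}"
  have b: "b \<in> H" by (simp add: H_def)
  have HB: "y \<in> B" if "y \<in> H" for y
  proof -
    have "(b, y) \<in> Q\<^sup>*" using that by (simp add: H_def)
    then show ?thesis using less.prems by (cases rule: rtranclE) (auto simp: Q_def B_def)
  qed
  have H_step: "y \<in> H" if "x \<in> H" "E x y" "y \<in> B" for x y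
    using that HB[of x] rtrancl_into_rtrancl[of b x Q y] by (simp add: H_def Q_def)
  have nbr: "y \<in> H \<union> S" if "x \<in> H" "y \<in> A" "E x y" for x y
    using H_step[OF that(1,3)] that HB[of x] E_sym[of x y]
    by (cases "E a y") (auto simp: S_def B_def)
  have S_clique: "E s t" if st: "s \<in> S" "t \<in> S" "s \<noteq> t" for s t
  proof (rule chordal_common_nbrs_adjacent[OF graph chordal])
    show "E a s" "E a t" "s \<noteq> t" using st by (auto simp: S_def)
    show "x \<noteq> a \<and> \<not> E a x" if "x \<in> H" for x using HB[OF that] by (simp add: B_def)
    define P where "P = {(x, y). E x y \<and> x \<in> H \<union> {s, t} \<and> y \<in> H \<union> {s, t}}"
    have "sym P" using E_sym by (auto simp: P_def intro!: symI)
    have conn: "(b, y) \<in> P\<^sup>*" if "y \<in> H" for y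
    proof -
      have "(b, y) \<in> Q\<^sup>*" using that by (simp add: H_def)
      then show ?thesis
      proof induction
        case (step y z)
        then have "y \<in> H" "z \<in> H" "E y z"
            using rtrancl_into_rtrancl[OF step(1,2)] by (auto simp: H_def Q_def)
          then have "(y, z) \<in> P" by (simp add: P_def)
        with step.IH show ?case by (rule rtrancl_into_rtrancl)
      qed simp
    qed
    have conn': "(b, z) \<in> P\<^sup>*" if z: "z \<in> S" "z \<in> {s, t}" for z
    proof -
      obtain x where "x \<in> H" "E x z" using z(1) by (auto simp: S_def)
      then have "(x, z) \<in> P" using z(2) by (auto simp: P_def)
      with conn[OF \<open>x \<in> H\<close>] show ?thesis by (rule rtrancl_into_rtrancl)
    qed
    have "(s, b) \<in> P\<^sup>*" using conn'[of s] st sym_rtrancl[OF \<open>sym P\<close>] by (auto dest: symD)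
    then have "(s, t) \<in> P\<^sup>*" using conn'[of t] st by (auto intro: rtrancl_trans)
    then show "(s, t) \<in> {(x, y). E x y \<and> x \<in> H \<union> {s, t} \<and> y \<in> H \<union> {s, t}}\<^sup>*"
      by (simp add: P_def)
  qed
  have sub: "H \<union> S \<subset> A"
    using less.prems HB E_irrefl by (auto simp: S_def B_def)
  then have smaller: "card (H \<union> S) < card A" "card H < card A" and fin: "finite (H \<union> S)" "finite H"
    using psubset_card_mono[OF less.prems(1)] finite_subset[of "H \<union> S" A] less.prems(1)
      psubset_card_mono[OF less.prems(1), of H] by auto
  \<comment> \<open>If some \<open>s\<close> in \<open>S\<close> misses a vertex of
    \<open>H \<union> S\<close>, induction with base point \<open>s\<close> yields a simplicial
    vertex not adjacent to \<open>s\<close>; it lies in \<open>H\<close>, since \<open>S\<close> is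
    a clique. Otherwise \<open>S\<close> is joined to everything, and a vertex simplicial in
    \<open>H\<close> suffices.\<close>
  have "\<exists>v\<in>H. simplicial_in E (H \<union> S) v"
  proof (cases "\<exists>s\<in>S. \<exists>w\<in>H \<union> S. w \<noteq> s \<and> \<not> E s w")
    case True
    then obtain s w where sw: "s \<in> S" "w \<in> H \<union> S" "w \<noteq> s" "\<not> E s w" by blast
    then obtain v where v: "simplicial_in E (H \<union> S) v" "v \<noteq> s" "\<not> E s v"
      using less.hyps[OF smaller(1) fin(1), of s w] by auto
    then have "v \<notin> S" using S_clique[OF sw(1), of v] by blast
    then show ?thesis using v(1) by (auto simp: simplicial_in_def)
  next
    case False
    have "\<exists>v. simplicial_in E H v"
    proof (cases "\<exists>x\<in>H. \<exists>y\<in>H. y \<noteq> x \<and> \<not> E x y")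
      case True
      then obtain x y where "x \<in> H" "y \<in> H" "y \<noteq> x" "\<not> E x y" by blast
      then show ?thesis using less.hyps[OF smaller(2) fin(2), of x y] by blast
    next
      case False
      then have "simplicial_in E H b" using b by (auto simp: simplicial_in_def)
      then show ?thesis by blast
    qed
    then obtain v where v: "simplicial_in E H v" by blast
    have "simplicial_in E (H \<union> S) v"
      unfolding simplicial_in_def
    proof (intro conjI ballI impI)
      show "v \<in> H \<union> S" using v by (simp add: simplicial_in_def)
      fix x y assume xy: "x \<in> H \<union> S" "y \<in> H \<union> S" "E v x" "E v y" "x \<noteq> y"
      have dom: "E s w" if "s \<in> S" "w \<in> H \<union> S" "w \<noteq> s" for s w using False that by blast
      consider "x \<in> S" | "y \<in> S" | "x \<in> H" "y \<in> H" using xy by blast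
      then show "E x y"
      proof cases
        case 1 then show ?thesis using dom xy by blast
      next
        case 2 then show ?thesis using dom[of y x] xy E_sym by blast
      next
        case 3 then show ?thesis using simplicial_inD[OF v] xy by blast
      qed
    qed
    moreover have "v \<in> H" using v by (simp add: simplicial_in_def)
    ultimately show ?thesis by blast
  qed
  then obtain v where v: "v \<in> H" "simplicial_in E (H \<union> S) v" by blast
  \<comment> \<open>All neighbours in \<open>A\<close> of a vertex of \<open>H\<close> lie in
    \<open>H \<union> S\<close>, so simpliciality passes to \<open>A\<close>.\<close>
  have "simplicial_in E A v"
    unfolding simplicial_in_def
  proof (intro conjI ballI impI)
    show "v \<in> A" using HB[OF v(1)] by (simp add: B_def)
    fix x y assume xy: "x \<in> A" "y \<in> A" "E v x" "E v y" "x \<noteq> y"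
    show "E x y" using simplicial_inD[OF v(2) nbr nbr] v(1) xy by blast
  qed
  then show ?case using HB[OF v(1)] by (auto simp: B_def)
qed

lemma chordal_simplicial_exists:
  assumes "simple_graph E" "chordal E" "finite A" "A \<noteq> {}"
  shows "\<exists>v. simplicial_in E A v"
proof (cases "\<exists>a\<in>A. \<exists>b\<in>A. b \<noteq> a \<and> \<not> E a b")
  case True
  then show ?thesis using simplicial_nonneighbour[OF assms(1-3)] by blast
next
  case False
  obtain v where "v \<in> A" using assms(4) by blast
  with False have "simplicial_in E A v" by (auto simp: simplicial_in_def)
  then show ?thesis by blast
qed

lemma chordal_elimination_on:
  assumes "simple_graph E" "chordal E" "finite A"
  shows "\<exists>r :: 'v \<Rightarrow> nat. inj_on r A \<and> (\<forall>i\<in>A. \<forall>j\<in>A. \<forall>l\<in>A.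
    E i j \<longrightarrow> E i l \<longrightarrow> r i < r j \<longrightarrow> r i < r l \<longrightarrow> j \<noteq> l \<longrightarrow> E j l)"
  using assms(3)
proof (induction "card A" arbitrary: A)
  case 0
  then show ?case by auto
next
  case (Suc n)
  then have "A \<noteq> {}" by auto
  then obtain v where v: "simplicial_in E A v"
    using chordal_simplicial_exists[OF assms(1,2)] Suc.prems by blast
  then have "v \<in> A" by (simp add: simplicial_in_def)
  have "n = card (A - {v})" using Suc.hyps(2) Suc.prems \<open>v \<in> A\<close> by simp
  then obtain r :: "'v \<Rightarrow> nat" where ih: "inj_on r (A - {v}) \<and>
      (\<forall>i\<in>A - {v}. \<forall>j\<in>A - {v}. \<forall>l\<in>A - {v}.
        E i j \<longrightarrow> E i l \<longrightarrow> r i < r j \<longrightarrow> r i < r l \<longrightarrow> j \<noteq> l \<longrightarrow> E j l)"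
    using Suc.hyps(1)[OF \<open>n = card (A - {v})\<close> finite_Diff[OF Suc.prems]] by (elim exE) (rule that)
  note r = conjunct1[OF ih] and rc = conjunct2[OF ih, rule_format]
  define r' where "r' x = (if x = v then 0 else Suc (r x))" for x
  have "inj_on r' A"
    using r by (auto simp: inj_on_def r'_def)
  moreover have "E j l" if "i \<in> A" "j \<in> A" "l \<in> A" "E i j" "E i l" "r' i < r' j" "r' i < r' l" "j \<noteq> l"
    for i j l
  proof (cases "i = v")
    case True
    then show ?thesis using simplicial_inD[OF v] that by blast
  next
    case False
    then have "j \<noteq> v" "l \<noteq> v" using that by (auto simp: r'_def)
    then show ?thesis using rc[of i j l] that False by (simp add: r'_def)
  qed
  ultimately show ?case by (intro exI[of _ r'] conjI ballI impI)
qed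

lemma chordal_perfect_elimination_order:
  fixes E :: "'v::finite \<Rightarrow> 'v \<Rightarrow> bool"
  assumes "simple_graph E" "chordal E"
  shows "\<exists>r. perfect_elimination_order E r"
proof -
  obtain r :: "'v \<Rightarrow> nat" where r: "inj r"
    "\<And>i j l. E i j \<Longrightarrow> E i l \<Longrightarrow> r i < r j \<Longrightarrow> r i < r l \<Longrightarrow> j \<noteq> l \<Longrightarrow> E j l"
    using chordal_elimination_on[OF assms finite_UNIV] by auto
  have "perfect_elimination_order E r"
  proof
    show "E x y \<Longrightarrow> E y x" for x y
      using assms(1) unfolding simple_graph_def by (auto dest: sympD)
    show "\<not> E x x" for x
      using assms(1) unfolding simple_graph_def by (auto dest: irreflpD)
  qed (rule r; assumption)+
  then show ?thesis by blast
qed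

section \<open>Regular sequences and filtrations by cones\<close>

definition ideal_set :: "'a::comm_ring_1 set \<Rightarrow> bool" where
  "ideal_set N \<longleftrightarrow> 0 \<in> N \<and> (\<forall>x\<in>N. \<forall>y\<in>N. x + y \<in> N) \<and> (\<forall>r. \<forall>x\<in>N. r * x \<in> N)"

lemma ideal_set_zero: "ideal_set N \<Longrightarrow> 0 \<in> N"
  and ideal_set_add: "ideal_set N \<Longrightarrow> x \<in> N \<Longrightarrow> y \<in> N \<Longrightarrow> x + y \<in> N"
  and ideal_set_mult: "ideal_set N \<Longrightarrow> x \<in> N \<Longrightarrow> r * x \<in> N"
  by (simp_all add: ideal_set_def)

lemma ideal_set_diff: "ideal_set N \<Longrightarrow> x \<in> N \<Longrightarrow> y \<in> N \<Longrightarrow> x - y \<in> N"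
  using ideal_set_add[of N x "- y"] ideal_set_mult[of N y "- 1"] by simp

lemma ideal_set_sum: "ideal_set N \<Longrightarrow> (\<And>i. i \<in> A \<Longrightarrow> f i \<in> N) \<Longrightarrow> sum f A \<in> N"
  by (induction A rule: infinite_finite_induct) (auto simp: ideal_set_zero ideal_set_add)

lemma ideal_set_UNIV: "ideal_set UNIV" by (simp add: ideal_set_def)

text \<open>\<open>extension g j M N\<close> is \<open>N + (g\<^sub>0, \<dots>, g\<^sub>j\<^sub>-\<^sub>1) M\<close>, so \<open>regular_on g k M N\<close> says that
  \<open>g\<^sub>0, \<dots>, g\<^sub>k\<^sub>-\<^sub>1\<close> is a weakly regular sequence on \<open>M/N\<close>.\<close>

definition extension :: "(nat \<Rightarrow> 'a) \<Rightarrow> nat \<Rightarrow> 'a set \<Rightarrow> 'a set \<Rightarrow> 'a::comm_ring_1 set" where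
  "extension g j M N = {n + (\<Sum>i<j. g i * y i) | n y. n \<in> N \<and> (\<forall>i<j. y i \<in> M)}"

definition regular_on :: "(nat \<Rightarrow> 'a) \<Rightarrow> nat \<Rightarrow> 'a set \<Rightarrow> 'a::comm_ring_1 set \<Rightarrow> bool" where
  "regular_on g k M N \<longleftrightarrow>
    (\<forall>j<k. \<forall>x\<in>M. g j * x \<in> extension g j M N \<longrightarrow> x \<in> extension g j M N)"

lemma extensionI: "n \<in> N \<Longrightarrow> (\<And>i. i < j \<Longrightarrow> y i \<in> M) \<Longrightarrow> n + (\<Sum>i<j. g i * y i) \<in> extension g j M N"
  unfolding extension_def by blast

lemma extensionE:
  assumes "x \<in> extension g j M N"
  obtains n y where "x = n + (\<Sum>i<j. g i * y i)" "n \<in> N" "\<And>i. i < j \<Longrightarrow> y i \<in> M"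
  using assms unfolding extension_def by blast

lemma extension_0: "extension g 0 M N = N"
  by (simp add: extension_def)

lemma extension_Suc: "extension g (Suc j) M N = {a + g j * y | a y. a \<in> extension g j M N \<and> y \<in> M}"
proof (intro subset_antisym subsetI)
  fix x assume "x \<in> extension g (Suc j) M N"
  then obtain n y where y: "x = n + (\<Sum>i<Suc j. g i * y i)" "n \<in> N" "\<And>i. i < Suc j \<Longrightarrow> y i \<in> M"
    by (rule extensionE) blast
  have "n + (\<Sum>i<j. g i * y i) \<in> extension g j M N" using y by (intro extensionI) auto
  moreover have "x = (n + (\<Sum>i<j. g i * y i)) + g j * y j" using y(1) by (simp add: add.assoc)
  ultimately show "x \<in> {a + g j * y | a y. a \<in> extension g j M N \<and> y \<in> M}" using y(3) by blast
next
  fix x assume "x \<in> {a + g j * y | a y. a \<in> extension g j M N \<and> y \<in> M}"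
  then obtain a z where az: "x = a + g j * z" "a \<in> extension g j M N" "z \<in> M" by blast
  from az(2) obtain n y where y: "a = n + (\<Sum>i<j. g i * y i)" "n \<in> N" "\<And>i. i < j \<Longrightarrow> y i \<in> M"
    by (rule extensionE) blast
  have "n + (\<Sum>i<Suc j. g i * (y(j := z)) i) \<in> extension g (Suc j) M N"
    using y az by (intro extensionI) (auto simp: less_Suc_eq)
  moreover have "n + (\<Sum>i<Suc j. g i * (y(j := z)) i) = x" using az y by (simp add: add.assoc)
  ultimately show "x \<in> extension g (Suc j) M N" by simp
qed

lemma extension_ideal_set:
  assumes "ideal_set M" "ideal_set N"
  shows "ideal_set (extension g j M N)"
proof (induction j)
  case 0
  then show ?case by (simp add: extension_0 assms)
next
  case (Suc j)
  have "0 \<in> extension g (Suc j) M N"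
    unfolding extension_Suc using ideal_set_zero[OF Suc] ideal_set_zero[OF assms(1)] by force
  moreover have "x + y \<in> extension g (Suc j) M N"
    if xy: "x \<in> extension g (Suc j) M N" "y \<in> extension g (Suc j) M N" for x y
  proof -
    obtain a z b w where "x = a + g j * z" "y = b + g j * w" "a \<in> extension g j M N"
      "b \<in> extension g j M N" "z \<in> M" "w \<in> M" using xy unfolding extension_Suc by blast
    then have "x + y = (a + b) + g j * (z + w)" "a + b \<in> extension g j M N" "z + w \<in> M"
      using ideal_set_add[OF Suc] ideal_set_add[OF assms(1)] by (auto simp: algebra_simps)
    then show ?thesis unfolding extension_Suc by blast
  qed
  moreover have "r * x \<in> extension g (Suc j) M N" if x: "x \<in> extension g (Suc j) M N" for r x
  proof -
    obtain a z where "x = a + g j * z" "a \<in> extension g j M N" "z \<in> M"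
      using x unfolding extension_Suc by blast
    then have "r * x = r * a + g j * (r * z)" "r * a \<in> extension g j M N" "r * z \<in> M"
      using ideal_set_mult[OF Suc] ideal_set_mult[OF assms(1)]
      by (auto simp: distrib_left mult.left_commute)
    then show ?thesis unfolding extension_Suc by blast
  qed
  ultimately show ?case unfolding ideal_set_def by blast
qed

lemma extension_base_subset: "0 \<in> M \<Longrightarrow> N \<subseteq> extension g j M N"
proof
  fix n assume "0 \<in> M" "n \<in> N"
  then have "n + (\<Sum>i<j. g i * 0) \<in> extension g j M N" by (intro extensionI) auto
  then show "n \<in> extension g j M N" by simp
qed

lemma extension_mono: "M \<subseteq> M' \<Longrightarrow> N \<subseteq> N' \<Longrightarrow> extension g j M N \<subseteq> extension g j M' N'"
  unfolding extension_def by blast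

lemma regular_onD:
  "regular_on g k M N \<Longrightarrow> j < k \<Longrightarrow> x \<in> M \<Longrightarrow> g j * x \<in> extension g j M N \<Longrightarrow> x \<in> extension g j M N"
  by (simp add: regular_on_def)

text \<open>Regularity on \<open>M' / M\<close> forces the last coefficient into \<open>M\<close>
  plus multiples of the earlier elements. It is replaced by its part in \<open>M\<close>, and the
  remainder is absorbed in the earlier coefficients. This is the exactness on the left that survives
  reduction modulo the sequence.\<close>

lemma combination_in_submodule:
  assumes "ideal_set M'" "ideal_set M" "regular_on g k M' M"
  shows "j \<le> k \<Longrightarrow> (\<And>i. i < j \<Longrightarrow> y i \<in> M') \<Longrightarrow> (\<Sum>i<j. g i * y i) \<in> M \<Longrightarrow>
    \<exists>z. (\<forall>i<j. z i \<in> M) \<and> (\<Sum>i<j. g i * y i) = (\<Sum>i<j. g i * z i)"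
proof (induction j arbitrary: y)
  case 0
  then show ?case by simp
next
  case (Suc j)
  have "g j * y j = (\<Sum>i<Suc j. g i * y i) + (\<Sum>i<j. g i * (- y i))"
    by (simp add: sum_negf)
  also have "\<dots> \<in> extension g j M' M"
    using Suc.prems ideal_set_mult[OF assms(1), of _ "- 1"] by (intro extensionI) auto
  finally have gy: "g j * y j \<in> extension g j M' M" .
  have "y j \<in> extension g j M' M"
    by (rule regular_onD[OF assms(3) _ _ gy]) (simp_all add: Suc.prems(2) Suc_le_lessD[OF Suc.prems(1)])
  then obtain m w where w: "y j = m + (\<Sum>i<j. g i * w i)" "m \<in> M" "\<And>i. i < j \<Longrightarrow> w i \<in> M'"
    by (rule extensionE) blast
  define y' where "y' i = y i + g j * w i" for i
  have eq: "(\<Sum>i<Suc j. g i * y i) = (\<Sum>i<j. g i * y' i) + g j * m"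
    by (simp add: w(1) y'_def algebra_simps sum.distrib sum_distrib_left)
  have "(\<Sum>i<j. g i * y' i) \<in> M"
    using ideal_set_diff[OF assms(2) Suc.prems(3) ideal_set_mult[OF assms(2) w(2), of "g j"]] eq
    by simp
  moreover have "y' i \<in> M'" if "i < j" for i
    unfolding y'_def using that w(3) Suc.prems(2)
    by (intro ideal_set_add[OF assms(1)] ideal_set_mult[OF assms(1)]) auto
  ultimately obtain z where z: "\<forall>i<j. z i \<in> M" "(\<Sum>i<j. g i * y' i) = (\<Sum>i<j. g i * z i)"
    using Suc.IH[of y'] Suc.prems(1) by auto
  have "(\<Sum>i<Suc j. g i * (z(j := m)) i) = (\<Sum>i<j. g i * z i) + g j * m" by simp
  then have "(\<Sum>i<Suc j. g i * y i) = (\<Sum>i<Suc j. g i * (z(j := m)) i)" using eq z(2) by simp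
  moreover have "\<forall>i<Suc j. (z(j := m)) i \<in> M" using z(1) w(2) by (auto simp: less_Suc_eq)
  ultimately show ?case by blast
qed

text \<open>Regularity on \<open>M' / M\<close> writes \<open>x\<close> as an element
  \<open>m\<close> of \<open>M\<close> plus multiples of the earlier elements. By
  \<open>combination_in_submodule\<close> the resulting relation for \<open>m\<close> can be
  rewritten with coefficients in \<open>M\<close>, where regularity on \<open>M / N\<close>
  applies.\<close>

lemma regular_on_trans:
  assumes "ideal_set M'" "ideal_set M" "ideal_set N" "N \<subseteq> M" "M \<subseteq> M'"
    and "regular_on g k M' M" "regular_on g k M N"
  shows "regular_on g k M' N"
  unfolding regular_on_def
proof (intro allI impI ballI)
  fix j x assume j: "j < k" and x: "x \<in> M'" and gx: "g j * x \<in> extension g j M' N"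
  have "x \<in> extension g j M' M"
    using extension_mono[of M' M' N M g j] assms(4) gx by (intro regular_onD[OF assms(6) j x]) auto
  then obtain m w where w: "x = m + (\<Sum>i<j. g i * w i)" "m \<in> M" "\<And>i. i < j \<Longrightarrow> w i \<in> M'"
    by (rule extensionE) blast
  obtain n y where y: "g j * x = n + (\<Sum>i<j. g i * y i)" "n \<in> N" "\<And>i. i < j \<Longrightarrow> y i \<in> M'"
    using gx by (rule extensionE) blast
  define v where "v i = y i - g j * w i" for i
  have v: "v i \<in> M'" if "i < j" for i
    unfolding v_def using that w(3) y(3)
    by (intro ideal_set_diff[OF assms(1)] ideal_set_mult[OF assms(1)]) auto
  have gm: "g j * m = g j * x - (\<Sum>i<j. g i * (g j * w i))"
    by (simp add: w(1) algebra_simps sum_distrib_left)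
  have eq: "g j * m = n + (\<Sum>i<j. g i * v i)"
    unfolding gm y(1) by (simp add: v_def algebra_simps sum_subtractf)
  have "(\<Sum>i<j. g i * v i) \<in> M"
    using ideal_set_diff[OF assms(2) ideal_set_mult[OF assms(2) w(2), of "g j"], of n] eq y(2) assms(4)
    by auto
  then obtain z where z: "\<forall>i<j. z i \<in> M" "(\<Sum>i<j. g i * v i) = (\<Sum>i<j. g i * z i)"
    using combination_in_submodule[OF assms(1,2,6), of j v] v j by auto
  have "g j * m \<in> extension g j M N"
    unfolding eq z(2) using y(2) z(1) by (intro extensionI) auto
  then have "m \<in> extension g j M N" by (rule regular_onD[OF assms(7) j w(2)])
  then have "m \<in> extension g j M' N" using extension_mono[OF assms(5), of N N g j] by blast
  moreover have "0 + (\<Sum>i<j. g i * w i) \<in> extension g j M' N"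
    using w(3) ideal_set_zero[OF assms(3)] by (intro extensionI) auto
  ultimately show "x \<in> extension g j M' N"
    using ideal_set_add[OF extension_ideal_set[OF assms(1,3)]] w(1) by fastforce
qed

text \<open>Multiplication by \<open>b\<close> identifies the ring modulo \<open>P\<close> with \<open>M/N\<close>.\<close>

lemma regular_on_cyclic:
  assumes M: "ideal_set M" and N: "ideal_set N" and b: "b \<in> M"
    and gen: "\<And>x. x \<in> M \<Longrightarrow> \<exists>q. x - b * q \<in> N"
    and ann: "\<And>q. b * q \<in> N \<longleftrightarrow> q \<in> P"
    and reg: "regular_on g k UNIV P"
  shows "regular_on g k M N"
  unfolding regular_on_def
proof (intro allI impI ballI)
  fix j x assume j: "j < k" and x: "x \<in> M" and gx: "g j * x \<in> extension g j M N"
  obtain q where q: "x - b * q \<in> N" using gen[OF x] by blast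
  obtain n y where y: "g j * x = n + (\<Sum>i<j. g i * y i)" "n \<in> N" "\<And>i. i < j \<Longrightarrow> y i \<in> M"
    using gx by (rule extensionE) blast
  have "\<forall>i. \<exists>p. i < j \<longrightarrow> y i - b * p \<in> N" using gen y(3) by blast
  then obtain p where p: "\<And>i. i < j \<Longrightarrow> y i - b * p i \<in> N" by metis
  have "b * (g j * q - (\<Sum>i<j. g i * p i)) =
      n + (\<Sum>i<j. g i * (y i - b * p i)) - g j * (x - b * q)"
    using y(1) by (simp add: algebra_simps sum_subtractf sum_distrib_left)
  also have "\<dots> \<in> N"
  proof (rule ideal_set_diff[OF N ideal_set_add[OF N y(2) ideal_set_sum[OF N]]])
    show "g i * (y i - b * p i) \<in> N" if "i \<in> {..<j}" for i
      using that by (intro ideal_set_mult[OF N] p) simp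
    show "g j * (x - b * q) \<in> N" by (rule ideal_set_mult[OF N q])
  qed
  finally have "g j * q - (\<Sum>i<j. g i * p i) \<in> P" using ann by blast
  then have "(g j * q - (\<Sum>i<j. g i * p i)) + (\<Sum>i<j. g i * p i) \<in> extension g j UNIV P"
    by (intro extensionI) auto
  then have "g j * q \<in> extension g j UNIV P" by (simp only: diff_add_cancel)
  then have "q \<in> extension g j UNIV P" by (rule regular_onD[OF reg j UNIV_I])
  then obtain n' w where w: "q = n' + (\<Sum>i<j. g i * w i)" "n' \<in> P" by (rule extensionE) blast
  have "x = (x - b * q + b * n') + (\<Sum>i<j. g i * (w i * b))"
    by (simp add: w(1) algebra_simps sum_distrib_left)
  also have "\<dots> \<in> extension g j M N"
    using q w(2) ann by (intro extensionI ideal_set_add[OF N] ideal_set_mult[OF M b]) simp_all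
  finally show "x \<in> extension g j M N" .
qed

section \<open>Supports, monomials and monomial ideals\<close>

definition restrict_keys :: "'a set \<Rightarrow> ('a \<Rightarrow>\<^sub>0 'b::zero) \<Rightarrow> 'a \<Rightarrow>\<^sub>0 'b" where
  "restrict_keys A p = Abs_poly_mapping (\<lambda>u. if u \<in> A then Poly_Mapping.lookup p u else 0)"

lemma lookup_restrict_keys: "Poly_Mapping.lookup (restrict_keys A p) u = (if u \<in> A then Poly_Mapping.lookup p u else 0)"
proof -
  have "finite {u. (if u \<in> A then Poly_Mapping.lookup p u else 0) \<noteq> 0}"
    by (rule finite_subset[OF _ finite_keys[of p]]) (auto simp: in_keys_iff)
  then show ?thesis unfolding restrict_keys_def by simp
qed

lemma keys_restrict_keys: "Poly_Mapping.keys (restrict_keys A p) = Poly_Mapping.keys p \<inter> A"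
  by (auto simp: in_keys_iff lookup_restrict_keys split: if_splits)

lemma restrict_keys_add:
  "restrict_keys A (p + q :: 'a \<Rightarrow>\<^sub>0 'b::monoid_add) = restrict_keys A p + restrict_keys A q"
  by (rule poly_mapping_eqI) (simp add: lookup_restrict_keys lookup_add)

lemma restrict_keys_zero: "restrict_keys A 0 = 0"
  by (rule poly_mapping_eqI) (simp add: lookup_restrict_keys)

lemma restrict_keys_sum:
  "restrict_keys A (\<Sum>i\<in>I. f i :: 'a \<Rightarrow>\<^sub>0 'b::comm_monoid_add) = (\<Sum>i\<in>I. restrict_keys A (f i))"
  by (induction I rule: infinite_finite_induct) (simp_all add: restrict_keys_add restrict_keys_zero)

lemma restrict_keys_id: "Poly_Mapping.keys p \<subseteq> A \<Longrightarrow> restrict_keys A p = p"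
  by (rule poly_mapping_eqI) (auto simp: lookup_restrict_keys in_keys_iff)

lemma restrict_keys_empty: "Poly_Mapping.keys p \<inter> A = {} \<Longrightarrow> restrict_keys A p = 0"
  by (rule poly_mapping_eqI) (auto simp: lookup_restrict_keys in_keys_iff)

lemma restrict_keys_Compl:
  "p = restrict_keys A p + restrict_keys (- A) (p :: 'a \<Rightarrow>\<^sub>0 'b::monoid_add)"
  by (rule poly_mapping_eqI) (simp add: lookup_restrict_keys lookup_add)

lemma poly_mapping_sum_single:
  "p = (\<Sum>u\<in>Poly_Mapping.keys p. Poly_Mapping.single u (Poly_Mapping.lookup p u :: 'b::comm_monoid_add))"
  by (rule poly_mapping_eqI)
    (simp add: lookup_sum lookup_single when_def in_keys_iff)

definition exp_monom :: "('v::finite \<Rightarrow> nat) \<Rightarrow> ('v, 'k::field) mpoly" where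
  "exp_monom b = Poly_Mapping.single (Abs_poly_mapping b) 1"

lemma Abs_plus: "Abs_poly_mapping (\<lambda>i. a i + b i :: nat) = Abs_poly_mapping a + Abs_poly_mapping (b :: 'v::finite \<Rightarrow> nat)"
  by (rule poly_mapping_eqI) (simp add: lookup_add)

lemma keys_monom_mult: "Poly_Mapping.keys (exp_monom b * q) = (\<lambda>u. Abs_poly_mapping b + u) ` Poly_Mapping.keys q"
proof -
  define e where "e = Abs_poly_mapping b"
  have "Poly_Mapping.lookup (Poly_Mapping.single e 1 * q) (e + d) = Poly_Mapping.lookup q d" for d
  proof -
    have "Poly_Mapping.single e 1 * q = (\<Sum>u\<in>Poly_Mapping.keys q. Poly_Mapping.single (e + u) (Poly_Mapping.lookup q u))"
      by (subst poly_mapping_sum_single[of q]) (simp add: sum_distrib_left mult_single)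
    then show ?thesis
      by (simp add: lookup_sum lookup_single when_def in_keys_iff)
  qed
  moreover have "Poly_Mapping.keys (Poly_Mapping.single e 1 * q) \<subseteq> (\<lambda>u. e + u) ` Poly_Mapping.keys q"
    using keys_mult[of "Poly_Mapping.single e 1" q] by (auto split: if_splits)
  ultimately show ?thesis
    unfolding exp_monom_def e_def[symmetric] by (auto simp: in_keys_iff)
qed

lemma monom_factor:
  assumes "\<And>u. u \<in> Poly_Mapping.keys p \<Longrightarrow> b \<le> Poly_Mapping.lookup u"
  shows "\<exists>q. p = exp_monom b * q"
proof
  define e where "e = Abs_poly_mapping b"
  have e: "e + (u - e) = u" if "u \<in> Poly_Mapping.keys p" for u
    using assms[OF that]
    by (intro poly_mapping_eqI) (simp add: lookup_add lookup_minus e_def le_fun_def)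
  have "exp_monom b * (\<Sum>u\<in>Poly_Mapping.keys p. Poly_Mapping.single (u - e) (Poly_Mapping.lookup p u)) = (\<Sum>u\<in>Poly_Mapping.keys p. Poly_Mapping.single (e + (u - e)) (Poly_Mapping.lookup p u))"
    by (simp add: exp_monom_def e_def[symmetric] sum_distrib_left mult_single)
  also have "\<dots> = (\<Sum>u\<in>Poly_Mapping.keys p. Poly_Mapping.single u (Poly_Mapping.lookup p u))" using e by (intro sum.cong) auto
  also have "\<dots> = p" by (rule poly_mapping_sum_single[symmetric])
  finally show "p = exp_monom b * (\<Sum>u\<in>Poly_Mapping.keys p. Poly_Mapping.single (u - e) (Poly_Mapping.lookup p u))" by simp
qed

lemma monom_mult: "exp_monom a * exp_monom b = exp_monom (\<lambda>i. a i + b i)"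
  by (simp add: exp_monom_def mult_single Abs_plus)

text \<open>For down-closed \<open>L\<close> this is a monomial ideal, and the monomials with
  exponents in \<open>L\<close> form a basis of the quotient by it.\<close>

definition avoiding :: "('v \<Rightarrow> nat) set \<Rightarrow> ('v, 'k::field) mpoly set" where
  "avoiding L = {p. \<forall>u\<in>Poly_Mapping.keys p. Poly_Mapping.lookup u \<notin> L}"

lemma avoiding_ideal_set:
  assumes "down_closed L"
  shows "ideal_set (avoiding L :: ('v::finite, 'k::field) mpoly set)"
  unfolding ideal_set_def
proof (intro conjI ballI allI)
  show "0 \<in> avoiding L" by (simp add: avoiding_def)
  show "x + y \<in> avoiding L" if "x \<in> avoiding L" "y \<in> avoiding L" for x y :: "('v, 'k) mpoly"
    using that keys_add[of x y] unfolding avoiding_def by blast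
  show "r * x \<in> avoiding L" if x: "x \<in> avoiding L" for r x :: "('v, 'k) mpoly"
    unfolding avoiding_def
  proof (intro CollectI ballI notI)
    fix u assume u: "u \<in> Poly_Mapping.keys (r * x)" "Poly_Mapping.lookup u \<in> L"
    then obtain a b where "u = a + b" "b \<in> Poly_Mapping.keys x" using keys_mult[of r x] by blast
    then have "Poly_Mapping.lookup b \<le> Poly_Mapping.lookup u" by (simp add: lookup_add le_fun_def)
    then have "Poly_Mapping.lookup b \<in> L" using assms u(2) unfolding down_closed_def by blast
    then show False using x \<open>b \<in> Poly_Mapping.keys x\<close> by (simp add: avoiding_def)
  qed
qed

lemma monom_mult_avoiding:
  "exp_monom b * q \<in> avoiding L \<longleftrightarrow> (\<forall>u\<in>Poly_Mapping.keys q. (\<lambda>i. b i + Poly_Mapping.lookup u i) \<notin> L)"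
  by (simp add: avoiding_def keys_monom_mult lookup_add[abs_def])

lemma monom_avoiding: "(exp_monom b :: ('v::finite, 'k::field) mpoly) \<in> avoiding L \<longleftrightarrow> b \<notin> L"
  by (simp add: avoiding_def exp_monom_def)

text \<open>The factor is generated by the monomial with exponent \<open>b\<close>, and its
  annihilator consists of the polynomials avoiding the cone at the origin. So the factor is a
  shifted polynomial ring in the variables of \<open>F\<close>.\<close>

lemma regular_on_cone:
  fixes g :: "nat \<Rightarrow> ('v::finite, 'k::field) mpoly"
  assumes L: "down_closed L" "down_closed (L \<union> coord_cone b F)" "L \<inter> coord_cone b F = {}"
    and reg: "regular_on g k UNIV (avoiding (coord_cone (\<lambda>_. 0) F))"
  shows "regular_on g k (avoiding L) (avoiding (L \<union> coord_cone b F))"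
proof (rule regular_on_cyclic[OF avoiding_ideal_set[OF L(1)] avoiding_ideal_set[OF L(2)]])
  have "b \<in> coord_cone b F" by (simp add: coord_cone_def)
  then have "b \<notin> L" using L(3) by blast
  then show "exp_monom b \<in> avoiding L" by (simp add: monom_avoiding)
  show "regular_on g k UNIV (avoiding (coord_cone (\<lambda>_. 0) F))" by (rule reg)
  show "\<exists>q. x - exp_monom b * q \<in> avoiding (L \<union> coord_cone b F)" if x: "x \<in> avoiding L" for x :: "('v, 'k) mpoly"
  proof -
    define A where "A = {u. Poly_Mapping.lookup u \<in> coord_cone b F}"
    obtain q where q: "restrict_keys A x = exp_monom b * q"
      using monom_factor[of "restrict_keys A x" b] by (auto simp: keys_restrict_keys A_def coord_cone_def)
    have "x - exp_monom b * q = restrict_keys (- A) x"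
      using restrict_keys_Compl[of x A] q by (metis add_diff_cancel_left')
    also have "\<dots> \<in> avoiding (L \<union> coord_cone b F)"
      using x by (auto simp: avoiding_def keys_restrict_keys A_def)
    finally show ?thesis by blast
  qed
  show "exp_monom b * q \<in> avoiding (L \<union> coord_cone b F) \<longleftrightarrow> q \<in> avoiding (coord_cone (\<lambda>_. 0) F)" for q :: "('v, 'k) mpoly"
  proof -
    have "(\<lambda>i. b i + w i) \<notin> L" for w
    proof
      assume "(\<lambda>i. b i + w i) \<in> L"
      moreover have "b \<le> (\<lambda>i. b i + w i)" by (simp add: le_fun_def)
      ultimately show False using L(1) \<open>b \<notin> L\<close> unfolding down_closed_def by blast
    qed
    moreover have "(\<lambda>i. b i + w i) \<in> coord_cone b F \<longleftrightarrow> w \<in> coord_cone (\<lambda>_. 0) F" for w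
      by (auto simp: coord_cone_def le_fun_def)
    ultimately show ?thesis unfolding monom_mult_avoiding by (simp add: avoiding_def)
  qed
qed

lemma regular_on_less: "regular_on g k M N \<Longrightarrow> k' \<le> k \<Longrightarrow> regular_on g k' M N"
  unfolding regular_on_def by auto

lemma cone_filtered_regular:
  fixes g :: "nat \<Rightarrow> ('v::finite, 'k::field) mpoly"
  assumes "cone_filtered k L" and reg: "\<And>F. regular_on g (card F) UNIV (avoiding (coord_cone (\<lambda>_. 0) F))"
  shows "regular_on g k UNIV (avoiding L)"
  using assms(1)
proof induction
  \<comment> \<open>The filtration starts with the zero quotient, on which every sequence is weakly
    regular.\<close>
  case empty
  have "avoiding {} = (UNIV :: ('v, 'k) mpoly set)" by (simp add: avoiding_def)
  moreover have "x \<in> extension g j UNIV UNIV" for x j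
    using extension_base_subset[of UNIV UNIV g j] by auto
  ultimately show ?case by (simp add: regular_on_def)
next
  case (add L b F)
  show ?case
  proof (rule regular_on_trans[OF ideal_set_UNIV avoiding_ideal_set avoiding_ideal_set])
    show "regular_on g k (avoiding L) (avoiding (L \<union> coord_cone b F))"
      using add reg[of F] by (intro regular_on_cone regular_on_less[OF reg[of F]])
  qed (use add in \<open>auto simp: avoiding_def\<close>)
qed

section \<open>Homogeneous components\<close>

definition total_deg :: "('v::finite \<Rightarrow>\<^sub>0 nat) \<Rightarrow> nat" where
  "total_deg u = (\<Sum>i\<in>UNIV. Poly_Mapping.lookup u i)"

lemma deg_add: "total_deg (u + v) = total_deg u + total_deg v"
  by (simp add: total_deg_def lookup_add sum.distrib)

definition hom_part :: "nat \<Rightarrow> ('v::finite, 'k::field) mpoly \<Rightarrow> ('v, 'k) mpoly" where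
  "hom_part d = restrict_keys {u. total_deg u = d}"

lemma hom_part_add: "hom_part d (p + q) = hom_part d p + hom_part d q"
  and hom_part_sum: "hom_part d (\<Sum>i\<in>I. f i) = (\<Sum>i\<in>I. hom_part d (f i))"
  by (simp_all add: hom_part_def restrict_keys_add restrict_keys_sum)

lemma keys_mult_deg:
  assumes "\<forall>u\<in>Poly_Mapping.keys g. total_deg u = c" "u \<in> Poly_Mapping.keys (g * p)"
  shows "\<exists>v\<in>Poly_Mapping.keys p. total_deg u = c + total_deg v"
proof -
  obtain a b where "u = a + b" "a \<in> Poly_Mapping.keys g" "b \<in> Poly_Mapping.keys p"
    using assms(2) keys_mult[of g p] by blast
  then show ?thesis using assms(1) by (auto simp: deg_add)
qed

lemma hom_part_mult:
  assumes g: "\<And>u. u \<in> Poly_Mapping.keys g \<Longrightarrow> total_deg u = c"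
  shows "hom_part (c + d) (g * p) = g * hom_part d p"
proof -
  define a b where "a = hom_part d p" and "b = restrict_keys (- {u. total_deg u = d}) p"
  have "p = a + b" unfolding a_def b_def hom_part_def by (rule restrict_keys_Compl)
  then have "hom_part (c + d) (g * p) = hom_part (c + d) (g * a) + hom_part (c + d) (g * b)"
    by (simp add: distrib_left hom_part_add)
  moreover have "hom_part (c + d) (g * a) = g * a"
    unfolding hom_part_def
  proof (rule restrict_keys_id, rule subsetI)
    fix u assume "u \<in> Poly_Mapping.keys (g * a)"
    then obtain v where "v \<in> Poly_Mapping.keys a" "total_deg u = c + total_deg v" using keys_mult_deg[of g c u a] g by blast
    then show "u \<in> {u. total_deg u = c + d}" by (simp add: a_def hom_part_def keys_restrict_keys)
  qed
  moreover have "hom_part (c + d) (g * b) = 0"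
    unfolding hom_part_def
  proof (rule restrict_keys_empty, rule ccontr)
    assume "Poly_Mapping.keys (g * b) \<inter> {u. total_deg u = c + d} \<noteq> {}"
    then obtain u where u: "u \<in> Poly_Mapping.keys (g * b)" "total_deg u = c + d" by blast
    obtain v where "v \<in> Poly_Mapping.keys b" "total_deg u = c + total_deg v" using keys_mult_deg[of g c u b] g u(1) by blast
    then show False using u(2) by (simp add: b_def keys_restrict_keys)
  qed
  ultimately show ?thesis by (simp add: a_def)
qed

lemma hom_part_mult_less:
  assumes g: "\<And>u. u \<in> Poly_Mapping.keys g \<Longrightarrow> total_deg u = c" and "d < c"
  shows "hom_part d (g * p) = 0"
  unfolding hom_part_def
proof (rule restrict_keys_empty, rule ccontr)
  assume "Poly_Mapping.keys (g * p) \<inter> {u. total_deg u = d} \<noteq> {}"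
  then obtain u where u: "u \<in> Poly_Mapping.keys (g * p)" "total_deg u = d" by blast
  obtain v where "v \<in> Poly_Mapping.keys p" "total_deg u = c + total_deg v" using keys_mult_deg[of g c u p] g u(1) by blast
  then show False using u(2) assms(2) by simp
qed

lemma sum_hom_part: "\<exists>m. p = (\<Sum>d<m. hom_part d p)"
proof -
  obtain m where m: "\<And>u. u \<in> Poly_Mapping.keys p \<Longrightarrow> total_deg u < m"
    using finite_nat_set_iff_bounded[of "total_deg ` Poly_Mapping.keys p"] by auto
  have "p = (\<Sum>d<m. hom_part d p)"
  proof (rule poly_mapping_eqI)
    fix u
    have "(\<Sum>d<m. Poly_Mapping.lookup (hom_part d p) u) = (\<Sum>d<m. if d = total_deg u then Poly_Mapping.lookup p u else 0)"
      by (intro sum.cong) (auto simp: hom_part_def lookup_restrict_keys)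
    then show "Poly_Mapping.lookup p u = Poly_Mapping.lookup (\<Sum>d<m. hom_part d p) u"
      using m[of u] by (auto simp: lookup_sum in_keys_iff)
  qed
  then show ?thesis by blast
qed

section \<open>Elementary symmetric polynomials modulo variables\<close>

definition indic :: "'v set \<Rightarrow> 'v \<Rightarrow> nat" where
  "indic A i = (if i \<in> A then 1 else 0)"

definition elem_sym :: "nat \<Rightarrow> ('v::finite, 'k::field) mpoly" where
  "elem_sym j = (\<Sum>A | card A = j. exp_monom (indic A))"

lemma keys_monom: "Poly_Mapping.keys (exp_monom b :: ('v::finite, 'k::field) mpoly) = {Abs_poly_mapping b}"
  by (simp add: exp_monom_def)

lemma keys_sum_subset: "Poly_Mapping.keys (\<Sum>i\<in>I. f i) \<subseteq> (\<Union>i\<in>I. Poly_Mapping.keys (f i))"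
proof (induction I rule: infinite_finite_induct)
  case (insert i I)
  then show ?case using keys_add[of "f i" "sum f I"] by auto
qed auto

lemma keys_elem_sym:
  "u \<in> Poly_Mapping.keys (elem_sym j :: ('v::finite, 'k::field) mpoly) \<Longrightarrow> \<exists>A. card A = j \<and> u = Abs_poly_mapping (indic A)"
  unfolding elem_sym_def using keys_sum_subset by (force simp: keys_monom)

lemma deg_indic: "total_deg (Abs_poly_mapping (indic (A :: 'v::finite set))) = card A"
  using sum.inter_restrict[of UNIV "\<lambda>_. 1 :: nat" A] by (simp add: total_deg_def indic_def)

lemma elem_sym_homogeneous: "u \<in> Poly_Mapping.keys (elem_sym j) \<Longrightarrow> total_deg u = j"
  by (auto dest!: keys_elem_sym simp: deg_indic)

text \<open>The shift omits \<open>elem_sym 0 = 1\<close>, so that a sequence indexed from 0 starts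
  in degree 1.\<close>

abbreviation esym_seq :: "nat \<Rightarrow> ('v::finite, 'k::field) mpoly" where
  "esym_seq j \<equiv> elem_sym (Suc j)"

text \<open>The ideal generated by the variables outside \<open>F\<close>. With
  \<open>F = - C\<close> it is the prime ideal generated by the variables of a cover
  \<open>C\<close>.\<close>

definition off_ideal :: "'v set \<Rightarrow> ('v::finite, 'k::field) mpoly set" where
  "off_ideal F = avoiding (coord_cone (\<lambda>_. 0) F)"

lemma off_ideal_iff: "p \<in> off_ideal F \<longleftrightarrow> (\<forall>u\<in>Poly_Mapping.keys p. \<exists>i. i \<notin> F \<and> Poly_Mapping.lookup u i \<noteq> 0)"
  by (auto simp: off_ideal_def avoiding_def coord_cone_def le_fun_def)

lemma off_ideal_ideal_set: "ideal_set (off_ideal F)"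
  unfolding off_ideal_def
proof (rule avoiding_ideal_set, unfold down_closed_def, intro ballI allI impI)
  fix u v :: "'a \<Rightarrow> nat" assume "u \<in> coord_cone (\<lambda>_. 0) F" and le: "v \<le> u"
  then have "u i = 0" if "i \<notin> F" for i using that by (simp add: coord_cone_def)
  then have "v i = 0" if "i \<notin> F" for i using that le by (metis le_fun_def le_zero_eq)
  then show "v \<in> coord_cone (\<lambda>_. 0) F" by (simp add: coord_cone_def le_fun_def)
qed

text \<open>The ideal generated by the variables outside \<open>F\<close> and the first \<open>j\<close> elementary symmetric
  polynomials. Setting a variable in \<open>F\<close> to \<open>0\<close> replaces \<open>F\<close> by \<open>F - {i}\<close>, which drives the
  induction on \<open>card F\<close>; variables and symmetric polynomials can be permuted in a regular sequence
  because everything is graded.\<close>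

definition esym_ideal :: "'v set \<Rightarrow> nat \<Rightarrow> ('v::finite, 'k::field) mpoly set" where
  "esym_ideal F j = extension esym_seq j UNIV (off_ideal F)"

lemma esym_ideal_ideal_set: "ideal_set (esym_ideal F j)"
  unfolding esym_ideal_def by (rule extension_ideal_set[OF ideal_set_UNIV off_ideal_ideal_set])

lemma esym_ideal_Suc: "esym_ideal F (Suc j) = {a + esym_seq j * y | a y. a \<in> esym_ideal F j}"
  by (simp add: esym_ideal_def extension_Suc)

lemma off_ideal_subset: "off_ideal F \<subseteq> esym_ideal F j"
  unfolding esym_ideal_def by (rule extension_base_subset) simp

text \<open>The generators are homogeneous, so taking a component acts on each coefficient with a
  shift of degree; the new coefficient is 0 when \<open>d\<close> is below the degree of the
  generator.\<close>

lemma hom_part_esym_ideal: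
  assumes "p \<in> esym_ideal F j"
  shows "hom_part d p \<in> esym_ideal F j"
proof -
  obtain n y where p: "p = n + (\<Sum>i<j. esym_seq i * y i)" "n \<in> off_ideal F"
    using assms unfolding esym_ideal_def by (rule extensionE) blast
  have "hom_part d n \<in> off_ideal F"
    using p(2) by (simp add: off_ideal_iff hom_part_def keys_restrict_keys)
  moreover have "hom_part d (esym_seq i * y i) =
      esym_seq i * (if Suc i \<le> d then hom_part (d - Suc i) (y i) else 0)" for i
    using hom_part_mult[of "esym_seq i" "Suc i" "d - Suc i" "y i", OF elem_sym_homogeneous]
      hom_part_mult_less[of "esym_seq i" "Suc i" d "y i", OF elem_sym_homogeneous]
    by (cases "Suc i \<le> d") simp_all
  ultimately show ?thesis
    unfolding p(1) hom_part_add hom_part_sum esym_ideal_def by (simp only:) (intro extensionI, auto)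
qed

lemma Var_eq_exp_monom: "Var i = exp_monom (indic {i})"
proof -
  have "Abs_poly_mapping (indic {i}) = Poly_Mapping.single i (1::nat)"
    by (rule poly_mapping_eqI) (auto simp: indic_def lookup_single when_def)
  then show ?thesis by (simp add: Var_def exp_monom_def)
qed

lemma var_mult_off_ideal: "i \<in> F \<Longrightarrow> Var i * y \<in> off_ideal F \<Longrightarrow> y \<in> off_ideal F"
  by (auto simp: off_ideal_iff Var_eq_exp_monom keys_monom_mult lookup_add indic_def split: if_splits)

lemma off_ideal_Diff_iff:
  "(y :: ('v::finite, 'k::field) mpoly) \<in> off_ideal (F - {i}) \<longleftrightarrow> (\<exists>a q. a \<in> off_ideal F \<and> y = a + Var i * q)"
proof
  assume y: "y \<in> off_ideal (F - {i})"
  define A where "A = {u :: 'v \<Rightarrow>\<^sub>0 nat. Poly_Mapping.lookup u i \<noteq> 0}"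
  have "\<exists>q. restrict_keys A y = Var i * q"
    unfolding Var_eq_exp_monom by (rule monom_factor) (auto simp: keys_restrict_keys A_def indic_def le_fun_def)
  then obtain q where "restrict_keys A y = Var i * q" by blast
  then have "y = restrict_keys (- A) y + Var i * q"
    using restrict_keys_Compl[of y A] by (simp add: add.commute)
  moreover have "restrict_keys (- A) y \<in> off_ideal F"
    unfolding off_ideal_iff
  proof
    fix u assume "u \<in> Poly_Mapping.keys (restrict_keys (- A) y)"
    then have "u \<in> Poly_Mapping.keys y" "Poly_Mapping.lookup u i = 0" by (auto simp: keys_restrict_keys A_def)
    then show "\<exists>i. i \<notin> F \<and> Poly_Mapping.lookup u i \<noteq> 0" using y unfolding off_ideal_iff by force
  qed
  ultimately show "\<exists>a q. a \<in> off_ideal F \<and> y = a + Var i * q" by blast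
next
  assume "\<exists>a q. a \<in> off_ideal F \<and> y = a + Var i * q"
  then obtain a q where y: "a \<in> off_ideal F" "y = a + Var i * q" by blast
  have "a \<in> off_ideal (F - {i})" using y(1) by (force simp: off_ideal_iff)
  moreover have "Var i * q \<in> off_ideal (F - {i})"
    by (auto simp: off_ideal_iff Var_eq_exp_monom keys_monom_mult lookup_add indic_def intro!: exI[of _ i])
  ultimately show "y \<in> off_ideal (F - {i})"
    unfolding y(2) by (rule ideal_set_add[OF off_ideal_ideal_set])
qed

text \<open>Lets reduction modulo \<open>Var i\<close> be read as passing to the smaller set
  \<open>F - {i}\<close>, where the induction hypothesis applies.\<close>

lemma esym_ideal_Diff_iff:
  "y \<in> esym_ideal (F - {i}) j \<longleftrightarrow> (\<exists>a q. a \<in> esym_ideal F j \<and> y = a + Var i * q)"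
proof
  assume "y \<in> esym_ideal (F - {i}) j"
  then obtain n w where w: "y = n + (\<Sum>i<j. esym_seq i * w i)" "n \<in> off_ideal (F - {i})"
    unfolding esym_ideal_def by (rule extensionE) blast
  then obtain a q where aq: "a \<in> off_ideal F" "n = a + Var i * q" using off_ideal_Diff_iff by blast
  have "a + (\<Sum>i<j. esym_seq i * w i) \<in> esym_ideal F j"
    unfolding esym_ideal_def using aq(1) by (intro extensionI) auto
  moreover have "y = (a + (\<Sum>i<j. esym_seq i * w i)) + Var i * q"
    unfolding w(1) aq(2) by (simp add: algebra_simps)
  ultimately show "\<exists>a q. a \<in> esym_ideal F j \<and> y = a + Var i * q" by blast
next
  assume "\<exists>a q. a \<in> esym_ideal F j \<and> y = a + Var i * q"
  then obtain a q where y: "a \<in> esym_ideal F j" "y = a + Var i * q" by blast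
  have "off_ideal F \<subseteq> off_ideal (F - {i})" by (force simp: off_ideal_iff)
  then have "a \<in> esym_ideal (F - {i}) j"
    using y(1) extension_mono[of UNIV UNIV "off_ideal F" "off_ideal (F - {i})" esym_seq j]
    unfolding esym_ideal_def by blast
  moreover have "0 + Var i * q \<in> off_ideal (F - {i})"
    using off_ideal_Diff_iff ideal_set_zero[OF off_ideal_ideal_set] by blast
  then have "Var i * q \<in> esym_ideal (F - {i}) j" using off_ideal_subset by auto
  ultimately show "y \<in> esym_ideal (F - {i}) j"
    unfolding y(2) by (rule ideal_set_add[OF esym_ideal_ideal_set])
qed

text \<open>Modulo the variables outside \<open>F\<close>, the product over a set of size
  \<open>card F\<close> survives only if that set is \<open>F\<close> itself.\<close>

lemma esym_top:
  assumes F: "card F = Suc j"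
  shows "(esym_seq j - exp_monom (indic F) :: ('v::finite, 'k::field) mpoly) \<in> off_ideal F"
proof -
  have "(esym_seq j :: ('v, 'k) mpoly) = exp_monom (indic F) + (\<Sum>A\<in>{A. card A = Suc j} - {F}. exp_monom (indic A))"
    unfolding elem_sym_def using F by (intro sum.remove) auto
  then have "(esym_seq j - exp_monom (indic F) :: ('v, 'k) mpoly) = (\<Sum>A\<in>{A. card A = Suc j} - {F}. exp_monom (indic A))"
    by simp
  also have "\<dots> \<in> off_ideal F"
  proof (rule ideal_set_sum[OF off_ideal_ideal_set])
    fix A assume A: "A \<in> {A. card A = Suc j} - {F}"
    then have "\<not> A \<subseteq> F" using F card_subset_eq[of F A] by auto
    then obtain i where "i \<in> A" "i \<notin> F" by blast
    then show "exp_monom (indic A) \<in> off_ideal F"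
      by (auto simp: off_ideal_iff keys_monom indic_def intro!: exI[of _ i])
  qed
  finally show ?thesis .
qed

lemma monom_indic_insert: "i \<notin> A \<Longrightarrow> exp_monom (indic (insert i A)) = Var i * exp_monom (indic A)"
  unfolding Var_eq_exp_monom monom_mult by (rule arg_cong[of _ _ exp_monom]) (auto simp: indic_def)

lemma monom_indic_cancel:
  fixes y :: "('v::finite, 'k::field) mpoly"
  assumes "\<And>i y. i \<in> A \<Longrightarrow> Var i * y \<in> J \<Longrightarrow> y \<in> J"
  shows "exp_monom (indic A) * y \<in> J \<Longrightarrow> y \<in> J"
proof -
  have "finite A" by simp
  then show "exp_monom (indic A) * y \<in> J \<Longrightarrow> y \<in> J"
    using assms
  proof (induction A arbitrary: y)
    case empty
    have "Abs_poly_mapping (indic {}) = (0 :: 'v \<Rightarrow>\<^sub>0 nat)"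
      by (rule poly_mapping_eqI) (simp add: indic_def)
    then have "exp_monom (indic {}) * y = y" by (simp add: exp_monom_def)
    then show ?case using empty by simp
  next
    case (insert i A)
    have "Var i * (exp_monom (indic A) * y) \<in> J"
      unfolding mult.assoc[symmetric] monom_indic_insert[OF insert.hyps(2), symmetric]
      by (rule insert.prems(1))
    then have "exp_monom (indic A) * y \<in> J" by (rule insert.prems(2)[rotated]) simp
    then show ?case by (rule insert.IH) (rule insert.prems(2), simp_all)
  qed
qed

text \<open>Permutes the variable past the symmetric polynomials. In
  \<open>Var i * y = a + esym_seq j * z\<close>, reduction modulo \<open>Var i\<close> and
  regularity for \<open>F - {i}\<close> put \<open>z\<close> into the ideal up to a multiple
  \<open>Var i * z'\<close>; then \<open>y - esym_seq j * z'\<close> satisfies a relation with one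
  symmetric polynomial less. The bound \<open>Suc j < card F\<close> keeps \<open>j\<close> below
  the size of \<open>F - {i}\<close>.\<close>

lemma var_nonzerodivisor:
  assumes IH: "\<And>i j y. i \<in> F \<Longrightarrow> Suc j < card F \<Longrightarrow> esym_seq j * y \<in> esym_ideal (F - {i}) j \<Longrightarrow>
      (y :: ('v::finite, 'k::field) mpoly) \<in> esym_ideal (F - {i}) j"
    and i: "i \<in> F"
  shows "j < card F \<Longrightarrow> Var i * (y :: ('v, 'k) mpoly) \<in> esym_ideal F j \<Longrightarrow> y \<in> esym_ideal F j"
proof (induction j arbitrary: y)
  case 0
  then show ?case using var_mult_off_ideal[OF i] by (simp add: esym_ideal_def extension_0)
next
  case (Suc j)
  obtain a z where az: "Var i * y = a + esym_seq j * z" "a \<in> esym_ideal F j"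
    using Suc.prems(2) unfolding esym_ideal_Suc by blast
  have "esym_seq j * z = - a + Var i * y" using az(1) by simp
  moreover have "- a \<in> esym_ideal F j"
    using ideal_set_mult[OF esym_ideal_ideal_set az(2), of "- 1"] by simp
  ultimately have "esym_seq j * z \<in> esym_ideal (F - {i}) j" unfolding esym_ideal_Diff_iff by blast
  then have "z \<in> esym_ideal (F - {i}) j" using IH i Suc.prems(1) by blast
  then obtain a' z' where z': "a' \<in> esym_ideal F j" "z = a' + Var i * z'"
    unfolding esym_ideal_Diff_iff by blast
  have "Var i * (y - esym_seq j * z') = a + esym_seq j * a'"
    using az(1) by (simp add: z'(2) algebra_simps)
  also have "\<dots> \<in> esym_ideal F j"
    by (rule ideal_set_add[OF esym_ideal_ideal_set az(2) ideal_set_mult[OF esym_ideal_ideal_set z'(1)]])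
  finally have "y - esym_seq j * z' \<in> esym_ideal F j" using Suc.IH Suc.prems(1) by simp
  moreover have "y = (y - esym_seq j * z') + esym_seq j * z'" by simp
  ultimately show ?case unfolding esym_ideal_Suc by blast
qed

text \<open>Descent on the degree in place of Nakayama: a homogeneous \<open>y\<close> killed by
  \<open>esym_seq j\<close> has the form \<open>a + Var i * q\<close> with \<open>q\<close> one
  degree lower, and \<open>q\<close> is killed as well because \<open>Var i\<close> is a
  nonzerodivisor. In degree 0 the term \<open>Var i * q\<close> vanishes.\<close>

lemma esym_nonzerodivisor_below_top:
  assumes IH: "\<And>y. esym_seq j * y \<in> esym_ideal (F - {i}) j \<Longrightarrow>
      (y :: ('v::finite, 'k::field) mpoly) \<in> esym_ideal (F - {i}) j"
    and var: "\<And>y. Var i * (y :: ('v, 'k) mpoly) \<in> esym_ideal F j \<Longrightarrow> y \<in> esym_ideal F j"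
    and y: "esym_seq j * (y :: ('v, 'k) mpoly) \<in> esym_ideal F j"
  shows "y \<in> esym_ideal F j"
proof -
  have var_deg: "total_deg u = 1" if "u \<in> Poly_Mapping.keys (Var i :: ('v, 'k) mpoly)" for u
    using that by (simp add: Var_eq_exp_monom keys_monom deg_indic)
  have hom: "hom_part d y \<in> esym_ideal F j"
    if "esym_seq j * hom_part d y \<in> esym_ideal F j" for d and y :: "('v, 'k) mpoly"
    using that
  proof (induction d arbitrary: y)
    case (0 y)
    have "esym_seq j * hom_part 0 y \<in> esym_ideal (F - {i}) j"
      unfolding esym_ideal_Diff_iff using 0 by (intro exI[of _ "esym_seq j * hom_part 0 y"] exI[of _ 0]) simp
    then obtain a q where aq: "a \<in> esym_ideal F j" "hom_part 0 y = a + Var i * q"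
      using IH unfolding esym_ideal_Diff_iff by blast
    have "hom_part 0 y = hom_part 0 (hom_part 0 y)"
      by (simp add: hom_part_def restrict_keys_id keys_restrict_keys)
    also have "\<dots> = hom_part 0 a"
      unfolding aq(2) hom_part_add using hom_part_mult_less[of "Var i" 1 0 q, OF var_deg] by simp
    finally show ?case using hom_part_esym_ideal[OF aq(1)] by simp
  next
    case (Suc d y)
    have "esym_seq j * hom_part (Suc d) y \<in> esym_ideal (F - {i}) j"
      unfolding esym_ideal_Diff_iff using Suc.prems
      by (intro exI[of _ "esym_seq j * hom_part (Suc d) y"] exI[of _ 0]) simp
    then obtain a q where aq: "a \<in> esym_ideal F j" "hom_part (Suc d) y = a + Var i * q"
      using IH unfolding esym_ideal_Diff_iff by blast
    have "hom_part (Suc d) y = hom_part (Suc d) (hom_part (Suc d) y)"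
      by (simp add: hom_part_def restrict_keys_id keys_restrict_keys)
    also have "\<dots> = hom_part (Suc d) a + Var i * hom_part d q"
      unfolding aq(2) hom_part_add using hom_part_mult[of "Var i" 1 d q, OF var_deg] by simp
    finally have y_eq: "hom_part (Suc d) y = hom_part (Suc d) a + Var i * hom_part d q" .
    have a': "hom_part (Suc d) a \<in> esym_ideal F j" by (rule hom_part_esym_ideal[OF aq(1)])
    have "Var i * (esym_seq j * hom_part d q) =
        esym_seq j * hom_part (Suc d) y - esym_seq j * hom_part (Suc d) a"
      unfolding y_eq by (simp add: algebra_simps)
    also have "\<dots> \<in> esym_ideal F j"
      using Suc.prems a' by (intro ideal_set_diff[OF esym_ideal_ideal_set] ideal_set_mult[OF esym_ideal_ideal_set a'])
    finally have "esym_seq j * hom_part d q \<in> esym_ideal F j" by (rule var)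
    then have "hom_part d q \<in> esym_ideal F j" by (rule Suc.IH)
    then show ?case
      unfolding y_eq by (intro ideal_set_add[OF esym_ideal_ideal_set a'] ideal_set_mult[OF esym_ideal_ideal_set])
  qed
  obtain m where m: "y = (\<Sum>d<m. hom_part d y)" using sum_hom_part by blast
  \<comment> \<open>The ideal is homogeneous, so the relation for \<open>y\<close> holds for each of
    its components.\<close>
  have "hom_part d y \<in> esym_ideal F j" for d
  proof (rule hom)
    have "hom_part (Suc j + d) (esym_seq j * y) = esym_seq j * hom_part d y"
      by (rule hom_part_mult[OF elem_sym_homogeneous])
    then show "esym_seq j * hom_part d y \<in> esym_ideal F j" using hom_part_esym_ideal[OF y] by metis
  qed
  then have "(\<Sum>d<m. hom_part d y) \<in> esym_ideal F j" by (intro ideal_set_sum[OF esym_ideal_ideal_set])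
  then show ?thesis using m by simp
qed

text \<open>While \<open>Suc j < card F\<close>, a variable of \<open>F\<close> can be set to 0 and
  the descent applies. At \<open>Suc j = card F\<close> the polynomial is, modulo the ideal, the
  product of the variables in \<open>F\<close>, and each of these is a nonzerodivisor.\<close>

lemma esym_nonzerodivisor:
  "j < card F \<Longrightarrow> esym_seq j * (y :: ('v::finite, 'k::field) mpoly) \<in> esym_ideal F j \<Longrightarrow> y \<in> esym_ideal F j"
proof (induction "card F" arbitrary: F j y)
  case (Suc n)
  have IH: "y \<in> esym_ideal (F - {i}) l"
    if "i \<in> F" "Suc l < card F" "esym_seq l * y \<in> esym_ideal (F - {i}) l" for i l and y :: "('v, 'k) mpoly"
  proof (rule Suc.hyps(1)[OF _ _ that(3)])
    show "n = card (F - {i})" "l < card (F - {i})" using that(1,2) Suc.hyps(2) by auto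
  qed
  have var: "y \<in> esym_ideal F j" if "i \<in> F" "Var i * y \<in> esym_ideal F j" for i and y :: "('v, 'k) mpoly"
    by (rule var_nonzerodivisor[OF IH that(1) Suc.prems(1) that(2)])
  show ?case
  proof (cases "Suc j < card F")
    case True
    then obtain i where "i \<in> F" by (metis card.empty equals0I not_less_zero)
    show ?thesis
      by (rule esym_nonzerodivisor_below_top[OF IH[OF \<open>i \<in> F\<close> True] var[OF \<open>i \<in> F\<close>] Suc.prems(2)])
  next
    case False
    then have "card F = Suc j" using Suc.prems(1) by simp
    have "exp_monom (indic F) * y = esym_seq j * y - y * (esym_seq j - exp_monom (indic F))"
      by (simp add: algebra_simps)
    also have "\<dots> \<in> esym_ideal F j"
    proof (rule ideal_set_diff[OF esym_ideal_ideal_set Suc.prems(2)], rule ideal_set_mult[OF esym_ideal_ideal_set])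
      show "esym_seq j - exp_monom (indic F) \<in> esym_ideal F j"
        using esym_top[OF \<open>card F = Suc j\<close>] off_ideal_subset by blast
    qed
    finally show ?thesis using monom_indic_cancel[of F "esym_ideal F j" y] var by blast
  qed
qed simp

lemma esym_regular_off_ideal:
  "regular_on (esym_seq :: nat \<Rightarrow> ('v::finite, 'k::field) mpoly) (card F) UNIV
    (avoiding (coord_cone (\<lambda>_. 0) F))"
  unfolding regular_on_def
  using esym_nonzerodivisor[where F = F, unfolded esym_ideal_def off_ideal_def] by blast

section \<open>Symbolic powers and depth in terms of monomials\<close>

lemma type_algebra_simps [simp]:
  "carrier (ring_of_type_algebra :: 'a::comm_ring_1 ring) = UNIV"
  "x \<otimes>\<^bsub>ring_of_type_algebra\<^esub> y = x * (y :: 'a)"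
  "x \<oplus>\<^bsub>ring_of_type_algebra\<^esub> y = x + (y :: 'a)"
  "\<zero>\<^bsub>ring_of_type_algebra\<^esub> = (0 :: 'a)"
  "\<one>\<^bsub>ring_of_type_algebra\<^esub> = (1 :: 'a)"
  by (simp_all add: ring_of_type_algebra_def)

lemma type_algebra_a_inv: "\<ominus>\<^bsub>ring_of_type_algebra\<^esub> x = - (x :: 'a::comm_ring_1)"
proof -
  interpret cring "ring_of_type_algebra :: 'a ring" by (rule cring_from_type_algebra)
  show ?thesis using minus_equality[of "- x" x] by simp
qed

lemma type_algebra_ideal_iff:
  "ideal I (ring_of_type_algebra :: 'a::comm_ring_1 ring) \<longleftrightarrow> ideal_set I"
proof
  assume "ideal I (ring_of_type_algebra :: 'a ring)"
  then show "ideal_set I"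
    unfolding ideal_set_def
    using additive_subgroup.zero_closed[OF ideal.axioms(1)] additive_subgroup.a_closed[OF ideal.axioms(1)]
      ideal.I_l_closed by fastforce
next
  assume I: "ideal_set I"
  show "ideal I (ring_of_type_algebra :: 'a ring)"
  proof (rule idealI)
    show "ring (ring_of_type_algebra :: 'a ring)" by (rule ring_from_type_algebra)
    show "subgroup I (add_monoid (ring_of_type_algebra :: 'a ring))"
    proof (rule subgroup.intro)
      show "inv\<^bsub>add_monoid ring_of_type_algebra\<^esub> x \<in> I" if "x \<in> I" for x :: 'a
        using ideal_set_mult[OF I that, of "- 1"] type_algebra_a_inv[of x] by (simp add: a_inv_def)
    qed (use ideal_set_zero[OF I] ideal_set_add[OF I] in auto)
    show "x \<otimes>\<^bsub>ring_of_type_algebra\<^esub> a \<in> I" "a \<otimes>\<^bsub>ring_of_type_algebra\<^esub> x \<in> I" if "a \<in> I" for a x :: 'a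
      using ideal_set_mult[OF I that, of x] by (simp_all add: mult.commute)
  qed
qed

lemma type_algebra_Idl_mem: "a \<in> A \<Longrightarrow> a \<in> Idl\<^bsub>ring_of_type_algebra\<^esub> (A :: 'a::comm_ring_1 set)"
  using ring.genideal_self[OF ring_from_type_algebra, of A] by auto

lemma type_algebra_Idl_subset:
  "ideal_set I \<Longrightarrow> A \<subseteq> I \<Longrightarrow> Idl\<^bsub>ring_of_type_algebra\<^esub> (A :: 'a::comm_ring_1 set) \<subseteq> I"
  using ring.genideal_minimal[OF ring_from_type_algebra, of I A] by (simp add: type_algebra_ideal_iff)

lemma type_algebra_Idl_ideal_set: "ideal_set (Idl\<^bsub>ring_of_type_algebra\<^esub> (A :: 'a::comm_ring_1 set))"
  using ring.genideal_ideal[OF ring_from_type_algebra, of A] by (simp add: type_algebra_ideal_iff)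

lemma Idl_eq_extension:
  assumes I: "ideal_set (I :: 'a::comm_ring_1 set)"
  shows "Idl\<^bsub>ring_of_type_algebra\<^esub> (I \<union> g ` {..<j}) = extension g j UNIV I"
proof (rule subset_antisym)
  have "g i \<in> extension g j UNIV I" if "i < j" for i
  proof -
    have "0 + (\<Sum>l<j. g l * (if l = i then 1 else 0)) \<in> extension g j UNIV I"
      using ideal_set_zero[OF I] by (intro extensionI) auto
    then show ?thesis using that by (simp add: if_distrib cong: if_cong)
  qed
  then show "Idl\<^bsub>ring_of_type_algebra\<^esub> (I \<union> g ` {..<j}) \<subseteq> extension g j UNIV I"
    using extension_base_subset[of UNIV I g j]
    by (intro type_algebra_Idl_subset extension_ideal_set[OF ideal_set_UNIV I]) auto
next
  let ?J = "Idl\<^bsub>ring_of_type_algebra\<^esub> (I \<union> g ` {..<j})"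
  have J: "ideal_set ?J" by (rule type_algebra_Idl_ideal_set)
  show "extension g j UNIV I \<subseteq> ?J"
  proof
    fix x assume "x \<in> extension g j UNIV I"
    then obtain n y where x: "x = n + (\<Sum>i<j. g i * y i)" "n \<in> I" by (rule extensionE) blast
    have "y i * g i \<in> ?J" if "i < j" for i
      using that by (intro ideal_set_mult[OF J] type_algebra_Idl_mem) auto
    then have "(\<Sum>i<j. g i * y i) \<in> ?J"
      by (intro ideal_set_sum[OF J]) (simp add: mult.commute)
    moreover have "n \<in> ?J" using x(2) by (intro type_algebra_Idl_mem) auto
    ultimately show "x \<in> ?J" unfolding x(1) by (intro ideal_set_add[OF J])
  qed
qed

lemma rcos_eq_zero_iff:
  assumes "ideal_set J"
  shows "J +>\<^bsub>ring_of_type_algebra\<^esub> x = J \<longleftrightarrow> (x :: 'a::comm_ring_1) \<in> J"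
proof -
  have "ideal J (ring_of_type_algebra :: 'a ring)" using assms by (simp add: type_algebra_ideal_iff)
  then show ?thesis
    using ideal.rcos_const_imp_mem[of J ring_of_type_algebra x]
      ring.a_rcos_zero[OF ring_from_type_algebra, of J x] by auto
qed

lemma Quot_simps:
  assumes "ideal_set (J :: 'a::comm_ring_1 set)"
  defines "R \<equiv> ring_of_type_algebra"
  shows "carrier (R Quot J) = range (\<lambda>x. J +>\<^bsub>R\<^esub> x)" "\<zero>\<^bsub>R Quot J\<^esub> = J" "\<one>\<^bsub>R Quot J\<^esub> = J +>\<^bsub>R\<^esub> 1"
    "(J +>\<^bsub>R\<^esub> x) \<otimes>\<^bsub>R Quot J\<^esub> (J +>\<^bsub>R\<^esub> y) = J +>\<^bsub>R\<^esub> (x * y)"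
  using ideal.rcoset_mult_add[of J R x y] assms
  by (auto simp: FactRing_def A_RCOSETS_def' type_algebra_ideal_iff)

lemma nonzerodivisor_Quot:
  assumes J: "ideal_set (J :: 'a::comm_ring_1 set)" and a: "\<And>x. a * x \<in> J \<Longrightarrow> x \<in> J"
  shows "nonzerodivisor (ring_of_type_algebra Quot J) (J +>\<^bsub>ring_of_type_algebra\<^esub> a)"
  unfolding nonzerodivisor_def
  using a by (auto simp: Quot_simps[OF J] rcos_eq_zero_iff[OF J])

text \<open>The proper ideal \<open>N\<close> certifies that the quotient by the whole sequence is
  nonzero, which weak regularity does not give.\<close>

lemma regular_sequence_quot_if_regular_on:
  assumes I: "ideal_set (I :: 'a::comm_ring_1 set)" and reg: "regular_on g k UNIV I"
    and m: "\<And>i. g i \<in> m" and N: "ideal_set N" "I \<subseteq> N" "\<And>i. g i \<in> N" "1 \<notin> N"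
  shows "regular_sequence_quot ring_of_type_algebra m I (map g [0..<k])"
  unfolding regular_sequence_quot_def
proof (intro conjI allI impI)
  show "set (map g [0..<k]) \<subseteq> m" using m by auto
  fix i assume i: "i < length (map g [0..<k])"
  have set: "set (take i (map g [0..<k])) = g ` {..<i}"
    using i by (simp add: take_map atLeast0LessThan)
  have "nonzerodivisor (ring_of_type_algebra Quot extension g i UNIV I)
      (extension g i UNIV I +>\<^bsub>ring_of_type_algebra\<^esub> g i)"
  proof (rule nonzerodivisor_Quot[OF extension_ideal_set[OF ideal_set_UNIV I]])
    fix x assume gx: "g i * x \<in> extension g i UNIV I"
    have "i < k" using i by simp
    then show "x \<in> extension g i UNIV I" by (rule regular_onD[OF reg _ UNIV_I gx])
  qed
  then show "let J = Idl\<^bsub>ring_of_type_algebra\<^esub> (I \<union> set (take i (map g [0..<k]))) in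
      nonzerodivisor (ring_of_type_algebra Quot J) (J +>\<^bsub>ring_of_type_algebra\<^esub> (map g [0..<k] ! i))"
    using i by (simp add: Let_def set Idl_eq_extension[OF I])
next
  have "Idl\<^bsub>ring_of_type_algebra\<^esub> (I \<union> set (map g [0..<k])) \<subseteq> N"
    using N by (intro type_algebra_Idl_subset) auto
  then show "Idl\<^bsub>ring_of_type_algebra\<^esub> (I \<union> set (map g [0..<k])) \<noteq> carrier ring_of_type_algebra"
    using N(4) by auto
qed

lemma (in cring) localization_annihilated:
  assumes "t0 \<otimes> f = \<zero>" "t0 \<in> carrier R" "t \<in> carrier R" "v \<in> carrier R" "f \<in> carrier R" "b \<in> carrier R"
  shows "(t0 \<otimes> t) \<otimes> (v \<otimes> f \<ominus> \<one> \<otimes> b) = (t0 \<otimes> t) \<otimes> (v \<otimes> \<zero> \<ominus> \<one> \<otimes> b)"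
proof -
  have "(t0 \<otimes> t) \<otimes> (v \<otimes> f) = (t \<otimes> v) \<otimes> (t0 \<otimes> f)" using assms(2-) by (simp add: m_ac)
  also have "\<dots> = (t0 \<otimes> t) \<otimes> (v \<otimes> \<zero>)" using assms by simp
  finally have "(t0 \<otimes> t) \<otimes> (v \<otimes> f) = (t0 \<otimes> t) \<otimes> (v \<otimes> \<zero>)" .
  then show ?thesis using assms(2-) by (simp add: a_minus_def r_distr)
qed

text \<open>Fractions are compared as sets of pairs. The pair of zero and one lies in the class of
  zero, and its membership in the class of \<open>f\<close> yields an annihilator. Conversely, an
  annihilator \<open>t0\<close> of \<open>f\<close> multiplies every witness for one class into a
  witness for the other.\<close>

lemma (in cring) to_localization_eq_zero_iff:
  assumes W: "W \<subseteq> carrier R" "\<one> \<in> W" "\<And>x y. x \<in> W \<Longrightarrow> y \<in> W \<Longrightarrow> x \<otimes> y \<in> W"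
    and f: "f \<in> carrier R"
  shows "to_localization R W f = to_localization R W \<zero> \<longleftrightarrow> (\<exists>t\<in>W. t \<otimes> f = \<zero>)"
proof
  assume eq: "to_localization R W f = to_localization R W \<zero>"
  have "(\<zero>, \<one>) \<in> to_localization R W \<zero>"
    using W(1,2) by (auto simp: to_localization_def frac_rel_def intro!: bexI[of _ \<one>])
  then have "(\<zero>, \<one>) \<in> to_localization R W f" using eq by simp
  then obtain t where "t \<in> W" "t \<otimes> (\<one> \<otimes> f \<ominus> \<one> \<otimes> \<zero>) = \<zero>"
    by (auto simp: to_localization_def frac_rel_def)
  then show "\<exists>t\<in>W. t \<otimes> f = \<zero>" using f W(1) by (auto simp: a_minus_def)
next
  assume "\<exists>t\<in>W. t \<otimes> f = \<zero>"
  then obtain t0 where t0: "t0 \<in> W" "t0 \<otimes> f = \<zero>" by blast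
  have mem: "(b, v) \<in> to_localization R W a \<longleftrightarrow> a \<in> carrier R \<and> b \<in> carrier R \<and> v \<in> W \<and>
      (\<exists>t\<in>W. t \<otimes> (v \<otimes> a \<ominus> \<one> \<otimes> b) = \<zero>)" for a b v
    using W(2) by (auto simp: to_localization_def frac_rel_def)
  have swap: "\<exists>t\<in>W. t \<otimes> (v \<otimes> a' \<ominus> \<one> \<otimes> b) = \<zero>"
    if ex: "\<exists>t\<in>W. t \<otimes> (v \<otimes> a \<ominus> \<one> \<otimes> b) = \<zero>" and that: "(a, a') = (f, \<zero>) \<or> (a, a') = (\<zero>, f)"
      "b \<in> carrier R" "v \<in> W" for a a' b v
  proof -
    obtain t where t: "t \<in> W" "t \<otimes> (v \<otimes> a \<ominus> \<one> \<otimes> b) = \<zero>" using ex by blast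
    have carr: "t \<in> carrier R" "t0 \<in> carrier R" "v \<in> carrier R" "a \<in> carrier R"
      using t(1) t0(1) that W(1) f by auto
    have "(t0 \<otimes> t) \<otimes> (v \<otimes> a' \<ominus> \<one> \<otimes> b) = (t0 \<otimes> t) \<otimes> (v \<otimes> a \<ominus> \<one> \<otimes> b)"
      using localization_annihilated[OF t0(2) carr(2,1,3) f that(2)] that(1) by auto
    also have "\<dots> = t0 \<otimes> (t \<otimes> (v \<otimes> a \<ominus> \<one> \<otimes> b))" using carr that(2) by (intro m_assoc) auto
    also have "\<dots> = \<zero>" using t(2) carr by simp
    finally show ?thesis using W(3)[OF t0(1) t(1)] by blast
  qed
  have "(b, v) \<in> to_localization R W f \<longleftrightarrow> (b, v) \<in> to_localization R W \<zero>" for b v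
    unfolding mem using swap[of v f b \<zero>] swap[of v \<zero> b f] f by blast
  then show "to_localization R W f = to_localization R W \<zero>" by auto
qed

lemma localization_kernel_iff:
  assumes J: "ideal_set (J :: 'a::comm_ring_1 set)" and P: "primeideal P ring_of_type_algebra"
  shows "f \<in> localization_kernel ring_of_type_algebra J P \<longleftrightarrow> (\<exists>u. u \<notin> P \<and> u * f \<in> J)"
proof -
  define R where "R = (ring_of_type_algebra :: 'a ring)"
  interpret P: primeideal P R unfolding R_def by (rule P)
  have ideal: "ideal J R" using J by (simp add: R_def type_algebra_ideal_iff)
  then interpret Q: cring "R Quot J"
    unfolding R_def by (rule ideal.quotient_is_cring) (rule cring_from_type_algebra)
  define W where "W = (\<lambda>u. J +>\<^bsub>R\<^esub> u) ` (carrier R - P)"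
  note quot = Quot_simps[OF J, folded R_def] and zero = rcos_eq_zero_iff[OF J, folded R_def]
  have "1 \<notin> P" using P.one_imp_carrier P.I_notcarr by (auto simp: R_def)
  have mult: "x * y \<notin> P" if "x \<notin> P" "y \<notin> P" for x y
    using P.I_prime[of x y] that by (auto simp: R_def)
  have "to_localization (R Quot J) W (J +>\<^bsub>R\<^esub> f) = to_localization (R Quot J) W \<zero>\<^bsub>R Quot J\<^esub> \<longleftrightarrow>
      (\<exists>t\<in>W. t \<otimes>\<^bsub>R Quot J\<^esub> (J +>\<^bsub>R\<^esub> f) = \<zero>\<^bsub>R Quot J\<^esub>)"
  proof (rule Q.to_localization_eq_zero_iff)
    show "W \<subseteq> carrier (R Quot J)" "J +>\<^bsub>R\<^esub> f \<in> carrier (R Quot J)" by (auto simp: W_def quot)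
    show "\<one>\<^bsub>R Quot J\<^esub> \<in> W"
      unfolding W_def quot(3) using \<open>1 \<notin> P\<close> by (intro imageI) (simp add: R_def)
    show "x \<otimes>\<^bsub>R Quot J\<^esub> y \<in> W" if "x \<in> W" "y \<in> W" for x y
      using that mult by (auto simp: W_def quot) (auto simp: R_def)
  qed
  also have "\<dots> \<longleftrightarrow> (\<exists>u. u \<notin> P \<and> u * f \<in> J)"
  proof -
    have "carrier R = UNIV" by (simp add: R_def)
    then show ?thesis by (auto simp: W_def quot zero)
  qed
  finally show ?thesis
    unfolding localization_kernel_def R_def[symmetric] W_def[symmetric] Let_def
    by (simp add: R_def)
qed

section \<open>Primary powers of the primes generated by variables\<close>

lemma unique_leading_sum:
  assumes "finite A" "A \<noteq> {}" "finite B" "B \<noteq> {}"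
  shows "\<exists>a\<in>A. \<exists>b\<in>B. \<forall>v\<in>A. \<forall>w\<in>B. v + w = a + b \<longrightarrow> v = a \<and> (w :: 'v::finite \<Rightarrow>\<^sub>0 nat) = b"
proof -
  \<comment> \<open>Keeping the members with the largest coordinate, one coordinate after another,
    selects lexicographically leading exponents: a sum of two maxima is attained only by
    maxima.\<close>
  have "\<exists>A'\<subseteq>A. \<exists>B'\<subseteq>B. A' \<noteq> {} \<and> B' \<noteq> {} \<and>
      (\<forall>i\<in>I. \<forall>v\<in>A'. \<forall>w\<in>A'. Poly_Mapping.lookup v i = Poly_Mapping.lookup w i) \<and>
      (\<forall>i\<in>I. \<forall>v\<in>B'. \<forall>w\<in>B'. Poly_Mapping.lookup v i = Poly_Mapping.lookup w i) \<and>
      (\<forall>a\<in>A'. \<forall>b\<in>B'. \<forall>v\<in>A. \<forall>w\<in>B. v + w = a + b \<longrightarrow> v \<in> A' \<and> w \<in> B')" for I :: "'v set"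
  proof (induction I rule: infinite_finite_induct)
    case empty
    show ?case by (rule exI[of _ A], intro conjI, simp, rule exI[of _ B]) (use assms in simp)
  next
    case (insert i I)
    then obtain A' B' where AB: "A' \<subseteq> A" "B' \<subseteq> B" "A' \<noteq> {}" "B' \<noteq> {}"
      "\<forall>i\<in>I. \<forall>v\<in>A'. \<forall>w\<in>A'. Poly_Mapping.lookup v i = Poly_Mapping.lookup w i"
      "\<forall>i\<in>I. \<forall>v\<in>B'. \<forall>w\<in>B'. Poly_Mapping.lookup v i = Poly_Mapping.lookup w i"
      "\<forall>a\<in>A'. \<forall>b\<in>B'. \<forall>v\<in>A. \<forall>w\<in>B. v + w = a + b \<longrightarrow> v \<in> A' \<and> w \<in> B'"
      by blast
    define top where "top K = {v\<in>K. \<forall>w\<in>K. Poly_Mapping.lookup w i \<le> Poly_Mapping.lookup v i}" for K :: "('v \<Rightarrow>\<^sub>0 nat) set"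
    have top_ne: "top K \<noteq> {}" if "finite K" "K \<noteq> {}" for K
    proof -
      have "Max ((\<lambda>v. Poly_Mapping.lookup v i) ` K) \<in> (\<lambda>v. Poly_Mapping.lookup v i) ` K" using that by (intro Max_in) auto
      then obtain v where "v \<in> K" "Poly_Mapping.lookup v i = Max ((\<lambda>v. Poly_Mapping.lookup v i) ` K)" by force
      then have "v \<in> top K" using that(1) by (simp add: top_def)
      then show ?thesis by blast
    qed
    have top_eq: "Poly_Mapping.lookup v i = Poly_Mapping.lookup w i" if "v \<in> top K" "w \<in> top K" for v w K
      using that by (force simp: top_def intro: antisym)
    have top_sub: "top K \<subseteq> K" for K by (auto simp: top_def)
    have "v \<in> top A' \<and> w \<in> top B'"
      if ab: "a \<in> top A'" "b \<in> top B'" and vw: "v \<in> A" "w \<in> B" "v + w = a + b" for a b v w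
    proof -
      have vw': "v \<in> A'" "w \<in> B'" using AB(7) ab vw top_sub by blast+
      have "Poly_Mapping.lookup v i + Poly_Mapping.lookup w i = Poly_Mapping.lookup a i + Poly_Mapping.lookup b i"
        using vw(3) by (metis lookup_add)
      moreover have "Poly_Mapping.lookup v i \<le> Poly_Mapping.lookup a i" "Poly_Mapping.lookup w i \<le> Poly_Mapping.lookup b i"
        using ab vw' by (auto simp: top_def)
      ultimately have "Poly_Mapping.lookup v i = Poly_Mapping.lookup a i" "Poly_Mapping.lookup w i = Poly_Mapping.lookup b i" by linarith+
      then show ?thesis using ab vw' by (simp add: top_def)
    qed
    moreover have "top A' \<noteq> {}" "top B' \<noteq> {}"
      using top_ne AB(1-4) assms(1,3) finite_subset by metis+
    moreover have "\<forall>l\<in>insert i I. \<forall>v\<in>top A'. \<forall>w\<in>top A'. Poly_Mapping.lookup v l = Poly_Mapping.lookup w l"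
      "\<forall>l\<in>insert i I. \<forall>v\<in>top B'. \<forall>w\<in>top B'. Poly_Mapping.lookup v l = Poly_Mapping.lookup w l"
      using AB(5,6) top_eq top_sub by blast+
    moreover have "top A' \<subseteq> A" "top B' \<subseteq> B" using AB(1,2) top_sub by blast+
    ultimately show ?case
      by (intro exI[of _ "top A'"] conjI exI[of _ "top B'"]) blast+
  qed simp
  from this[of UNIV] obtain A' B' where AB: "A' \<subseteq> A" "B' \<subseteq> B" "A' \<noteq> {}" "B' \<noteq> {}"
      "\<forall>i\<in>UNIV. \<forall>v\<in>A'. \<forall>w\<in>A'. Poly_Mapping.lookup v i = Poly_Mapping.lookup w i"
      "\<forall>i\<in>UNIV. \<forall>v\<in>B'. \<forall>w\<in>B'. Poly_Mapping.lookup v i = Poly_Mapping.lookup w i"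
      "\<forall>a\<in>A'. \<forall>b\<in>B'. \<forall>v\<in>A. \<forall>w\<in>B. v + w = a + b \<longrightarrow> v \<in> A' \<and> w \<in> B'"
    by (elim exE conjE) (rule that)
  obtain a b where ab: "a \<in> A'" "b \<in> B'" using AB(3,4) by blast
  have "v = a \<and> w = b" if "v \<in> A" "w \<in> B" "v + w = a + b" for v w
  proof -
    have "v \<in> A'" "w \<in> B'" using AB(7) ab that by blast+
    then show ?thesis using AB(5,6) ab by (intro conjI poly_mapping_eqI) blast+
  qed
  then show ?thesis using ab AB(1,2) by blast
qed

lemma lookup_mult_unique:
  fixes p q :: "('v::finite, 'k::field) mpoly"
  assumes "\<And>v w. v \<in> Poly_Mapping.keys p \<Longrightarrow> w \<in> Poly_Mapping.keys q \<Longrightarrow> v + w = a + b \<Longrightarrow> v = a \<and> w = b"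
  shows "Poly_Mapping.lookup (p * q) (a + b) = Poly_Mapping.lookup p a * Poly_Mapping.lookup q b"
proof -
  have eq: "p * q = (\<Sum>v\<in>Poly_Mapping.keys p. \<Sum>w\<in>Poly_Mapping.keys q. Poly_Mapping.single (v + w) (Poly_Mapping.lookup p v * Poly_Mapping.lookup q w))"
    by (subst poly_mapping_sum_single[of p], subst poly_mapping_sum_single[of q])
      (simp add: sum_product mult_single)
  have "Poly_Mapping.lookup (p * q) (a + b) = (\<Sum>v\<in>Poly_Mapping.keys p. \<Sum>w\<in>Poly_Mapping.keys q.
      if v + w = a + b then Poly_Mapping.lookup p v * Poly_Mapping.lookup q w else 0)"
    unfolding eq by (simp add: lookup_sum lookup_single when_def)
  also have "\<dots> = (\<Sum>v\<in>Poly_Mapping.keys p. \<Sum>w\<in>Poly_Mapping.keys q. if v = a \<and> w = b then Poly_Mapping.lookup p a * Poly_Mapping.lookup q b else 0)"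
    using assms by (intro sum.cong refl) auto
  also have "\<dots> = (\<Sum>v\<in>Poly_Mapping.keys p. if v = a then (\<Sum>w\<in>Poly_Mapping.keys q. if w = b then Poly_Mapping.lookup p a * Poly_Mapping.lookup q b else 0) else 0)"
    by (intro sum.cong refl) auto
  also have "\<dots> = Poly_Mapping.lookup p a * Poly_Mapping.lookup q b"
    by (simp add: in_keys_iff)
  finally show ?thesis .
qed

text \<open>The \<open>s\<close>-th power of the prime ideal generated by the variables in \<open>C\<close>.\<close>

definition cover_power :: "'v set \<Rightarrow> nat \<Rightarrow> ('v::finite, 'k::field) mpoly set" where
  "cover_power C s = avoiding {u. sum u C < s}"

lemma cover_power_iff: "p \<in> cover_power C s \<longleftrightarrow> (\<forall>u\<in>Poly_Mapping.keys p. s \<le> sum (Poly_Mapping.lookup u) C)"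
  by (auto simp: cover_power_def avoiding_def not_less)

lemma cover_power_ideal_set: "ideal_set (cover_power C s)"
  unfolding cover_power_def
proof (rule avoiding_ideal_set, unfold down_closed_def, intro ballI allI impI)
  fix u v :: "'a \<Rightarrow> nat" assume "u \<in> {u. sum u C < s}" "v \<le> u"
  moreover from this have "sum v C \<le> sum u C" by (intro sum_mono) (simp add: le_fun_def)
  ultimately show "v \<in> {u. sum u C < s}" by simp
qed

lemma cover_power_1: "cover_power C 1 = off_ideal (- C)"
proof -
  have "1 \<le> sum (Poly_Mapping.lookup u) C \<longleftrightarrow> sum (Poly_Mapping.lookup u) C \<noteq> 0" for u :: "'a \<Rightarrow>\<^sub>0 nat"
    by linarith
  then show ?thesis by (simp add: set_eq_iff cover_power_iff off_ideal_iff Bex_def)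
qed

lemma cover_power_mult:
  assumes "p \<in> cover_power C s" "q \<in> cover_power C t"
  shows "p * q \<in> cover_power C (s + t)"
  unfolding cover_power_iff
proof
  fix u assume "u \<in> Poly_Mapping.keys (p * q)"
  then obtain a b where "u = a + b" "a \<in> Poly_Mapping.keys p" "b \<in> Poly_Mapping.keys q" using keys_mult[of p q] by blast
  then show "s + t \<le> sum (Poly_Mapping.lookup u) C"
    using assms by (simp add: cover_power_iff lookup_add sum.distrib add_mono)
qed

text \<open>Among the terms of \<open>p\<close> of degree 0 in the variables of \<open>C\<close> and
  the terms of \<open>q\<close> of least such degree \<open>d < s\<close>, a leading pair multiplies
  to a term that nothing cancels. Its degree in \<open>C\<close> is \<open>d\<close>, so the product
  would lie outside the power.\<close>

lemma cover_power_primary: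
  assumes pq: "p * q \<in> cover_power C s" and p: "p \<notin> off_ideal (- C)"
  shows "q \<in> cover_power C s"
proof (rule ccontr)
  assume q: "q \<notin> cover_power C s"
  define A where "A = {u\<in>Poly_Mapping.keys p. sum (Poly_Mapping.lookup u) C = 0}"
  have "A \<noteq> {}" using p by (auto simp: off_ideal_iff A_def)
  define d where "d = Min ((\<lambda>u. sum (Poly_Mapping.lookup u) C) ` Poly_Mapping.keys q)"
  define B where "B = {u\<in>Poly_Mapping.keys q. sum (Poly_Mapping.lookup u) C = d}"
  obtain w0 where w0: "w0 \<in> Poly_Mapping.keys q" "sum (Poly_Mapping.lookup w0) C < s" using q by (auto simp: cover_power_iff not_le)
  have d_le: "d \<le> sum (Poly_Mapping.lookup u) C" if "u \<in> Poly_Mapping.keys q" for u unfolding d_def using that by (intro Min_le) auto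
  have "d \<in> (\<lambda>u. sum (Poly_Mapping.lookup u) C) ` Poly_Mapping.keys q" unfolding d_def using w0(1) by (intro Min_in) auto
  then have "B \<noteq> {}" by (auto simp: B_def)
  obtain a b where ab: "a \<in> A" "b \<in> B" "\<forall>v\<in>A. \<forall>w\<in>B. v + w = a + b \<longrightarrow> v = a \<and> w = b"
    using unique_leading_sum[of A B] \<open>A \<noteq> {}\<close> \<open>B \<noteq> {}\<close> by (auto simp: A_def B_def)
  have "v = a \<and> w = b" if vw: "v \<in> Poly_Mapping.keys p" "w \<in> Poly_Mapping.keys q" "v + w = a + b" for v w
  proof -
    have "sum (Poly_Mapping.lookup v) C + sum (Poly_Mapping.lookup w) C = sum (Poly_Mapping.lookup (v + w)) C"
      by (simp add: lookup_add sum.distrib)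
    also have "\<dots> = d" unfolding vw(3) using ab(1,2) by (simp add: lookup_add sum.distrib A_def B_def)
    finally have "sum (Poly_Mapping.lookup v) C = 0" "sum (Poly_Mapping.lookup w) C = d" using d_le[OF vw(2)] by linarith+
    then show ?thesis using ab(3) vw by (auto simp: A_def B_def)
  qed
  then have "Poly_Mapping.lookup (p * q) (a + b) = Poly_Mapping.lookup p a * Poly_Mapping.lookup q b" by (rule lookup_mult_unique)
  then have "a + b \<in> Poly_Mapping.keys (p * q)" using ab(1,2) by (simp add: A_def B_def in_keys_iff)
  then have "s \<le> sum (Poly_Mapping.lookup (a + b)) C" using pq by (simp add: cover_power_iff)
  also have "\<dots> = d" using ab(1,2) by (simp add: lookup_add sum.distrib A_def B_def)
  finally show False using d_le[OF w0(1)] w0(2) by simp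
qed

lemma Var_mem_off_ideal: "(Var i :: ('v::finite, 'k::field) mpoly) \<in> off_ideal F \<longleftrightarrow> i \<notin> F"
  by (auto simp: Var_def off_ideal_iff lookup_single when_def)

lemma off_ideal_subset_if_Vars:
  assumes Q: "ideal_set Q" and C: "\<And>i. i \<in> C \<Longrightarrow> (Var i :: ('v::finite, 'k::field) mpoly) \<in> Q"
  shows "off_ideal (- C) \<subseteq> Q"
proof
  fix p :: "('v, 'k) mpoly" assume p: "p \<in> off_ideal (- C)"
  have "Poly_Mapping.single u (Poly_Mapping.lookup p u) \<in> Q" if u: "u \<in> Poly_Mapping.keys p" for u
  proof -
    obtain i where i: "i \<in> C" "Poly_Mapping.lookup u i \<noteq> 0" using p u by (auto simp: off_ideal_iff)
    have "\<exists>q. Poly_Mapping.single u (Poly_Mapping.lookup p u) = Var i * q"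
      unfolding Var_eq_exp_monom using i(2)
      by (intro monom_factor) (auto simp: indic_def le_fun_def split: if_splits)
    then obtain q where "Poly_Mapping.single u (Poly_Mapping.lookup p u) = q * Var i" by (auto simp: mult.commute)
    then show ?thesis using ideal_set_mult[OF Q C[OF i(1)]] by simp
  qed
  then have "(\<Sum>u\<in>Poly_Mapping.keys p. Poly_Mapping.single u (Poly_Mapping.lookup p u)) \<in> Q" by (intro ideal_set_sum[OF Q])
  then show "p \<in> Q" using poly_mapping_sum_single[of p] by simp
qed

text \<open>Primality is the case \<open>s = 1\<close> of
  \<open>cover_power_primary\<close>.\<close>

lemma off_ideal_primeideal:
  "primeideal (off_ideal (- C) :: ('v::finite, 'k::field) mpoly set) polynomial_ring"
  unfolding polynomial_ring_def
proof (rule primeidealI)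
  show "ideal (off_ideal (- C) :: ('v, 'k) mpoly set) ring_of_type_algebra"
    by (simp add: type_algebra_ideal_iff off_ideal_ideal_set)
  show "cring (ring_of_type_algebra :: ('v, 'k) mpoly ring)" by (rule cring_from_type_algebra)
  have "(1 :: ('v, 'k) mpoly) \<notin> off_ideal (- C)" by (simp add: off_ideal_iff)
  then show "carrier ring_of_type_algebra \<noteq> (off_ideal (- C) :: ('v, 'k) mpoly set)" by auto
  show "p \<in> off_ideal (- C) \<or> q \<in> off_ideal (- C)"
    if "p \<otimes>\<^bsub>ring_of_type_algebra\<^esub> q \<in> off_ideal (- C)" for p q :: "('v, 'k) mpoly"
    using that cover_power_primary[of p q C 1] by (auto simp: cover_power_1[unfolded One_nat_def])
qed

section \<open>Minimal primes and symbolic powers of the edge ideal\<close>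

lemma edge_ideal_ideal_set: "ideal_set (edge_ideal E)"
  unfolding edge_ideal_def polynomial_ring_def by (rule type_algebra_Idl_ideal_set)

lemma edge_mem: "E x y \<Longrightarrow> Var x * Var y \<in> edge_ideal E"
  unfolding edge_ideal_def polynomial_ring_def by (rule type_algebra_Idl_mem) blast

lemma edge_ideal_subset_cover:
  assumes "vertex_cover E C"
  shows "(edge_ideal E :: ('v::finite, 'k::field) mpoly set) \<subseteq> off_ideal (- C)"
  unfolding edge_ideal_def polynomial_ring_def
proof (rule type_algebra_Idl_subset[OF off_ideal_ideal_set], rule subsetI)
  fix p :: "('v, 'k) mpoly" assume "p \<in> {Var x * Var y | x y. E x y}"
  then obtain x y where xy: "p = Var x * Var y" "E x y" by blast
  then have "x \<in> C \<or> y \<in> C" using assms by (auto simp: vertex_cover_def)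
  then have "(Var x :: ('v, 'k) mpoly) \<in> off_ideal (- C) \<or> (Var y :: ('v, 'k) mpoly) \<in> off_ideal (- C)"
    by (simp add: Var_mem_off_ideal)
  then show "p \<in> off_ideal (- C)"
    unfolding xy(1) using ideal_set_mult[OF off_ideal_ideal_set] by (metis mult.commute)
qed

lemma prime_Vars_vertex_cover:
  assumes P: "primeideal P polynomial_ring" and "edge_ideal E \<subseteq> P"
  shows "vertex_cover E {i. Var i \<in> P}"
  unfolding vertex_cover_def
proof (intro allI impI)
  fix x y assume "E x y"
  from assms(2) edge_mem[of E x y, OF this] have "Var x * Var y \<in> P" by (rule subsetD)
  then show "x \<in> {i. Var i \<in> P} \<or> y \<in> {i. Var i \<in> P}"
    using primeideal.I_prime[OF P, of "Var x" "Var y"] by (simp add: polynomial_ring_def)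
qed

lemma primeideal_ideal_set: "primeideal P polynomial_ring \<Longrightarrow> ideal_set P"
  using primeideal.axioms(1)[of P polynomial_ring] type_algebra_ideal_iff[of P]
  unfolding polynomial_ring_def by blast

text \<open>A prime over the edge ideal contains an end of every edge; inside the prime of a minimal
  cover \<open>C\<close>, these variables must be all of \<open>C\<close>.\<close>

lemma minimal_cover_minimal_prime:
  fixes E :: "'v::finite \<Rightarrow> 'v \<Rightarrow> bool"
  assumes C: "vertex_cover E C" "\<And>D. vertex_cover E D \<Longrightarrow> D \<subseteq> C \<Longrightarrow> D = C"
  shows "(off_ideal (- C) :: ('v, 'k::field) mpoly set) \<in> minimal_primes polynomial_ring (edge_ideal E)"
  unfolding minimal_primes_def
proof (intro CollectI conjI allI impI)
  show "primeideal (off_ideal (- C) :: ('v, 'k) mpoly set) polynomial_ring" by (rule off_ideal_primeideal)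
  show "(edge_ideal E :: ('v, 'k) mpoly set) \<subseteq> off_ideal (- C)" by (rule edge_ideal_subset_cover[OF C(1)])
  fix Q :: "('v, 'k) mpoly set"
  assume Q: "primeideal Q polynomial_ring \<and> edge_ideal E \<subseteq> Q \<and> Q \<subseteq> off_ideal (- C)"
  have "i \<in> C" if "Var i \<in> Q" for i
  proof -
    have "(Var i :: ('v, 'k) mpoly) \<in> off_ideal (- C)" using Q that by blast
    then show ?thesis by (simp add: Var_mem_off_ideal)
  qed
  then have "{i. Var i \<in> Q} = C" using Q by (intro C(2) prime_Vars_vertex_cover) auto
  then have "off_ideal (- C) \<subseteq> Q"
    using Q primeideal_ideal_set by (intro off_ideal_subset_if_Vars) auto
  then show "Q = off_ideal (- C)" using Q by blast
qed

text \<open>The variables in \<open>P\<close> form a cover whose own prime lies inside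
  \<open>P\<close>, so minimality gives equality. A vertex of \<open>C\<close> without neighbours
  outside \<open>C\<close> could be dropped, against minimality. The outside neighbours serve to
  complete variables of \<open>C\<close> to edges.\<close>

lemma minimal_primeE:
  fixes E :: "'v::finite \<Rightarrow> 'v \<Rightarrow> bool" and P :: "('v, 'k::field) mpoly set"
  assumes "simple_graph E" "P \<in> minimal_primes polynomial_ring (edge_ideal E)"
  obtains C where "P = off_ideal (- C)" "vertex_cover E C" "\<And>i. i \<in> C \<Longrightarrow> \<exists>j. j \<notin> C \<and> E i j"
proof -
  have E_sym: "E x y \<Longrightarrow> E y x" and E_irrefl: "\<not> E x x" for x y
    using assms(1) unfolding simple_graph_def by (auto dest: sympD irreflpD)
  have P: "primeideal P polynomial_ring" "edge_ideal E \<subseteq> P"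
    and min: "\<And>Q. primeideal Q polynomial_ring \<Longrightarrow> edge_ideal E \<subseteq> Q \<Longrightarrow> Q \<subseteq> P \<Longrightarrow> Q = P"
    using assms(2) by (auto simp: minimal_primes_def)
  define C where "C = {i. Var i \<in> P}"
  have C: "vertex_cover E C" unfolding C_def by (rule prime_Vars_vertex_cover[OF P])
  have off_P: "(off_ideal (- D) :: ('v, 'k) mpoly set) = P" if "vertex_cover E D" "D \<subseteq> C" for D
  proof (rule min)
    show "primeideal (off_ideal (- D) :: ('v, 'k) mpoly set) polynomial_ring" by (rule off_ideal_primeideal)
    show "(edge_ideal E :: ('v, 'k) mpoly set) \<subseteq> off_ideal (- D)" by (rule edge_ideal_subset_cover[OF that(1)])
    show "(off_ideal (- D) :: ('v, 'k) mpoly set) \<subseteq> P"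
      using that(2) by (intro off_ideal_subset_if_Vars primeideal_ideal_set[OF P(1)]) (auto simp: C_def)
  qed
  have "\<exists>j. j \<notin> C \<and> E i j" if i: "i \<in> C" for i
  proof (rule ccontr)
    assume "\<not> ?thesis"
    then have "vertex_cover E (C - {i})" using C E_sym E_irrefl unfolding vertex_cover_def by blast
    then have "off_ideal (- (C - {i})) = P" by (rule off_P) blast
    moreover have "Var i \<in> P" using i by (simp add: C_def)
    ultimately have "(Var i :: ('v, 'k) mpoly) \<in> off_ideal (- (C - {i}))" by simp
    then show False by (simp add: Var_mem_off_ideal)
  qed
  then show ?thesis using that[of C] off_P[OF C] C by blast
qed

abbreviation edge_power :: "('v \<Rightarrow> 'v \<Rightarrow> bool) \<Rightarrow> nat \<Rightarrow> ('v::finite, 'k::field) mpoly set" where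
  "edge_power E s \<equiv> edge_ideal E [^]\<^bsub>ideals_set polynomial_ring\<^esub> s"

lemma edge_power_0: "edge_power E 0 = UNIV"
  by (simp add: nat_pow_def ideals_set_def polynomial_ring_def)

lemma edge_power_Suc: "edge_power E (Suc s) = ideal_prod polynomial_ring (edge_power E s) (edge_ideal E)"
  by (simp add: nat_pow_def ideals_set_def)

lemma edge_power_ideal_set: "ideal_set (edge_power E s :: ('v::finite, 'k::field) mpoly set)"
proof (induction s)
  case 0
  show ?case unfolding edge_power_0 by (rule ideal_set_UNIV)
next
  case (Suc s)
  have "ideal (ideal_prod polynomial_ring (edge_power E s) (edge_ideal E :: ('v, 'k) mpoly set)) polynomial_ring"
    unfolding polynomial_ring_def
    by (rule ring.ideal_prod_is_ideal[OF ring_from_type_algebra])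
      (use Suc edge_ideal_ideal_set[of E] in \<open>simp_all add: type_algebra_ideal_iff polynomial_ring_def\<close>)
  then show ?case unfolding edge_power_Suc by (simp add: polynomial_ring_def type_algebra_ideal_iff)
qed

lemma edge_power_mult:
  "p \<in> edge_power E s \<Longrightarrow> q \<in> edge_ideal E \<Longrightarrow> p * q \<in> edge_power E (Suc s)"
  unfolding edge_power_Suc using ideal_prod.prod[of p _ q "edge_ideal E" polynomial_ring]
  by (simp add: polynomial_ring_def)

lemma edge_power_subset_cover_power:
  assumes "vertex_cover E C"
  shows "(edge_power E s :: ('v::finite, 'k::field) mpoly set) \<subseteq> cover_power C s"
proof (induction s)
  case 0
  show ?case by (auto simp: cover_power_iff)
next
  case (Suc s)
  show ?case
  proof
    fix p :: "('v, 'k) mpoly" assume "p \<in> edge_power E (Suc s)"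
    then have "p \<in> ideal_prod polynomial_ring (edge_power E s) (edge_ideal E)"
      unfolding edge_power_Suc .
    then show "p \<in> cover_power C (Suc s)"
    proof induction
      case (prod i j)
      have "j \<in> cover_power C 1"
        using prod(2) edge_ideal_subset_cover[OF assms] unfolding cover_power_1 by blast
      then have "i * j \<in> cover_power C (s + 1)" using prod(1) Suc by (intro cover_power_mult) auto
      then show ?case by (simp add: polynomial_ring_def)
    next
      case (sum p q)
      then show ?case using ideal_set_add[OF cover_power_ideal_set] by (simp add: polynomial_ring_def)
    qed
  qed
qed

text \<open>Each of \<open>s\<close> factors \<open>Var i\<close> with \<open>i\<close> in
  \<open>C\<close> is completed to a generator of the edge ideal by a neighbour outside
  \<open>C\<close>, so the multiplier involves only variables outside \<open>C\<close>.\<close>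

lemma monom_times_outside_in_edge_power:
  assumes C: "\<And>i. i \<in> C \<Longrightarrow> \<exists>j. j \<notin> C \<and> E i j" and "s \<le> sum w C"
  shows "\<exists>b. (\<forall>i\<in>C. b i = 0) \<and> (exp_monom b * exp_monom w :: ('v::finite, 'k::field) mpoly) \<in> edge_power E s"
  using assms(2)
proof (induction s arbitrary: w)
  case 0
  show ?case unfolding edge_power_0 by (intro exI[of _ "\<lambda>_. 0"]) simp
next
  case (Suc s)
  have "\<exists>i\<in>C. w i > 0"
  proof (rule ccontr)
    assume "\<not> ?thesis"
    then have "sum w C = 0" by simp
    then show False using Suc.prems by simp
  qed
  then obtain i where i: "i \<in> C" "w i > 0" by blast
  obtain j where j: "j \<notin> C" "E i j" using C[OF i(1)] by blast
  define w' where "w' = w(i := w i - 1)"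
  have w: "w = (\<lambda>l. w' l + indic {i} l)" using i(2) by (auto simp: w'_def indic_def)
  have "sum w C = sum w' C + sum (indic {i}) C" by (subst w) (simp add: sum.distrib)
  moreover have "sum (indic {i}) C = 1" using i(1) by (simp add: indic_def)
  ultimately have "s \<le> sum w' C" using Suc.prems by simp
  then obtain b where b: "\<forall>i\<in>C. b i = 0" "(exp_monom b * exp_monom w' :: ('v, 'k) mpoly) \<in> edge_power E s"
    using Suc.IH by blast
  define b' where "b' = (\<lambda>l. b l + indic {j} l)"
  have "(exp_monom b' * exp_monom w :: ('v, 'k) mpoly) = (exp_monom b * exp_monom w') * (Var i * Var j)"
    unfolding b'_def Var_eq_exp_monom by (subst w) (simp only: monom_mult[symmetric] mult_ac)
  also have "\<dots> \<in> edge_power E (Suc s)" by (rule edge_power_mult[OF b(2) edge_mem[of E i j, OF j(2)]])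
  finally have "(exp_monom b' * exp_monom w :: ('v, 'k) mpoly) \<in> edge_power E (Suc s)" .
  moreover have "\<forall>i\<in>C. b' i = 0" using b(1) j(1) by (auto simp: b'_def indic_def)
  ultimately show ?case by blast
qed

text \<open>A common multiplier for all terms is the product of the multipliers of the single
  terms.\<close>

lemma cover_power_times_outside_in_edge_power:
  assumes C: "\<And>i. i \<in> C \<Longrightarrow> \<exists>j. j \<notin> C \<and> E i j"
    and f: "(f :: ('v::finite, 'k::field) mpoly) \<in> cover_power C s"
  shows "\<exists>b. (\<forall>i\<in>C. b i = 0) \<and> exp_monom b * f \<in> edge_power E s"
proof -
  have "\<exists>b. (\<forall>i\<in>C. b i = 0) \<and> exp_monom b * (\<Sum>u\<in>U. Poly_Mapping.single u (Poly_Mapping.lookup f u)) \<in> edge_power E s"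
    if "U \<subseteq> Poly_Mapping.keys f" for U
  proof -
    have "finite U" by (rule finite_subset[OF that finite_keys])
    then show ?thesis using that
    proof (induction U)
      case empty
      show ?case by (intro exI[of _ "\<lambda>_. 0"]) (simp add: ideal_set_zero[OF edge_power_ideal_set])
    next
      case (insert u U)
      obtain b where b: "\<forall>i\<in>C. b i = 0" "exp_monom b * (\<Sum>u\<in>U. Poly_Mapping.single u (Poly_Mapping.lookup f u)) \<in> edge_power E s"
        using insert.IH insert.prems by blast
      have "\<exists>c. (\<forall>i\<in>C. c i = 0) \<and> (exp_monom c * exp_monom (Poly_Mapping.lookup u) :: ('v, 'k) mpoly) \<in> edge_power E s"
      proof (rule monom_times_outside_in_edge_power)
        show "\<exists>j. j \<notin> C \<and> E i j" if "i \<in> C" for i using that by (rule C)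
        show "s \<le> sum (Poly_Mapping.lookup u) C" using f insert.prems by (simp add: cover_power_iff)
      qed
      then obtain c where c: "\<forall>i\<in>C. c i = 0" "(exp_monom c * exp_monom (Poly_Mapping.lookup u) :: ('v, 'k) mpoly) \<in> edge_power E s"
        by blast
      have sgl: "Poly_Mapping.single u (Poly_Mapping.lookup f u) = Poly_Mapping.single 0 (Poly_Mapping.lookup f u) * exp_monom (Poly_Mapping.lookup u)"
        by (simp add: exp_monom_def mult_single)
      have "exp_monom c * Poly_Mapping.single u (Poly_Mapping.lookup f u) = Poly_Mapping.single 0 (Poly_Mapping.lookup f u) * (exp_monom c * exp_monom (Poly_Mapping.lookup u))"
        unfolding sgl by (simp only: mult_ac)
      then have c': "exp_monom c * Poly_Mapping.single u (Poly_Mapping.lookup f u) \<in> edge_power E s"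
        using ideal_set_mult[OF edge_power_ideal_set c(2)] by simp
      have "exp_monom (\<lambda>i. b i + c i) * (\<Sum>u\<in>insert u U. Poly_Mapping.single u (Poly_Mapping.lookup f u)) =
          exp_monom b * (exp_monom c * Poly_Mapping.single u (Poly_Mapping.lookup f u)) + exp_monom c * (exp_monom b * (\<Sum>u\<in>U. Poly_Mapping.single u (Poly_Mapping.lookup f u)))"
        using insert.hyps unfolding monom_mult[symmetric] by (simp add: algebra_simps)
      also have "\<dots> \<in> edge_power E s"
        by (intro ideal_set_add[OF edge_power_ideal_set] ideal_set_mult[OF edge_power_ideal_set] c' b(2))
      finally show ?case using b(1) c(1) by (intro exI[of _ "\<lambda>i. b i + c i"]) simp
    qed
  qed
  from this[of "Poly_Mapping.keys f"] show ?thesis using poly_mapping_sum_single[of f] by simp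
qed

lemma minimal_cover_exists:
  fixes C :: "'v::finite set"
  assumes "vertex_cover E C"
  obtains D where "D \<subseteq> C" "vertex_cover E D" "\<And>D'. vertex_cover E D' \<Longrightarrow> D' \<subseteq> D \<Longrightarrow> D' = D"
proof -
  have "finite {D. D \<subseteq> C \<and> vertex_cover E D}" by simp
  moreover have "C \<in> {D. D \<subseteq> C \<and> vertex_cover E D}" using assms by simp
  ultimately obtain D where "D \<in> {D. D \<subseteq> C \<and> vertex_cover E D}"
    "\<forall>D'\<in>{D. D \<subseteq> C \<and> vertex_cover E D}. D' \<subseteq> D \<longrightarrow> D = D'"
    using finite_has_minimal[of "{D. D \<subseteq> C \<and> vertex_cover E D}"] by blast
  then show ?thesis using that[of D] by blast
qed

text \<open>Localization at the prime of a minimal cover \<open>C\<close> inverts the variables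
  outside \<open>C\<close>, so the edge ideal becomes that prime and its power becomes
  \<open>cover_power C s\<close>, which is primary. The intersection runs over minimal covers while
  \<open>small_cover_wts\<close> allows all; shrinking a cover does not raise its weight.\<close>

lemma symbolic_power_edge_ideal:
  fixes E :: "'v::finite \<Rightarrow> 'v \<Rightarrow> bool"
  assumes graph: "simple_graph E"
  shows "symbolic_power polynomial_ring (edge_ideal E :: ('v, 'k::field) mpoly set) s =
    avoiding (small_cover_wts E s)"
proof (intro subset_antisym subsetI)
  have ker: "f \<in> localization_kernel polynomial_ring (edge_power E s) P \<longleftrightarrow> (\<exists>u. u \<notin> P \<and> u * f \<in> edge_power E s)"
    if "primeideal P polynomial_ring" for P and f :: "('v, 'k) mpoly"
    using localization_kernel_iff[OF edge_power_ideal_set[of E s] that[unfolded polynomial_ring_def], of f]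
    by (simp add: polynomial_ring_def)
  have avoid: "f \<in> avoiding (small_cover_wts E s) \<longleftrightarrow> (\<forall>C. vertex_cover E C \<longrightarrow> f \<in> cover_power C s)"
    for f :: "('v, 'k) mpoly"
    by (auto simp: avoiding_def small_cover_wts_def cover_power_iff not_less)
  {
    fix f :: "('v, 'k) mpoly" assume f: "f \<in> symbolic_power polynomial_ring (edge_ideal E) s"
    show "f \<in> avoiding (small_cover_wts E s)"
      unfolding avoid
    proof (intro allI impI)
      fix C assume "vertex_cover E C"
      then obtain D where D: "D \<subseteq> C" "vertex_cover E D" "\<And>D'. vertex_cover E D' \<Longrightarrow> D' \<subseteq> D \<Longrightarrow> D' = D"
        by (rule minimal_cover_exists) blast
      have "(off_ideal (- D) :: ('v, 'k) mpoly set) \<in> minimal_primes polynomial_ring (edge_ideal E)"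
        by (rule minimal_cover_minimal_prime[OF D(2,3)])
      then have "f \<in> localization_kernel polynomial_ring (edge_power E s) (off_ideal (- D))"
        using f by (auto simp: symbolic_power_def)
      then obtain u where u: "u \<notin> off_ideal (- D)" "u * f \<in> edge_power E s"
        unfolding ker[OF off_ideal_primeideal] by blast
      have "u * f \<in> cover_power D s" by (rule subsetD[OF edge_power_subset_cover_power[OF D(2)] u(2)])
      then have "f \<in> cover_power D s" using u(1) by (rule cover_power_primary)
      moreover have "sum (Poly_Mapping.lookup u) D \<le> sum (Poly_Mapping.lookup u) C" for u :: "'v \<Rightarrow>\<^sub>0 nat"
        using D(1) by (intro sum_mono2) auto
      ultimately show "f \<in> cover_power C s" unfolding cover_power_iff using order_trans by blast
    qed
  next
    fix f :: "('v, 'k) mpoly" assume f: "f \<in> avoiding (small_cover_wts E s)"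
    have "f \<in> localization_kernel polynomial_ring (edge_power E s) P"
      if P: "P \<in> minimal_primes polynomial_ring (edge_ideal E)" for P
    proof -
      obtain C where C: "P = off_ideal (- C)" "vertex_cover E C"
        "\<And>i. i \<in> C \<Longrightarrow> \<exists>j. j \<notin> C \<and> E i j"
        using graph P by (rule minimal_primeE) blast
      have "\<exists>b. (\<forall>i\<in>C. b i = 0) \<and> exp_monom b * f \<in> edge_power E s"
      proof (rule cover_power_times_outside_in_edge_power)
        show "\<exists>j. j \<notin> C \<and> E i j" if "i \<in> C" for i using that by (rule C(3))
        show "f \<in> cover_power C s" using f C(2) avoid by blast
      qed
      then obtain b where b: "\<forall>i\<in>C. b i = 0" "exp_monom b * f \<in> edge_power E s" by blast
      have "(exp_monom b :: ('v, 'k) mpoly) \<notin> off_ideal (- C)"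
        using b(1) by (auto simp: off_ideal_iff keys_monom)
      then show ?thesis unfolding C(1) ker[OF off_ideal_primeideal] using b(2) by blast
    qed
    then show "f \<in> symbolic_power polynomial_ring (edge_ideal E) s"
      by (auto simp: symbolic_power_def polynomial_ring_def)
  }
qed

text \<open>Two vertices can be centres of the same star, as the ends of an isolated edge are; so
  one centre is chosen for each star of a maximum packing.\<close>

lemma star_packing_number_centres:
  fixes E :: "'v::finite \<Rightarrow> 'v \<Rightarrow> bool"
  obtains Z where "card Z = star_packing_number E"
    "\<And>x y. x \<in> Z \<Longrightarrow> y \<in> Z \<Longrightarrow> x \<noteq> y \<Longrightarrow> closed_nbhd E x \<inter> closed_nbhd E y = {}"
proof -
  have "{card F | F. star_packing E F} = card ` {F. star_packing E F}" by blast
  moreover have "{F. star_packing E F} \<subseteq> Pow (range (star E))" by (auto simp: star_packing_def)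
  then have "finite {F. star_packing E F}" by (rule finite_subset) simp
  ultimately have fin: "finite {card F | F. star_packing E F}" by simp
  have "star_packing E {}" by (simp add: star_packing_def)
  then have "{card F | F. star_packing E F} \<noteq> {}" by blast
  then have "star_packing_number E \<in> {card F | F. star_packing E F}"
    unfolding star_packing_number_def using fin by (rule Max_in[rotated])
  then obtain F where F: "star_packing E F" "card F = star_packing_number E" by auto
  define c where "c = inv_into UNIV (star E)"
  have sc: "star E (c A) = A" if "A \<in> F" for A
    unfolding c_def using F(1) that by (intro f_inv_into_f) (auto simp: star_packing_def)
  have "inj_on c F" using sc by (metis inj_onI)
  then have "card (c ` F) = star_packing_number E" using F(2) by (simp add: card_image)
  moreover have "closed_nbhd E x \<inter> closed_nbhd E y = {}" if xy: "x \<in> c ` F" "y \<in> c ` F" "x \<noteq> y" for x y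
  proof -
    obtain A B where AB: "x = c A" "y = c B" "A \<in> F" "B \<in> F" using xy by blast
    then have "disjnt (fst A) (fst B)" using F(1) xy(3) by (auto simp: star_packing_def pairwise_def)
    moreover have "fst A = closed_nbhd E x"
      using arg_cong[OF sc[OF AB(3)], of fst] by (simp add: AB(1) star_def)
    moreover have "fst B = closed_nbhd E y"
      using arg_cong[OF sc[OF AB(4)], of fst] by (simp add: AB(2) star_def)
    ultimately show ?thesis by (simp add: disjnt_def)
  qed
  ultimately show ?thesis by (rule that)
qed

theorem theorem3p4:
  fixes E :: "'v::finite \<Rightarrow> 'v \<Rightarrow> bool"
    and S :: "('v, 'k::field) mpoly ring"
    and s :: nat
  assumes "simple_graph E"
    and "chordal E"
    and "S = polynomial_ring"
    and "s \<ge> 1"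
  shows "ereal_of_enat (depth_quot S graded_maximal_ideal (symbolic_power S (edge_ideal E) s))
           \<ge> ereal (real (star_packing_number E) - real s + 1)"
proof -
  obtain r where "perfect_elimination_order E r"
    using chordal_perfect_elimination_order[OF assms(1,2)] by blast
  then interpret perfect_elimination_order E r .
  obtain Z where Z: "card Z = star_packing_number E"
    "\<And>x y. x \<in> Z \<Longrightarrow> y \<in> Z \<Longrightarrow> x \<noteq> y \<Longrightarrow> closed_nbhd E x \<inter> closed_nbhd E y = {}"
    by (rule star_packing_number_centres) blast
  interpret peo_with_centres E r Z by unfold_locales (rule Z(2))
  \<comment> \<open>If \<open>s > star_packing_number E + 1\<close>, truncated subtraction gives
    \<open>k = 0\<close> while the real bound is negative, so a regular sequence of length
    \<open>k\<close> still suffices.\<close>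
  define k where "k = star_packing_number E + 1 - s"
  define I where "I = (avoiding (small_cover_wts E s) :: ('v, 'k) mpoly set)"
  have "cone_filtered k (small_cover_wts E s)"
    using small_cover_cone_filtered[of s] assms(4) by (simp add: k_def Z(1))
  then have reg: "regular_on esym_seq k UNIV I"
    unfolding I_def by (rule cone_filtered_regular) (rule esym_regular_off_ideal)
  have "regular_sequence_quot S graded_maximal_ideal I (map esym_seq [0..<k])"
    unfolding assms(3) polynomial_ring_def
  proof (rule regular_sequence_quot_if_regular_on[OF _ reg])
    show "ideal_set I" unfolding I_def by (rule avoiding_ideal_set[OF small_cover_wts_down_closed])
    \<comment> \<open>\<open>off_ideal {}\<close> consists of the polynomials without constant term;
      it witnesses that \<open>I\<close> and the sequence generate a proper ideal.\<close>
    show "ideal_set (off_ideal {} :: ('v, 'k) mpoly set)" by (rule off_ideal_ideal_set)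
    show esym: "(esym_seq i :: ('v, 'k) mpoly) \<in> off_ideal {}" for i
      unfolding off_ideal_iff
    proof
      fix u assume "u \<in> Poly_Mapping.keys (esym_seq i :: ('v, 'k) mpoly)"
      then obtain A where A: "card A = Suc i" "u = Abs_poly_mapping (indic A)" using keys_elem_sym by blast
      then obtain l where "l \<in> A" by (metis card.empty equals0I nat.distinct(1))
      then show "\<exists>i. i \<notin> {} \<and> Poly_Mapping.lookup u i \<noteq> 0" using A(2) by (auto simp: indic_def intro!: exI[of _ l])
    qed
    have "off_ideal (- UNIV) \<subseteq> (graded_maximal_ideal :: ('v, 'k) mpoly set)"
      unfolding graded_maximal_ideal_def polynomial_ring_def
      by (intro off_ideal_subset_if_Vars type_algebra_Idl_ideal_set type_algebra_Idl_mem) auto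
    then show "(esym_seq i :: ('v, 'k) mpoly) \<in> graded_maximal_ideal" for i using esym[of i] by auto
    show "(1 :: ('v, 'k) mpoly) \<notin> off_ideal {}" by (simp add: off_ideal_iff)
    \<comment> \<open>Since \<open>s \<ge> 1\<close>, the zero exponent has a cover of weight below
      \<open>s\<close>, so no element of \<open>I\<close> has a constant term.\<close>
    have "vertex_cover E UNIV" by (simp add: vertex_cover_def)
    then have zero: "u \<in> small_cover_wts E s" if "\<And>i. u i = 0" for u
      using that assms(4) by (auto simp: small_cover_wts_def intro!: exI[of _ UNIV])
    show "I \<subseteq> off_ideal {}"
    proof
      fix p assume p: "p \<in> I"
      show "p \<in> off_ideal {}"
        unfolding off_ideal_iff
      proof (rule ballI, rule ccontr)
        fix u assume "u \<in> Poly_Mapping.keys p" "\<not> (\<exists>i. i \<notin> {} \<and> Poly_Mapping.lookup u i \<noteq> 0)"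
        then show False using zero[of "Poly_Mapping.lookup u"] p by (simp add: I_def avoiding_def)
      qed
    qed
  qed
  then have "enat k \<le> depth_quot S graded_maximal_ideal I"
    unfolding depth_quot_def by (intro SUP_upper2[of "map esym_seq [0..<k]"]) auto
  then have "ereal_of_enat (enat k) \<le> ereal_of_enat (depth_quot S graded_maximal_ideal I)"
    by (simp only: ereal_of_enat_le_iff)
  moreover have "ereal (real (star_packing_number E) - real s + 1) \<le> ereal_of_enat (enat k)"
    by (simp add: k_def)
  ultimately have "ereal (real (star_packing_number E) - real s + 1)
      \<le> ereal_of_enat (depth_quot S graded_maximal_ideal I)"
    by (rule order_trans[rotated])
  then show ?thesis
    unfolding I_def assms(3) symbolic_power_edge_ideal[OF assms(1)] .
qed

end
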